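(* There exists an absolute constant $C>0$ such that for each integer $d\ge 2$, $$\frac{C^{-1}}{\log d}\ \le\ \mathcal N_d\ \le\ \frac{C}{\log d}\,,$$ where $\mathcal N_d$ is the Nadirashvili constant $\mathcal N_d:=\inf_{u\in\mathcal H_d}\operatorname{Area}(\{z\in\mathbb D: u(z)>0\})$.
   Context: $\mathbb D=\{|z|<1\}\subset\mathbb C$ is the unit disc and $\mathbb T=\{|z|=1\}$ the unit circle. $\mathcal H_d$ is the class of all real harmonic functions $u\not\equiv0$ on $\mathbb D$, continuous up to $\mathbb T$, with $u(0)=0$ that have no more than $d$ sign changes on $\mathbb T$. The number of sign changes of a continuous real function $u$ (not of constant weak sign) on the circle is the largest $k$ (possibly $+\infty$) for which there are cyclically ordered points $\zeta_1,\dots,\zeta_k$ on the circle with $u(\zeta_j)u(\zeta_{j+1})<0$ for all $j$, where $\zeta_{k+1}=\zeta_1$. Area is Lebesgue measure in the plane. *)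

theory Defs
  imports "HOL-Analysis.Analysis" "HOL-Library.Extended_Nat"
begin

(* C^2 with vanishing Laplacian.  With z = x + i y, the functions p, q are the first partial
   derivatives of u in x and y; pxx, pxy (resp. qyx, qyy) are the x- and y-derivatives of p
   (resp. q). *)
definition harmonic_on :: "(complex \<Rightarrow> real) \<Rightarrow> complex set \<Rightarrow> bool" where
  "harmonic_on u S \<longleftrightarrow> open S \<and>
     (\<exists>p q pxx pxy qyx qyy.
        (\<forall>z\<in>S. (u has_derivative (\<lambda>h. p z * Re h + q z * Im h)) (at z) \<and>
               (p has_derivative (\<lambda>h. pxx z * Re h + pxy z * Im h)) (at z) \<and>
               (q has_derivative (\<lambda>h. qyx z * Re h + qyy z * Im h)) (at z)) \<and>
        continuous_on S pxx \<and> continuous_on S pxy \<and>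
        continuous_on S qyx \<and> continuous_on S qyy \<and>
        (\<forall>z\<in>S. pxx z + qyy z = 0))"

(* The points \<zeta> 0, ..., \<zeta> (k - 1) of the unit circle are pairwise distinct and are met in this
   order in one counterclockwise turn. *)
definition cyclically_ordered :: "nat \<Rightarrow> (nat \<Rightarrow> complex) \<Rightarrow> bool" where
  "cyclically_ordered k \<zeta> \<longleftrightarrow>
     (\<exists>\<theta>::nat \<Rightarrow> real. strict_mono_on {..<k} \<theta> \<and>
        (\<forall>i<k. \<forall>j<k. \<theta> j < \<theta> i + 2 * pi) \<and>
        (\<forall>j<k. \<zeta> j = cis (\<theta> j)))"

(* The largest such k, or \<infinity> if there is none; the value is 0 for functions of constant weak sign,
   as k = 0 is always admissible.  Indices start at 0, so j + 1 is taken modulo k. *)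
definition sign_changes :: "(complex \<Rightarrow> real) \<Rightarrow> enat" where
  "sign_changes u = Sup {enat k | k. \<exists>\<zeta>. cyclically_ordered k \<zeta> \<and>
      (\<forall>j<k. u (\<zeta> j) * u (\<zeta> ((j + 1) mod k)) < 0)}"

(* Only the values on the closed unit disc matter. *)
definition nadirashvili_class :: "nat \<Rightarrow> (complex \<Rightarrow> real) set" where
  "nadirashvili_class d = {u. harmonic_on u (ball 0 1) \<and> continuous_on (cball 0 1) u \<and>
      (\<exists>z\<in>ball 0 1. u z \<noteq> 0) \<and> u 0 = 0 \<and> sign_changes u \<le> enat d}"

(* A genuine infimum for d \<ge> 2: the areas are nonnegative and the class contains Re. *)
definition nadirashvili_constant :: "nat \<Rightarrow> real" where
  "nadirashvili_constant d =
     (INF u\<in>nadirashvili_class d. measure lebesgue {z \<in> ball 0 1. u z > 0})"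

end

theory Submission
  imports Defs "HOL-Complex_Analysis.Complex_Analysis"
begin

text \<open>Upper bound. There is an entire function that is bounded outside a horizontal strip of fixed width but grows like
  \<open>exp (exp x)\<close> inside it. Rescaling the plane by a factor of order \<open>ln d\<close> and truncating the Taylor series at
  degree \<open>d div 2\<close> gives a polynomial whose real part has at most \<open>d\<close> sign changes on the unit circle and, after
  subtracting its value at the origin, is positive only in a strip of width of order \<open>1 / ln d\<close>.

  Lower bound. Let \<open>u = Re f\<close> with \<open>f 0 = 0\<close>. Few sign changes on the circle bound the growth: between two fixed circles
  \<open>ln (max |f|)\<close> increases by at most a multiple of \<open>d\<close>. Cut the disc into about \<open>ln d\<close> annuli of equal width.
  By convexity of \<open>ln (max |f|)\<close> the increment over an annulus is of the same order as over the preceding one for most of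
  them. In such an annulus take a square of comparable size near a maximum point of \<open>|f|\<close>, where \<open>ln |f|\<close> varies by
  some large \<open>\<Delta>\<close>. Where \<open>u < 0\<close> the argument of \<open>f\<close> is confined to a half-plane, hence bounded, so by the
  Cauchy-Riemann equations the variation of \<open>ln |f|\<close> must come from the set where \<open>u > 0\<close>; as the Dirichlet
  energy of a regularised \<open>ln |f|\<close> is at most of order \<open>\<Delta>\<^sup>2\<close>, that set occupies a fixed proportion of the square.\<close>

section \<open>Integration by parts in the plane\<close>

text \<open>The logarithm comes from counting. For the lower bound take p of order ln d. The
  increments of ln (max |f|) are nondecreasing, start above a constant and end below exp p, so they
  can triple over at most p of 2 p blocks of annuli; each other block has width of order 1 / p and
  contributes area of order 1 / p^2. The first obstacle is the starting constant: the local estimate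
  loses bounded terms (regularising ln |f| at zeros, folding, the bound on the argument), so it is
  empty for slowly growing f such as z. An alternative on inner rings deals with this: at a maximum
  point of Re f, small positive area forces Re f to grow fast, by the mean value inequality. The
  second obstacle is that only Re f is continuous up to the circle, so the growth bound must be
  drawn from moments of Re f alone. For the upper bound, the entire function is an integral over
  {-R..R}; on a disc of radius about R it is approximated by polynomials of degree about exp (2 R),
  so R may be of order ln d.\<close>

lemma integrable_lborel_compact_support:
  fixes f :: "'a::euclidean_space \<Rightarrow> real"
  assumes "compact K" "continuous_on K f" "\<And>z. z \<notin> K \<Longrightarrow> f z = 0"
  shows "integrable lborel f"
proof -
  have "integrable lborel (\<lambda>x. indicator K x *\<^sub>R f x)"
    by (rule borel_integrable_compact[OF assms(1,2)])
  also have "(\<lambda>x. indicator K x *\<^sub>R f x) = f"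
    using assms(3) by (auto simp: indicator_def fun_eq_iff)
  finally show ?thesis .
qed

lemma lborel_integral_eq_integral_cbox:
  fixes f :: "'a::euclidean_space \<Rightarrow> real"
  assumes "continuous_on (cbox A B) f" "\<And>z. z \<notin> cbox A B \<Longrightarrow> f z = 0"
  shows "(\<integral>z. f z \<partial>lborel) = integral (cbox A B) f"
proof -
  have "integrable lborel f"
    using assms by (intro integrable_lborel_compact_support[of "cbox A B"]) auto
  then have "(f has_integral (\<integral>z. f z \<partial>lborel)) UNIV"
    by (rule has_integral_integral_lborel)
  then have "(f has_integral (\<integral>z. f z \<partial>lborel)) (cbox A B)"
    using assms(2) has_integral_on_superset[of f _ "cbox A B" UNIV]
    by (smt (verit, best) UNIV_I has_integral_restrict_UNIV has_integral_cong)
  then show ?thesis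
    by (simp add: integral_unique)
qed

text \<open>Leibniz' rule on a box carries over to \<open>lborel\<close> because the integrands
  vanish outside it. One-sided derivatives at the end points let the parameter fill a closed
  interval.\<close>

lemma has_field_derivative_lborel_integral:
  fixes G G' :: "real \<Rightarrow> 'a::euclidean_space \<Rightarrow> real"
  assumes der: "\<And>t z. t \<in> {a..b} \<Longrightarrow> z \<in> cbox A B \<Longrightarrow>
      ((\<lambda>t. G t z) has_real_derivative G' t z) (at t within {a..b})"
    and G: "\<And>t. t \<in> {a..b} \<Longrightarrow> continuous_on (cbox A B) (G t)"
    and G': "continuous_on ({a..b} \<times> cbox A B) (\<lambda>(t, z). G' t z)"
    and supp: "\<And>t z. t \<in> {a..b} \<Longrightarrow> z \<notin> cbox A B \<Longrightarrow> G t z = 0"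
      "\<And>t z. t \<in> {a..b} \<Longrightarrow> z \<notin> cbox A B \<Longrightarrow> G' t z = 0"
    and t: "t \<in> {a..b}"
  shows "((\<lambda>t. \<integral>z. G t z \<partial>lborel) has_real_derivative (\<integral>z. G' t z \<partial>lborel))
    (at t within {a..b})"
proof -
  have "continuous_on (cbox A B) (G' t)"
    by (rule continuous_on_compose2[OF G', of _ "Pair t", simplified])
      (use t in \<open>auto intro!: continuous_intros\<close>)
  then have *: "(\<integral>z. G' t z \<partial>lborel) = integral (cbox A B) (G' t)"
    using supp t by (intro lborel_integral_eq_integral_cbox) auto
  have "((\<lambda>t. integral (cbox A B) (G t)) has_real_derivative integral (cbox A B) (G' t))
      (at t within {a..b})"
    using der G' G t by (intro leibniz_rule_field_derivative) (auto intro: integrable_continuous)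
  then show ?thesis
    unfolding *
  proof (rule has_field_derivative_transform_within[of _ _ _ _ 1])
    fix x assume "x \<in> {a..b}"
    then show "integral (cbox A B) (G x) = (\<integral>z. G x z \<partial>lborel)"
      using supp G by (intro lborel_integral_eq_integral_cbox[symmetric]) auto
  qed (use t in auto)
qed

lemma lborel_integral_translate:
  fixes f :: "'a::euclidean_space \<Rightarrow> real"
  assumes "f \<in> borel_measurable borel"
  shows "(\<integral>z. f (c + z) \<partial>lborel) = (\<integral>z. f z \<partial>lborel)"
proof -
  have "(\<integral>z. f z \<partial>lborel) = (\<integral>z. f z \<partial>distr lborel borel ((+) c))"
    by (simp add: lborel_distr_plus)
  also have "\<dots> = (\<integral>z. f (c + z) \<partial>lborel)"
    using assms by (subst integral_distr) auto
  finally show ?thesis by simp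
qed

lemma has_real_derivative_shift:
  fixes F :: "complex \<Rightarrow> real"
  assumes "((\<lambda>t. F (z + of_real t0 * e + of_real t * e)) has_real_derivative D) (at 0)"
  shows "((\<lambda>t. F (z + of_real t * e)) has_real_derivative D) (at t0)"
proof -
  have "((\<lambda>t. F (z + of_real t0 * e + of_real (t - t0) * e)) has_real_derivative D) (at t0)"
    using DERIV_shift[of "\<lambda>t. F (z + of_real t0 * e + of_real (t - t0) * e)" D 0 t0] assms
    by (simp add: add.commute)
  then show ?thesis
    by (simp add: algebra_simps)
qed

text \<open>Translation invariance makes the integral of \<open>F (z + t * e)\<close> constant in
  \<open>t\<close>; differentiate under the integral at \<open>t = 0\<close>.\<close>

lemma lborel_integral_derivative_eq_0:
  fixes F D :: "complex \<Rightarrow> real"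
  assumes der: "\<And>z. ((\<lambda>t. F (z + of_real t * e)) has_real_derivative D z) (at 0)"
    and F: "continuous_on UNIV F" and D: "continuous_on UNIV D"
    and supp: "\<And>z. z \<notin> cball p R \<Longrightarrow> F z = 0" "\<And>z. z \<notin> cball p R \<Longrightarrow> D z = 0"
  shows "(\<integral>z. D z \<partial>lborel) = 0"
proof -
  \<comment> \<open>The box contains the ball enlarged by \<open>norm e\<close>, so every translate
    with \<open>|t| \<le> 1\<close> still vanishes outside it.\<close>
  have "bounded (cball p (R + norm e))" by simp
  then obtain A B where AB: "cball p (R + norm e) \<subseteq> cbox A B"
    by (metis bounded_subset_cbox_symmetric)
  have out: "z + of_real t * e \<notin> cball p R" if "t \<in> {-1..1}" "z \<notin> cbox A B" for t z
  proof
    assume "z + of_real t * e \<in> cball p R"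
    moreover have "norm (of_real t * e) \<le> norm e"
      using that mult_right_mono[of "\<bar>t\<bar>" 1 "norm e"] by (simp add: norm_mult abs_le_iff)
    moreover have "dist p z \<le> dist p (z + of_real t * e) + norm (of_real t * e)"
      by (metis add_diff_cancel_left' dist_commute dist_norm dist_triangle)
    ultimately have "z \<in> cball p (R + norm e)" by auto
    then show False using AB that by auto
  qed
  have 1: "((\<lambda>t. \<integral>z. F (z + of_real t * e) \<partial>lborel) has_real_derivative
      (\<integral>z. D (z + of_real 0 * e) \<partial>lborel)) (at 0 within {-1..1})"
  proof (rule has_field_derivative_lborel_integral[of _ _ A B])
    show "((\<lambda>t. F (z + of_real t * e)) has_real_derivative D (z + of_real t * e))
        (at t within {- 1..1})" for t z
      by (rule has_field_derivative_at_within, rule has_real_derivative_shift, rule der)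
    show "continuous_on (cbox A B) (\<lambda>z. F (z + of_real t * e))" for t
      by (intro continuous_on_compose2[OF F] continuous_intros) auto
    show "continuous_on ({- 1..1} \<times> cbox A B) (\<lambda>(t, z). D (z + complex_of_real t * e))"
      unfolding case_prod_beta by (intro continuous_on_compose2[OF D] continuous_intros) auto
  qed (use out supp in auto)
  have meas: "F \<in> borel_measurable borel"
    using F by (simp add: borel_measurable_continuous_onI)
  have 2: "(\<lambda>t. \<integral>z. F (z + of_real t * e) \<partial>lborel) = (\<lambda>t. \<integral>z. F z \<partial>lborel)"
    by (subst add.commute) (simp only: lborel_integral_translate[OF meas])
  have "((\<lambda>t. \<integral>z. F (z + of_real t * e) \<partial>lborel) has_real_derivative 0) (at 0 within {-1..1})"
    unfolding 2 by simp
  moreover have "at (0::real) within {-1..1} = at 0"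
    by (rule at_within_interior) auto
  ultimately show ?thesis
    using 1 DERIV_unique by fastforce
qed

text \<open>The set \<open>S\<close> and the complement of the ball form an open cover of the plane;
  on the second set the product is zero, whatever values \<open>A\<close> takes outside
  \<open>S\<close>.\<close>

lemma continuous_on_mult_supported:
  fixes A b :: "complex \<Rightarrow> real"
  assumes "open S" "cball p R \<subseteq> S" "continuous_on UNIV b" "\<And>z. z \<notin> cball p R \<Longrightarrow> b z = 0"
    and "continuous_on S A"
  shows "continuous_on UNIV (\<lambda>z. b z * A z)"
proof -
  have "continuous_on (S \<union> - cball p R) (\<lambda>z. b z * A z)"
  proof (rule continuous_on_open_Un)
    show "continuous_on S (\<lambda>z. b z * A z)"
      by (intro continuous_intros assms continuous_on_subset[OF assms(3)]) auto
    show "continuous_on (- cball p R) (\<lambda>z. b z * A z)"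
      by (rule continuous_on_eq[of _ "\<lambda>_. 0"]) (use assms in auto)
  qed (use assms in auto)
  moreover have "S \<union> - cball p R = UNIV" using assms by auto
  ultimately show ?thesis by simp
qed

lemma integrable_mult_supported:
  fixes A b :: "complex \<Rightarrow> real"
  assumes "open S" "cball p R \<subseteq> S" "continuous_on UNIV b" "\<And>z. z \<notin> cball p R \<Longrightarrow> b z = 0"
    and "continuous_on S A"
  shows "integrable lborel (\<lambda>z. b z * A z)"
  using continuous_on_mult_supported[OF assms] assms(4)
  by (intro integrable_lborel_compact_support[of "cball p R"]) (auto intro: continuous_on_subset)

text \<open>This is \<open>lborel_integral_derivative_eq_0\<close> for the product
  \<open>b * A\<close>.\<close>

lemma lborel_integration_by_parts:
  fixes A A' b b' :: "complex \<Rightarrow> real"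
  assumes S: "open S" "cball p R \<subseteq> S"
    and b: "\<And>z. ((\<lambda>t. b (z + of_real t * e)) has_real_derivative b' z) (at 0)"
    and cb: "continuous_on UNIV b" "continuous_on UNIV b'"
    and supp: "\<And>z. z \<notin> cball p R \<Longrightarrow> b z = 0" "\<And>z. z \<notin> cball p R \<Longrightarrow> b' z = 0"
    and A: "\<And>z. z \<in> S \<Longrightarrow> ((\<lambda>t. A (z + of_real t * e)) has_real_derivative A' z) (at 0)"
    and cA: "continuous_on S A" "continuous_on S A'"
  shows "(\<integral>z. b z * A' z \<partial>lborel) = - (\<integral>z. b' z * A z \<partial>lborel)"
proof -
  have "(\<integral>z. b' z * A z + b z * A' z \<partial>lborel) = 0"
  proof (rule lborel_integral_derivative_eq_0)
    fix z
    show "((\<lambda>t. b (z + of_real t * e) * A (z + of_real t * e)) has_real_derivative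
        b' z * A z + b z * A' z) (at 0)"
    proof (cases "z \<in> S")
      case True
      from DERIV_mult[OF b[of z] A[OF True]] show ?thesis by (simp add: algebra_simps)
    next
      \<comment> \<open>Here \<open>b\<close> vanishes on a whole neighbourhood of \<open>z\<close>,
        so the product has derivative 0 although nothing is known about \<open>A\<close>.\<close>
      case False
      then have z: "z \<notin> cball p R" using S by auto
      have "((\<lambda>t. z + complex_of_real t * e) \<longlongrightarrow> z + of_real 0 * e) (at 0)"
        by (intro tendsto_intros)
      then have "\<forall>\<^sub>F t in at 0. z + complex_of_real t * e \<in> - cball p R"
        using z by (intro topological_tendstoD) auto
      then have "\<forall>\<^sub>F t in nhds 0. b (z + of_real t * e) * A (z + of_real t * e) = 0"
        unfolding eventually_at_filter by eventually_elim (use supp z in auto)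
      then have "((\<lambda>t. b (z + of_real t * e) * A (z + of_real t * e)) has_real_derivative 0) (at 0)"
        by (subst DERIV_cong_ev[OF refl _ refl, of _ "\<lambda>_. 0"]) auto
      then show ?thesis using supp z by simp
    qed
    show "continuous_on UNIV (\<lambda>z. b z * A z)"
      by (rule continuous_on_mult_supported[OF S cb(1) supp(1) cA(1)])
    show "continuous_on UNIV (\<lambda>z. b' z * A z + b z * A' z)"
      by (intro continuous_intros continuous_on_mult_supported[OF S cb(2) supp(2) cA(1)]
          continuous_on_mult_supported[OF S cb(1) supp(1) cA(2)])
  qed (use supp in auto)
  then show ?thesis
    using integrable_mult_supported[OF S cb(2) supp(2) cA(1)]
      integrable_mult_supported[OF S cb(1) supp(1) cA(2)] by simp
qed

section \<open>Bump functions with polynomial profile\<close>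

lemma has_real_derivative_pos_part_power:
  "((\<lambda>x::real. max 0 x ^ Suc (Suc n)) has_real_derivative real (Suc (Suc n)) * max 0 x ^ Suc n) (at x)"
proof -
  consider "x < 0" | "x = 0" | "x > 0" by linarith
  then show ?thesis
  proof cases
    case 1
    have "((\<lambda>x::real. 0) has_real_derivative 0) (at x)" by simp
    then have "((\<lambda>x::real. max 0 x ^ Suc (Suc n)) has_real_derivative 0) (at x)"
      by (rule has_field_derivative_transform_within_open[of _ _ _ "{..<0}"]) (use 1 in auto)
    then show ?thesis using 1 by simp
  next
    case 2
    \<comment> \<open>The difference quotient at 0 is dominated by \<open>|h| ^ (n + 1)\<close>,
      which tends to 0 because the exponent of the power is at least 2.\<close>
    have "((\<lambda>h::real. \<bar>h\<bar> ^ Suc n) \<longlongrightarrow> \<bar>0\<bar> ^ Suc n) (at 0)" by (intro tendsto_intros)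
    then have "((\<lambda>h::real. max 0 h ^ Suc (Suc n) / h) \<longlongrightarrow> 0) (at 0)"
    proof (rule Lim_null_comparison[rotated, OF tendsto_eq_rhs])
      show "\<forall>\<^sub>F h::real in at 0. norm (max 0 h ^ Suc (Suc n) / h) \<le> \<bar>h\<bar> ^ Suc n"
        by (intro always_eventually allI) (auto simp: max_def abs_mult power_abs mult_nonpos_nonneg)
    qed auto
    then show ?thesis using 2 by (simp add: DERIV_def)
  next
    case 3
    have "((\<lambda>x::real. x ^ Suc (Suc n)) has_real_derivative real (Suc (Suc n)) * x ^ Suc n) (at x)"
      by (rule derivative_eq_intros refl | simp)+
    then have "((\<lambda>x::real. max 0 x ^ Suc (Suc n)) has_real_derivative real (Suc (Suc n)) * x ^ Suc n) (at x)"
      by (rule has_field_derivative_transform_within_open[of _ _ _ "{0<..}"]) (use 3 in auto)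
    then show ?thesis using 3 by simp
  qed
qed

text \<open>A power of a quadratic instead of a smooth bump: differentiation lowers the exponent by
  one and multiplies by a linear form, so gradients and Laplacians of bumps are explicit and are
  again made of bumps.\<close>

definition cutoff :: "nat \<Rightarrow> complex \<Rightarrow> real \<Rightarrow> complex \<Rightarrow> real" where
  "cutoff n p R z = max 0 (1 - (cmod (z - p) / R)\<^sup>2) ^ n"

lemma cutoff_nonneg [simp]: "cutoff n p R z \<ge> 0"
  by (simp add: cutoff_def)

lemma cutoff_le_1: "cutoff n p R z \<le> 1"
  unfolding cutoff_def by (intro power_le_one) auto

lemma cutoff_eq_0:
  assumes "n > 0" "R > 0" "z \<notin> ball p R"
  shows "cutoff n p R z = 0"
proof -
  have "1 \<le> cmod (z - p) / R" using assms by (auto simp: dist_norm norm_minus_commute)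
  then have "1 \<le> (cmod (z - p) / R)\<^sup>2" by (rule one_le_power)
  then show ?thesis using assms by (simp add: cutoff_def max_def)
qed

lemma continuous_on_cutoff [continuous_intros]:
  "continuous_on A g \<Longrightarrow> continuous_on A (\<lambda>x. cutoff n p R (g x))"
  unfolding cutoff_def divide_inverse by (intro continuous_intros)

lemma cutoff_has_derivative:
  "((\<lambda>t. cutoff (Suc (Suc n)) p R (z + of_real t * e)) has_real_derivative
     real (Suc (Suc n)) * cutoff (Suc n) p R z * (- 2 * ((z - p) \<bullet> e) / R\<^sup>2)) (at 0)"
proof -
  define c where "c = inverse (R\<^sup>2)"
  have eq: "1 - (cmod (w - p) / R)\<^sup>2 = 1 - ((Re w - Re p)\<^sup>2 + (Im w - Im p)\<^sup>2) * c" for w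
    unfolding power_divide cmod_power2 c_def by (simp add: divide_inverse)
  have "((\<lambda>t. 1 - (cmod (z + of_real t * e - p) / R)\<^sup>2) has_real_derivative
      (- 2 * ((z - p) \<bullet> e) / R\<^sup>2)) (at 0)"
    unfolding eq
    by (rule derivative_eq_intros refl | simp)+
      (simp add: inner_complex_def c_def divide_inverse algebra_simps)
  from DERIV_chain2[OF has_real_derivative_pos_part_power this] show ?thesis
    by (simp add: cutoff_def)
qed

lemma continuous_on_mult_cutoff:
  fixes H :: "real \<Rightarrow> complex \<Rightarrow> real"
  assumes b: "continuous_on UNIV b" "\<And>z. z \<notin> ball p R \<Longrightarrow> b z = 0"
    and T: "closed T"
    and H: "continuous_on (T \<times> cball p R) (\<lambda>(t, z). H t z)"
  shows "continuous_on (T \<times> UNIV) (\<lambda>(t, z). b z * H t z)"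
proof -
  have "continuous_on (T \<times> cball p R \<union> T \<times> (- ball p R)) (\<lambda>(t, z). b z * H t z)"
  proof (rule continuous_on_closed_Un)
    show "continuous_on (T \<times> cball p R) (\<lambda>(t, z). b z * H t z)"
      using H unfolding case_prod_beta
      by (intro continuous_intros continuous_on_compose2[OF b(1)]) auto
    show "continuous_on (T \<times> (- ball p R)) (\<lambda>(t, z). b z * H t z)"
      by (rule continuous_on_eq[of _ "\<lambda>_. 0"]) (use b in auto)
  qed (use T in \<open>auto intro!: closed_Times\<close>)
  moreover have "T \<times> cball p R \<union> T \<times> (- ball p R) = T \<times> UNIV" by auto
  ultimately show ?thesis by simp
qed

lemma has_field_derivative_lborel_integral_cutoff:
  fixes H H' :: "real \<Rightarrow> complex \<Rightarrow> real"
  assumes b: "continuous_on UNIV b" "\<And>z. z \<notin> ball p R \<Longrightarrow> b z = 0"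
    and der: "\<And>t z. t \<in> {\<alpha>..\<beta>} \<Longrightarrow> z \<in> cball p R \<Longrightarrow>
      ((\<lambda>t. H t z) has_real_derivative H' t z) (at t within {\<alpha>..\<beta>})"
    and H: "continuous_on ({\<alpha>..\<beta>} \<times> cball p R) (\<lambda>(t, z). H t z)"
    and H': "continuous_on ({\<alpha>..\<beta>} \<times> cball p R) (\<lambda>(t, z). H' t z)"
    and t: "t \<in> {\<alpha>..\<beta>}"
  shows "((\<lambda>t. \<integral>z. b z * H t z \<partial>lborel) has_real_derivative (\<integral>z. b z * H' t z \<partial>lborel))
    (at t within {\<alpha>..\<beta>})"
proof -
  obtain A B where AB: "cball p R \<subseteq> cbox A B"
    by (metis bounded_subset_cbox_symmetric bounded_cball)
  have c: "continuous_on ({\<alpha>..\<beta>} \<times> UNIV) (\<lambda>(t, z). b z * H t z)"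
    "continuous_on ({\<alpha>..\<beta>} \<times> UNIV) (\<lambda>(t, z). b z * H' t z)"
    by (intro continuous_on_mult_cutoff[OF b]; use H H' in simp)+
  show ?thesis
  proof (rule has_field_derivative_lborel_integral[of _ _ A B])
    fix t z assume t: "t \<in> {\<alpha>..\<beta>}"
    show "((\<lambda>t. b z * H t z) has_real_derivative b z * H' t z) (at t within {\<alpha>..\<beta>})"
    proof (cases "z \<in> cball p R")
      case True
      then show ?thesis by (intro DERIV_cmult der t)
    next
      case False
      then show ?thesis using b(2)[of z] by auto
    qed
    show "continuous_on (cbox A B) (\<lambda>z. b z * H t z)"
      by (rule continuous_on_compose2[OF c(1), of _ "Pair t", simplified])
        (use t in \<open>auto intro!: continuous_intros\<close>)
    show "b z * H t z = 0" "b z * H' t z = 0" if "z \<notin> cbox A B"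
    proof -
      have "z \<notin> ball p R" using that AB ball_subset_cball by blast
      then show "b z * H t z = 0" "b z * H' t z = 0" using b(2) by auto
    qed
  next
    show "continuous_on ({\<alpha>..\<beta>} \<times> cbox A B) (\<lambda>(t, z). b z * H' t z)"
      by (rule continuous_on_subset[OF c(2)]) auto
  qed fact
qed

section \<open>Laplacians integrated against bumps\<close>

definition C2_on :: "complex set \<Rightarrow> (complex \<Rightarrow> real) \<Rightarrow> (complex \<Rightarrow> real) \<Rightarrow> (complex \<Rightarrow> real) \<Rightarrow>
    (complex \<Rightarrow> real) \<Rightarrow> (complex \<Rightarrow> real) \<Rightarrow> bool" where
  "C2_on S Y Yx Yy Yxx Yyy \<longleftrightarrow> open S \<and>
    (\<forall>z\<in>S. (Y has_derivative (\<lambda>h. Yx z * Re h + Yy z * Im h)) (at z) \<and>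
      ((\<lambda>t. Yx (z + of_real t * 1)) has_real_derivative Yxx z) (at 0) \<and>
      ((\<lambda>t. Yy (z + of_real t * \<i>)) has_real_derivative Yyy z) (at 0)) \<and>
    continuous_on S Yx \<and> continuous_on S Yy \<and> continuous_on S Yxx \<and> continuous_on S Yyy"

lemma has_derivative_along_line:
  assumes "(Y has_derivative D) (at (z :: complex))"
  shows "((\<lambda>t. Y (z + of_real t * e)) has_real_derivative D e) (at 0)"
proof -
  have 1: "((\<lambda>t. z + of_real t * e) has_derivative (\<lambda>t. of_real t * e)) (at 0)"
    by (auto intro!: derivative_eq_intros)
  have "((\<lambda>t. Y (z + of_real t * e)) has_derivative (\<lambda>t. D (of_real t * e))) (at 0)"
    using diff_chain_at[OF 1, of Y D] assms by (simp add: o_def)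
  moreover have "D (of_real t * e) = D e * t" for t
    using linear_scale[OF has_derivative_linear[OF assms], of t e]
    by (simp add: scaleR_conv_of_real mult.commute)
  ultimately show ?thesis by (simp add: has_field_derivative_def)
qed

lemma C2_on_line:
  assumes "C2_on S Y Yx Yy Yxx Yyy" "z \<in> S"
  shows "((\<lambda>t. Y (z + of_real t * e)) has_real_derivative Yx z * Re e + Yy z * Im e) (at 0)"
  using assms has_derivative_along_line[of Y _ z e] unfolding C2_on_def by blast

lemma C2_on_continuous: "C2_on S Y Yx Yy Yxx Yyy \<Longrightarrow> continuous_on S Y"
  unfolding C2_on_def
  by (meson continuous_at_imp_continuous_on has_derivative_continuous)

text \<open>The derivative of \<open>\<integral> cutoff 2 p R z * Y (p + t (z - p)) dz\<close> in \<open>t\<close> is a positive multiple of an integral of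
  the Laplacian, because \<open>cutoff 2 p R z * (z - p)\<close> is a multiple of the gradient of \<open>cutoff 3 p R\<close>.\<close>

lemma cutoff_submean:
  assumes Y: "C2_on S Y Yx Yy Yxx Yyy" and S: "cball p R \<subseteq> S" and R: "R > 0"
    and sub: "\<And>z. z \<in> S \<Longrightarrow> Yxx z + Yyy z \<ge> 0"
  shows "Y p * (\<integral>z. cutoff 2 p R z \<partial>lborel) \<le> (\<integral>z. cutoff 2 p R z * Y z \<partial>lborel)"
proof -
  define w where "w t z = p + of_real t * (z - p)" for t z
  \<comment> \<open>\<open>N 0\<close> and \<open>N 1\<close> are the two sides of the claim, as
    \<open>w t\<close> contracts the disc to \<open>p\<close>; it suffices that
    \<open>N' \<ge> 0\<close>.\<close>
  define N where "N t = (\<integral>z. cutoff 2 p R z * Y (w t z) \<partial>lborel)" for t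
  define N' where "N' t = (\<integral>z. cutoff 2 p R z * (Yx (w t z) * Re (z - p) + Yy (w t z) * Im (z - p)) \<partial>lborel)" for t
  have "open S" and cont: "continuous_on S Y" "continuous_on S Yx" "continuous_on S Yy"
      "continuous_on S Yxx" "continuous_on S Yyy"
    using Y C2_on_continuous[OF Y] by (auto simp: C2_on_def)
  have w: "w t z \<in> S" if "t \<in> {0..1}" "z \<in> cball p R" for t z
  proof -
    have "dist p (w t z) = \<bar>t\<bar> * dist p z"
      by (simp add: w_def dist_norm norm_mult norm_minus_commute)
    also have "\<dots> \<le> 1 * dist p z" using that by (intro mult_right_mono) auto
    finally have "w t z \<in> cball p R" using that by simp
    then show ?thesis using S by auto
  qed
  have cw': "continuous_on ({0..1} \<times> cball p R) (\<lambda>x. F (w (fst x) (snd x)))"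
    if "continuous_on S F" for F :: "complex \<Rightarrow> real"
  proof (rule continuous_on_compose2[OF that])
    show "continuous_on ({0..1} \<times> cball p R) (\<lambda>x. w (fst x) (snd x))"
      unfolding w_def by (intro continuous_intros)
  qed (use w in auto)
  have der: "(N has_real_derivative N' t) (at t within {0..1})" if "t \<in> {0..1}" for t
    unfolding N_def[abs_def] N'_def
  proof (rule has_field_derivative_lborel_integral_cutoff[of _ p R, OF _ _ _ _ _ that])
    show "((\<lambda>t. Y (w t z)) has_real_derivative Yx (w t z) * Re (z - p) + Yy (w t z) * Im (z - p))
        (at t within {0..1})" if "t \<in> {0..1}" "z \<in> cball p R" for t z
    proof (rule has_field_derivative_at_within)
      have "((\<lambda>s. Y (p + of_real t * (z - p) + of_real s * (z - p))) has_real_derivative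
          Yx (w t z) * Re (z - p) + Yy (w t z) * Im (z - p)) (at 0)"
        using C2_on_line[OF Y w[OF that], of "z - p"] by (simp only: w_def)
      from has_real_derivative_shift[OF this]
      show "((\<lambda>t. Y (w t z)) has_real_derivative Yx (w t z) * Re (z - p) + Yy (w t z) * Im (z - p)) (at t)"
        by (simp only: w_def)
    qed
    show "continuous_on ({0..1} \<times> cball p R) (\<lambda>(t, z). Y (w t z))"
      unfolding case_prod_beta by (intro cw' cont)
    show "continuous_on ({0..1} \<times> cball p R) (\<lambda>(t, z). Yx (w t z) * Re (z - p) + Yy (w t z) * Im (z - p))"
      unfolding case_prod_beta by (intro continuous_intros cw' cont)
    show "cutoff 2 p R z = 0" if "z \<notin> ball p R" for z
      using that R by (simp add: cutoff_eq_0)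
    show "continuous_on UNIV (cutoff 2 p R)"
      by (intro continuous_intros continuous_on_id)
  qed
  have N'_nonneg: "N' t \<ge> 0" if t: "t \<in> {0..1}" for t
  proof -
    define S' where "S' = (\<lambda>z. w t z) -` S"
    have cwt: "continuous_on A (\<lambda>z. w t z)" for A
      unfolding w_def by (intro continuous_intros)
    have S': "open S'" "cball p R \<subseteq> S'"
      using continuous_open_vimage[OF \<open>open S\<close>, of "\<lambda>z. w t z"] cwt[of UNIV] w[OF t]
      by (auto simp: S'_def continuous_on_eq_continuous_at)
    have cS: "continuous_on S' (\<lambda>z. F (w t z))" if "continuous_on S F" for F :: "complex \<Rightarrow> real"
      by (rule continuous_on_compose2[OF that cwt]) (auto simp: S'_def)
    have dir: "(\<integral>z. cutoff 3 p R z * (t * F' (w t z)) \<partial>lborel) =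
        6 / R\<^sup>2 * (\<integral>z. cutoff 2 p R z * (F (w t z) * ((z - p) \<bullet> e)) \<partial>lborel)"
      if F: "\<And>z. z \<in> S \<Longrightarrow> ((\<lambda>t. F (z + of_real t * e)) has_real_derivative F' z) (at 0)"
        and cF: "continuous_on S F" "continuous_on S F'" for F F' e
    proof -
      have "(\<integral>z. cutoff 3 p R z * (t * F' (w t z)) \<partial>lborel) =
         - (\<integral>z. (real (Suc (Suc 1)) * cutoff (Suc 1) p R z * (- 2 * ((z - p) \<bullet> e) / R\<^sup>2)) * F (w t z) \<partial>lborel)"
      proof (rule lborel_integration_by_parts[OF S', of _ e])
        fix z assume "z \<in> S'"
        then have 1: "((\<lambda>s. F (w t z + of_real s * e)) has_real_derivative F' (w t z)) (at (t * 0))"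
          using F by (simp add: S'_def)
        have "((\<lambda>s. F (w t z + of_real (t * s) * e)) has_real_derivative F' (w t z) * t) (at 0)"
          by (rule DERIV_chain2[of "\<lambda>s. F (w t z + of_real s * e)" _ "\<lambda>s. t * s", OF 1])
            (auto intro!: derivative_eq_intros)
        then show "((\<lambda>s. F (w t (z + of_real s * e))) has_real_derivative t * F' (w t z)) (at 0)"
          by (simp add: w_def algebra_simps)
      next
        show "((\<lambda>s. cutoff 3 p R (z + of_real s * e)) has_real_derivative
          real (Suc (Suc 1)) * cutoff (Suc 1) p R z * (- 2 * ((z - p) \<bullet> e) / R\<^sup>2)) (at 0)" for z
          using cutoff_has_derivative[of 1 p R z e] by (simp add: numeral_3_eq_3)
      qed (use R S' in \<open>auto intro!: continuous_intros cS cF cutoff_eq_0 simp: divide_inverse\<close>)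
      also have "\<dots> = (\<integral>z. 6 / R\<^sup>2 * (cutoff 2 p R z * (F (w t z) * ((z - p) \<bullet> e))) \<partial>lborel)"
        unfolding integral_minus[symmetric]
        by (intro Bochner_Integration.integral_cong refl) (simp add: numeral_2_eq_2 algebra_simps divide_inverse)
      finally show ?thesis by simp
    qed
    have int: "integrable lborel (\<lambda>z. cutoff (Suc n) p R z * F z)" if "continuous_on S' F" for F n
      using that S' R by (intro integrable_mult_supported[OF S']) (auto intro!: continuous_intros cutoff_eq_0)
    have "N' t = (\<integral>z. cutoff 2 p R z * (Yx (w t z) * ((z - p) \<bullet> 1)) + cutoff 2 p R z * (Yy (w t z) * ((z - p) \<bullet> \<i>)) \<partial>lborel)"
      unfolding N'_def by (simp add: inner_complex_def algebra_simps)
    also have "\<dots> = (\<integral>z. cutoff 2 p R z * (Yx (w t z) * ((z - p) \<bullet> 1)) \<partial>lborel) +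
        (\<integral>z. cutoff 2 p R z * (Yy (w t z) * ((z - p) \<bullet> \<i>)) \<partial>lborel)"
      unfolding numeral_2_eq_2
      by (rule Bochner_Integration.integral_add; rule int; intro continuous_intros cS cont)
    finally have "N' t = (\<integral>z. cutoff 2 p R z * (Yx (w t z) * ((z - p) \<bullet> 1)) \<partial>lborel) +
        (\<integral>z. cutoff 2 p R z * (Yy (w t z) * ((z - p) \<bullet> \<i>)) \<partial>lborel)" .
    moreover have "(\<integral>z. cutoff 3 p R z * (t * Yxx (w t z)) \<partial>lborel) =
        6 / R\<^sup>2 * (\<integral>z. cutoff 2 p R z * (Yx (w t z) * ((z - p) \<bullet> 1)) \<partial>lborel)"
      using Y cont by (intro dir) (auto simp: C2_on_def)
    moreover have "(\<integral>z. cutoff 3 p R z * (t * Yyy (w t z)) \<partial>lborel) =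
        6 / R\<^sup>2 * (\<integral>z. cutoff 2 p R z * (Yy (w t z) * ((z - p) \<bullet> \<i>)) \<partial>lborel)"
      using Y cont by (intro dir) (auto simp: C2_on_def)
    ultimately have "6 / R\<^sup>2 * N' t = (\<integral>z. cutoff 3 p R z * (t * Yxx (w t z)) \<partial>lborel) +
        (\<integral>z. cutoff 3 p R z * (t * Yyy (w t z)) \<partial>lborel)"
      by (simp only: distrib_left)
    also have "\<dots> = (\<integral>z. cutoff 3 p R z * (t * Yxx (w t z)) + cutoff 3 p R z * (t * Yyy (w t z)) \<partial>lborel)"
      unfolding numeral_3_eq_3
      by (rule Bochner_Integration.integral_add[symmetric]; rule int; intro continuous_intros cS cont)
    also have "\<dots> \<ge> 0"
    proof (rule Bochner_Integration.integral_nonneg)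
      fix z
      show "0 \<le> cutoff 3 p R z * (t * Yxx (w t z)) + cutoff 3 p R z * (t * Yyy (w t z))"
      proof (cases "z \<in> cball p R")
        case True
        then have "0 \<le> cutoff 3 p R z * (t * (Yxx (w t z) + Yyy (w t z)))"
          using sub w t by (intro mult_nonneg_nonneg) auto
        then show ?thesis by (simp add: algebra_simps)
      next
        case False
        then show ?thesis using R by (subst (1 2) cutoff_eq_0) auto
      qed
    qed
    finally have "0 \<le> 6 / R\<^sup>2 * N' t" .
    moreover have "6 / R\<^sup>2 > 0" using R by simp
    ultimately show ?thesis using zero_le_mult_iff by (metis not_le)
  qed
  have "\<exists>t\<in>{0<..<1}. N 1 - N 0 = (N' t * (1 - 0))"
    using der by (intro mvt_simple) (auto simp: has_field_derivative_def mult_commute_abs)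
  then obtain t where "t \<in> {0<..<1}" "N 1 - N 0 = N' t" by auto
  then have "N 0 \<le> N 1" using N'_nonneg[of t] by simp
  then show ?thesis by (simp add: N_def w_def mult.commute)
qed

text \<open>Two integrations by parts along each axis move both derivatives onto the bump. The
  exponent 3 leaves a continuous \<open>cutoff 1\<close> after two differentiations, and the weight
  on the right is the Laplacian of \<open>cutoff 3 p R\<close>.\<close>

lemma cutoff_laplacian:
  assumes Z: "C2_on S Z Zx Zy Zxx Zyy" and S: "cball p R \<subseteq> S" and R: "R > 0"
  shows "(\<integral>z. cutoff 3 p R z * (Zxx z + Zyy z) \<partial>lborel) =
    (\<integral>z. (24 / R ^ 4 * (cmod (z - p))\<^sup>2 * cutoff 1 p R z - 12 / R\<^sup>2 * cutoff 2 p R z) * Z z \<partial>lborel)"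
proof -
  have "open S" and cont: "continuous_on S Z" "continuous_on S Zx" "continuous_on S Zy"
      "continuous_on S Zxx" "continuous_on S Zyy"
    using Z C2_on_continuous[OF Z] by (auto simp: C2_on_def)
  note S = \<open>open S\<close> S
  define c3' where "c3' e z = - 6 / R\<^sup>2 * cutoff 2 p R z * ((z - p) \<bullet> e)" for e z
  define c3'' where "c3'' e z = 24 / R ^ 4 * ((z - p) \<bullet> e)\<^sup>2 * cutoff 1 p R z - 6 / R\<^sup>2 * (e \<bullet> e) * cutoff 2 p R z" for e z
  have int: "integrable lborel (\<lambda>z. b z * F z)" if "continuous_on S F" "continuous_on UNIV b"
      "\<And>z. z \<notin> cball p R \<Longrightarrow> b z = 0" for F b :: "complex \<Rightarrow> real"
    using that by (intro integrable_mult_supported[OF S]) auto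
  have dir: "(\<integral>z. cutoff 3 p R z * Fee z \<partial>lborel) = (\<integral>z. c3'' e z * F z \<partial>lborel)"
    if F: "\<And>z. z \<in> S \<Longrightarrow> ((\<lambda>t. F (z + of_real t * e)) has_real_derivative Fe z) (at 0)"
      "\<And>z. z \<in> S \<Longrightarrow> ((\<lambda>t. Fe (z + of_real t * e)) has_real_derivative Fee z) (at 0)"
      and cF: "continuous_on S F" "continuous_on S Fe" "continuous_on S Fee" for F Fe Fee e
  proof -
    have d2: "((\<lambda>t. cutoff 2 p R (z + of_real t * e)) has_real_derivative
         2 * cutoff 1 p R z * (- 2 * ((z - p) \<bullet> e) / R\<^sup>2)) (at 0)" for z
      using cutoff_has_derivative[of 0 p R z e] by (simp add: numeral_2_eq_2)
    have d3: "((\<lambda>t. cutoff 3 p R (z + of_real t * e)) has_real_derivative c3' e z) (at 0)" for z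
      using cutoff_has_derivative[of 1 p R z e] by (simp add: numeral_3_eq_3 numeral_2_eq_2 c3'_def field_simps)
    have di: "((\<lambda>t. (z + of_real t * e - p) \<bullet> e) has_real_derivative e \<bullet> e) (at 0)" for z
      unfolding inner_complex_def by (rule derivative_eq_intros refl | simp)+
    have d3': "((\<lambda>t. c3' e (z + of_real t * e)) has_real_derivative c3'' e z) (at 0)" for z
      unfolding c3'_def c3''_def
      by (rule derivative_eq_intros d2 di refl)+ (simp add: power2_eq_square power4_eq_xxxx divide_inverse algebra_simps)
    have "(\<integral>z. cutoff 3 p R z * Fee z \<partial>lborel) = - (\<integral>z. c3' e z * Fe z \<partial>lborel)"
      by (rule lborel_integration_by_parts[OF S d3 _ _ _ _ F(2)])
        (use R in \<open>auto intro!: continuous_intros cF cutoff_eq_0 simp: c3'_def\<close>)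
    also have "(\<integral>z. c3' e z * Fe z \<partial>lborel) = - (\<integral>z. c3'' e z * F z \<partial>lborel)"
      by (rule lborel_integration_by_parts[OF S d3' _ _ _ _ F(1)])
        (use R in \<open>auto intro!: continuous_intros cF simp: c3'_def c3''_def cutoff_eq_0\<close>)
    finally show ?thesis by simp
  qed
  have "(\<integral>z. cutoff 3 p R z * (Zxx z + Zyy z) \<partial>lborel) =
     (\<integral>z. cutoff 3 p R z * Zxx z \<partial>lborel) + (\<integral>z. cutoff 3 p R z * Zyy z \<partial>lborel)"
    unfolding distrib_left using R
    by (intro Bochner_Integration.integral_add int cont) (auto intro!: continuous_intros cutoff_eq_0)
  also have "(\<integral>z. cutoff 3 p R z * Zxx z \<partial>lborel) = (\<integral>z. c3'' 1 z * Z z \<partial>lborel)"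
    using Z C2_on_line[OF Z, of _ 1] cont by (intro dir[of _ _ Zx]) (auto simp: C2_on_def)
  also have "(\<integral>z. cutoff 3 p R z * Zyy z \<partial>lborel) = (\<integral>z. c3'' \<i> z * Z z \<partial>lborel)"
    using Z C2_on_line[OF Z, of _ \<i>] cont by (intro dir[of _ _ Zy]) (auto simp: C2_on_def)
  also have "(\<integral>z. c3'' 1 z * Z z \<partial>lborel) + (\<integral>z. c3'' \<i> z * Z z \<partial>lborel) =
      (\<integral>z. c3'' 1 z * Z z + c3'' \<i> z * Z z \<partial>lborel)"
    by (rule Bochner_Integration.integral_add[symmetric]; rule int)
      (use R in \<open>auto intro!: continuous_intros cont simp: c3''_def cutoff_eq_0\<close>)
  also have "\<dots> = (\<integral>z. (24 / R ^ 4 * (cmod (z - p))\<^sup>2 * cutoff 1 p R z - 12 / R\<^sup>2 * cutoff 2 p R z) * Z z \<partial>lborel)"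
    by (intro Bochner_Integration.integral_cong refl)
      (simp add: c3''_def inner_complex_def cmod_power2 algebra_simps)
  finally show ?thesis .
qed

text \<open>Since \<open>Z\<close> is nonnegative, the negative part of the Laplacian of the bump
  may be dropped; the positive part is at most \<open>24 / R^2\<close>.\<close>

lemma cutoff_laplacian_le:
  assumes Z: "C2_on S Z Zx Zy Zxx Zyy" and S: "cball p R \<subseteq> S" and R: "R > 0"
    and B: "\<And>z. z \<in> cball p R \<Longrightarrow> 0 \<le> Z z \<and> Z z \<le> B"
  shows "(\<integral>z. cutoff 3 p R z * (Zxx z + Zyy z) \<partial>lborel) \<le> 24 * B / R\<^sup>2 * measure lborel (cball p R)"
proof -
  have "(\<integral>z. cutoff 3 p R z * (Zxx z + Zyy z) \<partial>lborel) \<le> (\<integral>z. 24 * B / R\<^sup>2 * indicator (cball p R) z \<partial>lborel)"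
    unfolding cutoff_laplacian[OF Z S R]
  proof (rule integral_mono)
    have "open S" "continuous_on S Z" using Z C2_on_continuous[OF Z] by (auto simp: C2_on_def)
    then show "integrable lborel (\<lambda>z. (24 / R ^ 4 * (cmod (z - p))\<^sup>2 * cutoff 1 p R z - 12 / R\<^sup>2 * cutoff 2 p R z) * Z z)"
      using R by (intro integrable_mult_supported[OF _ S])
        (auto intro!: continuous_intros simp: cutoff_eq_0)
    show "integrable lborel (\<lambda>z. 24 * B / R\<^sup>2 * indicat_real (cball p R) z)"
      by (intro integrable_mult_right integrable_real_indicator) (use emeasure_bounded_finite[of "cball p R"] in auto)
    fix z
    show "(24 / R ^ 4 * (cmod (z - p))\<^sup>2 * cutoff 1 p R z - 12 / R\<^sup>2 * cutoff 2 p R z) * Z z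
        \<le> 24 * B / R\<^sup>2 * indicat_real (cball p R) z"
    proof (cases "z \<in> cball p R")
      case True
      then have "cmod (z - p) \<le> R" by (simp add: dist_norm norm_minus_commute)
      then have "(cmod (z - p))\<^sup>2 \<le> R\<^sup>2" by (intro power_mono) auto
      then have "24 / R ^ 4 * (cmod (z - p))\<^sup>2 * cutoff 1 p R z \<le> 24 / R ^ 4 * R\<^sup>2 * 1"
        using R by (intro mult_mono cutoff_le_1) auto
      moreover have "24 / R ^ 4 * R\<^sup>2 * 1 = 24 / R\<^sup>2" using R by (simp add: field_simps power4_eq_xxxx power2_eq_square)
      moreover have "12 / R\<^sup>2 * cutoff 2 p R z \<ge> 0" by simp
      ultimately have "24 / R ^ 4 * (cmod (z - p))\<^sup>2 * cutoff 1 p R z - 12 / R\<^sup>2 * cutoff 2 p R z \<le> 24 / R\<^sup>2"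
        by linarith
      then have "(24 / R ^ 4 * (cmod (z - p))\<^sup>2 * cutoff 1 p R z - 12 / R\<^sup>2 * cutoff 2 p R z) * Z z \<le> 24 / R\<^sup>2 * B"
        using B[OF True] by (intro order_trans[OF mult_right_mono mult_left_mono]) auto
      then show ?thesis using True by simp
    next
      case False
      then show ?thesis using R by (subst (1 2) cutoff_eq_0) auto
    qed
  qed
  then show ?thesis by simp
qed

section \<open>Energy of the logarithm of a holomorphic function\<close>

lemma holomorphic_line_derivative:
  assumes "g holomorphic_on S" "open S" "z \<in> S"
  shows "((\<lambda>t. Re (g (z + of_real t * e))) has_real_derivative Re (deriv g z * e)) (at 0)"
    and "((\<lambda>t. Im (g (z + of_real t * e))) has_real_derivative Im (deriv g z * e)) (at 0)"
proof -
  have "(g has_derivative (\<lambda>h. deriv g z * h)) (at z)"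
    using holomorphic_derivI[OF assms] by (simp add: has_field_derivative_def)
  then have "((\<lambda>z. Re (g z)) has_derivative (\<lambda>h. Re (deriv g z * h))) (at z)"
    "((\<lambda>z. Im (g z)) has_derivative (\<lambda>h. Im (deriv g z * h))) (at z)"
    by (rule has_derivative_Re, rule has_derivative_Im)
  from this[THEN has_derivative_along_line]
  show "((\<lambda>t. Re (g (z + of_real t * e))) has_real_derivative Re (deriv g z * e)) (at 0)"
    and "((\<lambda>t. Im (g (z + of_real t * e))) has_real_derivative Im (deriv g z * e)) (at 0)" .
qed

text \<open>The Laplacian of this square is \<open>|grad Y|^2 + (Y + 1) * (Yxx + Yyy)\<close>. For
  nonnegative subharmonic \<open>Y\<close> it dominates both the energy density and the Laplacian of
  \<open>Y\<close>; the shift by 1 gives the latter a coefficient of at least 1.\<close>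

lemma C2_on_square:
  assumes "C2_on S Y Yx Yy Yxx Yyy"
  shows "C2_on S (\<lambda>z. (Y z + 1)\<^sup>2 / 2) (\<lambda>z. (Y z + 1) * Yx z) (\<lambda>z. (Y z + 1) * Yy z)
    (\<lambda>z. (Yx z)\<^sup>2 + (Y z + 1) * Yxx z) (\<lambda>z. (Yy z)\<^sup>2 + (Y z + 1) * Yyy z)"
proof -
  note cY = C2_on_continuous[OF assms]
  have d: "((\<lambda>t. Y (z + of_real t * 1)) has_real_derivative Yx z) (at 0)"
      "((\<lambda>t. Y (z + of_real t * \<i>)) has_real_derivative Yy z) (at 0)" if "z \<in> S" for z
    using C2_on_line[OF assms that, of 1] C2_on_line[OF assms that, of \<i>] by simp_all
  have D: "((\<lambda>z. (Y z + 1)\<^sup>2 / 2) has_derivative (\<lambda>h. (Y z + 1) * Yx z * Re h + (Y z + 1) * Yy z * Im h)) (at z)"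
    if "z \<in> S" for z
  proof -
    have [derivative_intros]: "(Y has_derivative (\<lambda>h. Yx z * Re h + Yy z * Im h)) (at z)"
      using assms that by (auto simp: C2_on_def)
    show ?thesis by (auto intro!: derivative_eq_intros simp: algebra_simps)
  qed
  have D2: "((\<lambda>t. (Y (z + of_real t * 1) + 1) * Yx (z + of_real t * 1)) has_real_derivative
        (Yx z)\<^sup>2 + (Y z + 1) * Yxx z) (at 0)"
      "((\<lambda>t. (Y (z + of_real t * \<i>) + 1) * Yy (z + of_real t * \<i>)) has_real_derivative
        (Yy z)\<^sup>2 + (Y z + 1) * Yyy z) (at 0)" if "z \<in> S" for z
  proof -
    have x: "((\<lambda>t. Yx (z + of_real t * 1)) has_real_derivative Yxx z) (at 0)"
      "((\<lambda>t. Yy (z + of_real t * \<i>)) has_real_derivative Yyy z) (at 0)"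
      using assms that by (auto simp: C2_on_def)
    show "((\<lambda>t. (Y (z + of_real t * 1) + 1) * Yx (z + of_real t * 1)) has_real_derivative
        (Yx z)\<^sup>2 + (Y z + 1) * Yxx z) (at 0)"
      by (rule DERIV_cong, rule DERIV_mult[OF DERIV_add[OF d(1)[OF that] DERIV_const] x(1)])
        (simp add: power2_eq_square algebra_simps)
    show "((\<lambda>t. (Y (z + of_real t * \<i>) + 1) * Yy (z + of_real t * \<i>)) has_real_derivative
        (Yy z)\<^sup>2 + (Y z + 1) * Yyy z) (at 0)"
      by (rule DERIV_cong, rule DERIV_mult[OF DERIV_add[OF d(2)[OF that] DERIV_const] x(2)])
        (simp add: power2_eq_square algebra_simps)
  qed
  show ?thesis
    unfolding C2_on_def
  proof (intro conjI ballI)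
    show "open S" using assms by (simp add: C2_on_def)
  qed (use D D2 cY assms in \<open>auto simp: C2_on_def intro!: continuous_intros\<close>)
qed

lemma C2_on_Re_holomorphic:
  assumes "f holomorphic_on S" "open S"
  shows "C2_on S (\<lambda>z. Re (f z)) (\<lambda>z. Re (deriv f z)) (\<lambda>z. - Im (deriv f z))
    (\<lambda>z. Re (deriv (deriv f) z)) (\<lambda>z. - Re (deriv (deriv f) z))"
proof -
  have f': "deriv f holomorphic_on S" and f'': "deriv (deriv f) holomorphic_on S"
    using assms by (auto intro: holomorphic_deriv)
  have D: "((\<lambda>z. Re (f z)) has_derivative (\<lambda>h. Re (deriv f z) * Re h + - Im (deriv f z) * Im h)) (at z)"
    if "z \<in> S" for z
  proof -
    have "(f has_derivative (\<lambda>h. deriv f z * h)) (at z)"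
      using holomorphic_derivI[OF assms that] by (simp add: has_field_derivative_def)
    from has_derivative_Re[OF this] show ?thesis by simp
  qed
  have "((\<lambda>t. - Im (deriv f (z + of_real t * \<i>))) has_real_derivative - Re (deriv (deriv f) z)) (at 0)"
    if "z \<in> S" for z
    using DERIV_minus[OF holomorphic_line_derivative(2)[OF f' assms(2) that, of \<i>]] by simp
  moreover have "((\<lambda>t. Re (deriv f (z + of_real t * 1))) has_real_derivative Re (deriv (deriv f) z)) (at 0)"
    if "z \<in> S" for z
    using holomorphic_line_derivative(1)[OF f' assms(2) that, of 1] by simp
  ultimately show ?thesis
    using D assms f' f''
    by (auto simp: C2_on_def intro!: continuous_intros holomorphic_on_imp_continuous_on)
qed

text \<open>The logarithm of \<open>sqrt (1 + |g|^2)\<close>: a smooth subharmonic substitute for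
  the positive part of \<open>ln |g|\<close>, from which it differs by at most
  \<open>ln 2 / 2\<close>.\<close>

definition log_norm :: "(complex \<Rightarrow> complex) \<Rightarrow> complex \<Rightarrow> real" where
  "log_norm g z = ln (1 + (cmod (g z))\<^sup>2) / 2"

text \<open>A direct calculation with the real and imaginary parts of \<open>g\<close> and its first
  two derivatives. The Laplacian is nonnegative, and Laplacian plus squared gradient is at least
  \<open>|g'|^2 / (1 + |g|^2)\<close>, the density in \<open>energy_bound\<close>.\<close>

lemma C2_on_log_norm:
  assumes g: "g holomorphic_on S" and S: "open S"
  obtains Yx Yy Yxx Yyy where "C2_on S (log_norm g) Yx Yy Yxx Yyy"
    "\<And>z. Yxx z + Yyy z = 2 * (cmod (deriv g z))\<^sup>2 / (1 + (cmod (g z))\<^sup>2)\<^sup>2"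
    "\<And>z. (Yx z)\<^sup>2 + (Yy z)\<^sup>2 = (cmod (deriv g z))\<^sup>2 * (cmod (g z))\<^sup>2 / (1 + (cmod (g z))\<^sup>2)\<^sup>2"
proof -
  define a b c d p r where "a z = Re (g z)" and "b z = Im (g z)" and "c z = Re (deriv g z)"
    and "d z = Im (deriv g z)" and "p z = Re (deriv (deriv g) z)" and "r z = Im (deriv (deriv g) z)" for z
  define N where "N z = 1 + ((a z)\<^sup>2 + (b z)\<^sup>2)" for z
  define Yx where "Yx z = (a z * c z + b z * d z) / N z" for z
  define Yy where "Yy z = (b z * c z - a z * d z) / N z" for z
  define Yxx where "Yxx z = ((c z)\<^sup>2 + (d z)\<^sup>2 + a z * p z + b z * r z) / N z - 2 * (a z * c z + b z * d z)\<^sup>2 / (N z)\<^sup>2" for z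
  define Yyy where "Yyy z = ((c z)\<^sup>2 + (d z)\<^sup>2 - a z * p z - b z * r z) / N z - 2 * (b z * c z - a z * d z)\<^sup>2 / (N z)\<^sup>2" for z
  have N: "N z > 0" for z unfolding N_def by (metis add.assoc add_pos_nonneg sum_power2_ge_zero zero_less_one)
  then have N0: "N z \<noteq> 0" for z by (metis less_irrefl)
  have g': "deriv g holomorphic_on S" and g'': "deriv (deriv g) holomorphic_on S"
    using g S by (auto intro: holomorphic_deriv)
  have ca: "continuous_on S a" "continuous_on S b" "continuous_on S c" "continuous_on S d"
     "continuous_on S p" "continuous_on S r"
    unfolding a_def b_def c_def d_def p_def r_def using g g' g''
    by (auto intro!: continuous_intros holomorphic_on_imp_continuous_on)
  have cN: "continuous_on S N" unfolding N_def by (intro continuous_intros ca)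
  have Yeq: "log_norm g = (\<lambda>z. ln (N z) / 2)"
    by (simp add: fun_eq_iff log_norm_def N_def a_def b_def cmod_power2)
  have D: "((\<lambda>z. ln (N z) / 2) has_derivative (\<lambda>h. Yx z * Re h + Yy z * Im h)) (at z)"
    if "z \<in> S" for z
  proof -
    have gd: "(g has_derivative (\<lambda>h. deriv g z * h)) (at z)"
      using holomorphic_derivI[OF g S that] by (simp add: has_field_derivative_def)
    have [derivative_intros]: "(a has_derivative (\<lambda>h. c z * Re h - d z * Im h)) (at z)"
      "(b has_derivative (\<lambda>h. c z * Im h + d z * Re h)) (at z)"
      using has_derivative_Re[OF gd] has_derivative_Im[OF gd] unfolding a_def b_def c_def d_def by simp_all
    have "(N has_derivative (\<lambda>h. 2 * a z * (c z * Re h - d z * Im h) + 2 * b z * (c z * Im h + d z * Re h))) (at z)"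
      unfolding N_def by (auto intro!: derivative_eq_intros simp: fun_eq_iff algebra_simps)
    from has_derivative_ln[OF N this]
    have "((\<lambda>z. ln (N z)) has_derivative (\<lambda>h. 2 * (Yx z * Re h + Yy z * Im h))) (at z)"
      by (rule has_derivative_eq_rhs) (auto simp: fun_eq_iff Yx_def Yy_def divide_inverse algebra_simps)
    from has_derivative_mult_right[OF this, of "1/2"] show ?thesis
      by (simp add: add_divide_distrib)
  qed
  have Dxx: "((\<lambda>t. Yx (z + of_real t * 1)) has_real_derivative Yxx z) (at 0)" if "z \<in> S" for z
  proof -
    note [derivative_intros] = holomorphic_line_derivative[OF g S that, of 1, folded a_def b_def, simplified, folded c_def d_def]
      holomorphic_line_derivative[OF g' S that, of 1, folded c_def d_def, simplified, folded p_def r_def]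
    show ?thesis
      unfolding Yx_def N_def using N0[of z]
      by (auto intro!: derivative_eq_intros simp: Yxx_def N_def)
        (simp add: divide_simps power2_eq_square, simp add: algebra_simps)
  qed
  have Dyy: "((\<lambda>t. Yy (z + of_real t * \<i>)) has_real_derivative Yyy z) (at 0)" if "z \<in> S" for z
  proof -
    note [derivative_intros] = holomorphic_line_derivative[OF g S that, of \<i>, folded a_def b_def, simplified, folded c_def d_def]
      holomorphic_line_derivative[OF g' S that, of \<i>, folded c_def d_def, simplified, folded p_def r_def]
    show ?thesis
      unfolding Yy_def N_def using N0[of z]
      by (auto intro!: derivative_eq_intros simp: Yyy_def N_def)
        (simp add: divide_simps power2_eq_square, simp add: algebra_simps)
  qed
  have "C2_on S (log_norm g) Yx Yy Yxx Yyy"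
    unfolding C2_on_def Yeq
  proof (intro conjI ballI D Dxx Dyy S)
    show "continuous_on S Yx" unfolding Yx_def[abs_def] using N0 by (intro continuous_intros ca cN) auto
    show "continuous_on S Yy" unfolding Yy_def[abs_def] using N0 by (intro continuous_intros ca cN) auto
    show "continuous_on S Yxx" unfolding Yxx_def[abs_def] using N0 by (intro continuous_intros ca cN) auto
    show "continuous_on S Yyy" unfolding Yyy_def[abs_def] using N0 by (intro continuous_intros ca cN) auto
  qed
  moreover have eq: "cmod (deriv g z) ^ 2 = (c z)\<^sup>2 + (d z)\<^sup>2" "1 + cmod (g z) ^ 2 = N z"
      "cmod (g z) ^ 2 = (a z)\<^sup>2 + (b z)\<^sup>2" for z
    by (simp_all add: cmod_power2 a_def b_def c_def d_def N_def)
  have "Yxx z + Yyy z = 2 * (cmod (deriv g z))\<^sup>2 / (1 + (cmod (g z))\<^sup>2)\<^sup>2" for z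
  proof -
    have "Yxx z + Yyy z = 2 * ((c z)\<^sup>2 + (d z)\<^sup>2) / N z - 2 * ((c z)\<^sup>2 + (d z)\<^sup>2) * ((a z)\<^sup>2 + (b z)\<^sup>2) / (N z)\<^sup>2"
      unfolding Yxx_def Yyy_def by (simp add: diff_divide_distrib add_divide_distrib power2_eq_square algebra_simps)
    also have "\<dots> = 2 * ((c z)\<^sup>2 + (d z)\<^sup>2) * (N z - ((a z)\<^sup>2 + (b z)\<^sup>2)) / (N z)\<^sup>2"
      using N0[of z] by (simp add: field_simps power2_eq_square)
    finally show ?thesis unfolding eq by (simp add: N_def)
  qed
  moreover have "(Yx z)\<^sup>2 + (Yy z)\<^sup>2 = (cmod (deriv g z))\<^sup>2 * (cmod (g z))\<^sup>2 / (1 + (cmod (g z))\<^sup>2)\<^sup>2" for z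
    unfolding eq(2) unfolding eq Yx_def Yy_def
    by (simp add: power_divide add_divide_distrib[symmetric] power2_eq_square algebra_simps)
  ultimately show ?thesis by (rule that)
qed

lemma log_norm_nonneg: "log_norm g z \<ge> 0"
  by (simp add: log_norm_def)

lemma log_norm_ge: "exp D \<le> cmod (g z) \<Longrightarrow> D \<le> log_norm g z"
proof -
  assume "exp D \<le> cmod (g z)"
  then have "(exp D)\<^sup>2 \<le> (cmod (g z))\<^sup>2" by (intro power_mono) auto
  also have "\<dots> \<le> 1 + (cmod (g z))\<^sup>2" by simp
  finally have "exp (2 * D) \<le> 1 + (cmod (g z))\<^sup>2" by (simp only: exp_double)
  then have "2 * D \<le> ln (1 + (cmod (g z))\<^sup>2)" by (subst ln_ge_iff) (auto simp: add_pos_nonneg)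
  then show ?thesis by (simp add: log_norm_def)
qed

lemma log_norm_le:
  assumes "cmod (g z) \<le> exp D" "D \<ge> 0"
  shows "log_norm g z \<le> D + ln 2 / 2"
proof -
  have "(cmod (g z))\<^sup>2 \<le> (exp D)\<^sup>2" using assms by (intro power_mono) auto
  moreover have "1 \<le> (exp D)\<^sup>2" using assms by (intro one_le_power) auto
  ultimately have "1 + (cmod (g z))\<^sup>2 \<le> 2 * (exp D)\<^sup>2" by linarith
  then have "ln (1 + (cmod (g z))\<^sup>2) \<le> ln (2 * (exp D)\<^sup>2)"
    by (subst ln_le_cancel_iff) (auto simp: add_pos_nonneg)
  also have "\<dots> = ln 2 + 2 * D" by (simp add: ln_mult ln_realpow)
  finally show ?thesis by (simp add: log_norm_def)
qed

text \<open>A Caccioppoli type estimate: the energy density is dominated by the Laplacian of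
  \<open>(log_norm g + 1)^2 / 2\<close>, and integrating a Laplacian against a bump costs only the
  size of the function. Hence the bound is quadratic in the oscillation \<open>B\<close>.\<close>

lemma energy_bound:
  assumes g: "g holomorphic_on S" "open S" and S: "cball p R \<subseteq> S" and R: "R > 0"
    and B: "\<And>z. z \<in> cball p R \<Longrightarrow> log_norm g z \<le> B"
  shows "(\<integral>z. cutoff 3 p R z * ((cmod (deriv g z))\<^sup>2 / (1 + (cmod (g z))\<^sup>2)) \<partial>lborel)
    \<le> 12 * (B + 1)\<^sup>2 / R\<^sup>2 * measure lborel (cball p R)"
proof -
  obtain Yx Yy Yxx Yyy where Y: "C2_on S (log_norm g) Yx Yy Yxx Yyy"
    and l: "\<And>z. Yxx z + Yyy z = 2 * (cmod (deriv g z))\<^sup>2 / (1 + (cmod (g z))\<^sup>2)\<^sup>2"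
    and n: "\<And>z. (Yx z)\<^sup>2 + (Yy z)\<^sup>2 = (cmod (deriv g z))\<^sup>2 * (cmod (g z))\<^sup>2 / (1 + (cmod (g z))\<^sup>2)\<^sup>2"
    using C2_on_log_norm[OF g] by blast
  note Z = C2_on_square[OF Y]
  have cont: "continuous_on S (\<lambda>z. (cmod (deriv g z))\<^sup>2 / (1 + (cmod (g z))\<^sup>2))"
    using g holomorphic_deriv[OF g]
    by (intro continuous_intros holomorphic_on_imp_continuous_on) (auto simp: add_nonneg_eq_0_iff)
  have "(\<integral>z. cutoff 3 p R z * ((cmod (deriv g z))\<^sup>2 / (1 + (cmod (g z))\<^sup>2)) \<partial>lborel) \<le>
    (\<integral>z. cutoff 3 p R z * (((Yx z)\<^sup>2 + (log_norm g z + 1) * Yxx z) + ((Yy z)\<^sup>2 + (log_norm g z + 1) * Yyy z)) \<partial>lborel)"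
  proof (rule integral_mono)
    show "integrable lborel (\<lambda>z. cutoff 3 p R z * ((cmod (deriv g z))\<^sup>2 / (1 + (cmod (g z))\<^sup>2)))"
      using R by (intro integrable_mult_supported[OF g(2) S] cont) (auto intro!: continuous_intros cutoff_eq_0)
    show "integrable lborel (\<lambda>z. cutoff 3 p R z * (((Yx z)\<^sup>2 + (log_norm g z + 1) * Yxx z) + ((Yy z)\<^sup>2 + (log_norm g z + 1) * Yyy z)))"
      using R Z by (intro integrable_mult_supported[OF g(2) S])
        (auto intro!: continuous_intros cutoff_eq_0 simp: C2_on_def)
    fix z
    define u where "u = (cmod (g z))\<^sup>2"
    define v where "v = (cmod (deriv g z))\<^sup>2"
    have u: "u \<ge> 0" "v \<ge> 0" by (auto simp: u_def v_def)
    have "v / (1 + u) = v * (1 + u) / (1 + u)\<^sup>2" using u by (simp add: power2_eq_square)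
    also have "\<dots> \<le> (v * u + 2 * v) / (1 + u)\<^sup>2"
      using u by (intro divide_right_mono) (auto simp: algebra_simps)
    also have "\<dots> = ((Yx z)\<^sup>2 + (Yy z)\<^sup>2) + 1 * (Yxx z + Yyy z)"
      unfolding l n u_def v_def by (simp add: add_divide_distrib)
    also have "\<dots> \<le> ((Yx z)\<^sup>2 + (Yy z)\<^sup>2) + (log_norm g z + 1) * (Yxx z + Yyy z)"
      by (intro add_left_mono mult_right_mono) (auto simp: l log_norm_nonneg)
    finally have "v / (1 + u) \<le> ((Yx z)\<^sup>2 + (log_norm g z + 1) * Yxx z) + ((Yy z)\<^sup>2 + (log_norm g z + 1) * Yyy z)"
      by (simp add: algebra_simps)
    then show "cutoff 3 p R z * ((cmod (deriv g z))\<^sup>2 / (1 + (cmod (g z))\<^sup>2)) \<le>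
      cutoff 3 p R z * (((Yx z)\<^sup>2 + (log_norm g z + 1) * Yxx z) + ((Yy z)\<^sup>2 + (log_norm g z + 1) * Yyy z))"
      unfolding u_def v_def by (intro mult_left_mono) auto
  qed
  also have "\<dots> \<le> 24 * ((B + 1)\<^sup>2 / 2) / R\<^sup>2 * measure lborel (cball p R)"
  proof (rule cutoff_laplacian_le[OF Z S R])
    fix z assume z: "z \<in> cball p R"
    have "log_norm g z + 1 \<ge> 0" using log_norm_nonneg[of g z] by simp
    then show "0 \<le> (log_norm g z + 1)\<^sup>2 / 2 \<and> (log_norm g z + 1)\<^sup>2 / 2 \<le> (B + 1)\<^sup>2 / 2"
      using B[OF z] by (auto intro!: divide_right_mono power_mono)
  qed
  finally show ?thesis by simp
qed

section \<open>Folding at the imaginary axis\<close>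

lemma one_plus_square_pos: "1 + (x::real)\<^sup>2 > 0" "1 + x\<^sup>2 \<noteq> 0"
proof -
  show "1 + x\<^sup>2 > 0" by (rule add_pos_nonneg) auto
  then show "1 + x\<^sup>2 \<noteq> 0" by simp
qed

text \<open>A C^1 fold of the line into the positive half-line: slope -1 for
  \<open>x \<le> 0\<close>, asymptotic slope 1 for large \<open>x\<close>. The correction vanishes
  to third order at 0, so the derivative is continuous there.\<close>

definition bend :: "real \<Rightarrow> real" where
  "bend x = 1 - x + 2 * max 0 x ^ 3 / (1 + max 0 x ^ 2)"

definition bend' :: "real \<Rightarrow> real" where
  "bend' x = - 1 + (6 * max 0 x ^ 2 + 2 * max 0 x ^ 4) / (1 + max 0 x ^ 2)\<^sup>2"

lemma bend_has_derivative: "(bend has_real_derivative bend' x) (at x)"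
proof -
  define m where "m = max 0 x"
  have 3: "((\<lambda>x::real. max 0 x ^ 3) has_real_derivative 3 * m ^ 2) (at x)"
    using has_real_derivative_pos_part_power[of 1 x] by (simp add: numeral_3_eq_3 numeral_2_eq_2 m_def)
  have 2: "((\<lambda>x::real. max 0 x ^ 2) has_real_derivative 2 * m) (at x)"
    using has_real_derivative_pos_part_power[of 0 x] by (simp add: numeral_2_eq_2 m_def)
  have pos: "1 + m\<^sup>2 \<noteq> 0" by (metis add_pos_nonneg less_irrefl zero_le_power2 zero_less_one)
  have "((\<lambda>x. 1 - x + 2 * max 0 x ^ 3 / (1 + max 0 x ^ 2)) has_real_derivative
     (0 - 1 + (2 * (3 * m ^ 2) * (1 + m\<^sup>2) - 2 * m ^ 3 * (0 + 2 * m)) / ((1 + m\<^sup>2) * (1 + m\<^sup>2)))) (at x)"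
    using pos unfolding m_def
    by (intro DERIV_add DERIV_diff DERIV_const DERIV_ident DERIV_divide DERIV_cmult 2[unfolded m_def] 3[unfolded m_def])
  moreover have "0 - 1 + (2 * (3 * m ^ 2) * (1 + m\<^sup>2) - 2 * m ^ 3 * (0 + 2 * m)) / ((1 + m\<^sup>2) * (1 + m\<^sup>2)) = bend' x"
    unfolding bend'_def m_def[symmetric] by (simp add: power2_eq_square power3_eq_cube power4_eq_xxxx algebra_simps)
  ultimately show ?thesis unfolding bend_def[abs_def] by simp
qed

lemma continuous_on_bend: "continuous_on A bend"
  by (meson DERIV_isCont bend_has_derivative continuous_at_imp_continuous_on)

lemma continuous_on_bend': "continuous_on A bend'"
  unfolding bend'_def[abs_def]
  by (intro continuous_intros) (auto simp: add_nonneg_eq_0_iff)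

lemma bend_bounds: "(1 + \<bar>x\<bar>) / 4 \<le> bend x" "bend x \<le> 1 + \<bar>x\<bar>"
proof -
  have "(1 + \<bar>x\<bar>) / 4 \<le> bend x \<and> bend x \<le> 1 + \<bar>x\<bar>"
  proof (cases "x \<le> 0")
    case True
    then show ?thesis by (simp add: bend_def)
  next
    case False
    then have x: "x > 0" by simp
    have p: "1 + x\<^sup>2 > 0" by (simp add: one_plus_square_pos)
    have b: "bend x = (1 - x + x\<^sup>2 + x ^ 3) / (1 + x\<^sup>2)"
      using x p by (simp add: bend_def field_simps power2_eq_square power3_eq_cube)
    \<comment> \<open>\<open>12 * (3 - 5 * x + 3 * x^2) = (6 * x - 5)^2 + 11\<close>, which makes
      the cubic below positive for \<open>x > 0\<close>.\<close>
    have "(6 * x - 5)\<^sup>2 \<ge> 0" by auto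
    moreover have "(6 * x - 5)\<^sup>2 = 36 * x\<^sup>2 - 60 * x + 25" by (simp add: power2_eq_square algebra_simps)
    moreover have "(1 - x + x\<^sup>2 + x ^ 3) * 4 - (1 + x) * (1 + x\<^sup>2) = 3 - 5 * x + 3 * x\<^sup>2 + 3 * x ^ 3"
      by (simp add: power2_eq_square power3_eq_cube algebra_simps)
    moreover have "x ^ 3 \<ge> 0" using x by simp
    ultimately have "(1 + x) * (1 + x\<^sup>2) \<le> (1 - x + x\<^sup>2 + x ^ 3) * 4" by linarith
    moreover have "1 - x + x\<^sup>2 + x ^ 3 \<le> (1 + x) * (1 + x\<^sup>2)"
      using x by (simp add: power2_eq_square power3_eq_cube algebra_simps)
    ultimately show ?thesis using p x unfolding b by (simp add: field_simps)
  qed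
  then show "(1 + \<bar>x\<bar>) / 4 \<le> bend x" "bend x \<le> 1 + \<bar>x\<bar>" by auto
qed

lemma bend_pos: "bend x > 0"
  using bend_bounds(1)[of x] by (smt (verit) divide_pos_pos)

lemma abs_bend'_le: "\<bar>bend' x\<bar> \<le> 2"
proof -
  define m where "m = max 0 x"
  have p: "(1 + m\<^sup>2)\<^sup>2 > 0" by (simp add: one_plus_square_pos)
  have "0 \<le> (6 * m ^ 2 + 2 * m ^ 4) / (1 + m\<^sup>2)\<^sup>2" by simp
  moreover have "(6 * m ^ 2 + 2 * m ^ 4) / (1 + m\<^sup>2)\<^sup>2 \<le> 3"
  proof -
    have "3 * (1 + m\<^sup>2)\<^sup>2 = 3 + 6 * m ^ 2 + 3 * m ^ 4" by (simp add: power2_eq_square power4_eq_xxxx algebra_simps)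
    moreover have "m ^ 4 \<ge> 0" by simp
    ultimately show ?thesis using p by (subst pos_divide_le_eq) auto
  qed
  ultimately show ?thesis unfolding bend'_def m_def by linarith
qed

text \<open>On \<open>{Re g \<le> 0}\<close> this is the holomorphic function \<open>1 - g\<close>; its logarithm has bounded
  imaginary part everywhere.\<close>

definition folded :: "(complex \<Rightarrow> complex) \<Rightarrow> complex \<Rightarrow> complex" where
  "folded g z = Complex (bend (Re (g z))) (- Im (g z))"

text \<open>The derivative of \<open>Ln (folded g)\<close> in the direction \<open>h\<close>. It is
  only real linear in \<open>h\<close> in general, because \<open>folded g\<close> need not be
  holomorphic where \<open>Re g > 0\<close>.\<close>

definition dlog_folded :: "(complex \<Rightarrow> complex) \<Rightarrow> complex \<Rightarrow> complex \<Rightarrow> complex" where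
  "dlog_folded g z h = Complex (bend' (Re (g z)) * Re (deriv g z * h)) (- Im (deriv g z * h)) / folded g z"

text \<open>The positive real part keeps \<open>folded g\<close> in the domain of the principal
  logarithm, also at zeros of \<open>g\<close>.\<close>

lemma folded_notin: "folded g z \<notin> \<real>\<^sub>\<le>\<^sub>0" "folded g z \<noteq> 0"
  using bend_pos[of "Re (g z)"] by (auto simp: folded_def complex_nonpos_Reals_iff complex_eq_iff)

lemma Ln_folded_line:
  assumes "g holomorphic_on S" "open S" "z \<in> S"
  shows "((\<lambda>t. Re (Ln (folded g (z + of_real t * h)))) has_real_derivative Re (dlog_folded g z h)) (at 0)"
    and "((\<lambda>t. Im (Ln (folded g (z + of_real t * h)))) has_real_derivative Im (dlog_folded g z h)) (at 0)"
proof -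
  note d = holomorphic_line_derivative[OF assms, of h]
  have b: "(bend has_real_derivative bend' (Re (g z))) (at (Re (g (z + of_real 0 * h))))"
    using bend_has_derivative by simp
  have "((\<lambda>t. folded g (z + of_real t * h)) has_vector_derivative
      Complex (bend' (Re (g z)) * Re (deriv g z * h)) (- Im (deriv g z * h))) (at 0)"
    unfolding has_vector_derivative_complex_iff folded_def complex.sel
    using DERIV_chain2[of bend _ "\<lambda>t. Re (g (z + of_real t * h))", OF b d(1)] DERIV_minus[OF d(2)] by simp
  moreover have "(Ln has_field_derivative inverse (folded g z)) (at (folded g (z + of_real 0 * h)))"
    using has_field_derivative_Ln[OF folded_notin(1)[of g z]] by simp
  ultimately have "((Ln \<circ> (\<lambda>t. folded g (z + of_real t * h))) has_vector_derivative
      Complex (bend' (Re (g z)) * Re (deriv g z * h)) (- Im (deriv g z * h)) * inverse (folded g z)) (at 0)"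
    by (rule field_vector_diff_chain_at)
  then have "((\<lambda>t. Ln (folded g (z + of_real t * h))) has_vector_derivative dlog_folded g z h) (at 0)"
    by (simp add: o_def dlog_folded_def divide_inverse)
  then show "((\<lambda>t. Re (Ln (folded g (z + of_real t * h)))) has_real_derivative Re (dlog_folded g z h)) (at 0)"
    and "((\<lambda>t. Im (Ln (folded g (z + of_real t * h)))) has_real_derivative Im (dlog_folded g z h)) (at 0)"
    unfolding has_vector_derivative_complex_iff by auto
qed

lemma norm_folded_ge: "sqrt (1 + (cmod (g z))\<^sup>2) / 4 \<le> cmod (folded g z)"
proof -
  define x y where "x = Re (g z)" and "y = Im (g z)"
  have "((1 + \<bar>x\<bar>) / 4)\<^sup>2 \<le> (bend x)\<^sup>2" by (intro power_mono bend_bounds) auto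
  moreover have "(1 + x\<^sup>2) / 16 \<le> ((1 + \<bar>x\<bar>) / 4)\<^sup>2"
    by (simp add: power_divide power2_eq_square algebra_simps)
  moreover have "y\<^sup>2 \<ge> 0" by simp
  ultimately have "(1 + (x\<^sup>2 + y\<^sup>2)) / 16 \<le> (bend x)\<^sup>2 + y\<^sup>2" by argo
  then have "sqrt ((1 + (x\<^sup>2 + y\<^sup>2)) / 16) \<le> sqrt ((bend x)\<^sup>2 + y\<^sup>2)" by (rule real_sqrt_le_mono)
  moreover have "sqrt ((1 + (x\<^sup>2 + y\<^sup>2)) / 16) = sqrt (1 + (cmod (g z))\<^sup>2) / 4"
    by (simp add: real_sqrt_divide cmod_power2 x_def y_def)
  moreover have "cmod (folded g z) = sqrt ((bend x)\<^sup>2 + y\<^sup>2)"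
    by (simp add: folded_def cmod_def x_def y_def)
  ultimately show ?thesis by (simp only:)
qed

text \<open>With \<open>Re_Ln_folded_le\<close>: replacing \<open>log_norm g\<close> by the real
  part of the folded logarithm costs an additive constant, which is harmless against a large
  variation.\<close>

lemma Re_Ln_folded_ge: "log_norm g z - ln 4 \<le> Re (Ln (folded g z))"
proof -
  have p: "sqrt (1 + (cmod (g z))\<^sup>2) / 4 > 0" by (simp add: one_plus_square_pos)
  have "ln (sqrt (1 + (cmod (g z))\<^sup>2) / 4) \<le> ln (cmod (folded g z))"
    using p norm_folded_ge[of g z] by (intro ln_mono) auto
  moreover have "ln (sqrt (1 + (cmod (g z))\<^sup>2) / 4) = log_norm g z - ln 4"
    using p by (simp add: ln_div ln_sqrt log_norm_def one_plus_square_pos)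
  ultimately show ?thesis using folded_notin by (simp add: Re_Ln)
qed

lemma Re_Ln_folded_le: "Re (Ln (folded g z)) \<le> log_norm g z + ln 2 / 2"
proof -
  define x y where "x = Re (g z)" and "y = Im (g z)"
  have "(bend x)\<^sup>2 \<le> (1 + \<bar>x\<bar>)\<^sup>2" using bend_pos[of x] by (intro power_mono bend_bounds) auto
  also have "\<dots> \<le> 2 * (1 + x\<^sup>2)"
    using zero_le_power2[of "1 - \<bar>x\<bar>"] by (simp add: power2_eq_square algebra_simps)
  finally have "(bend x)\<^sup>2 \<le> 2 * (1 + x\<^sup>2)" .
  moreover have "y\<^sup>2 \<ge> 0" by simp
  ultimately have "(bend x)\<^sup>2 + y\<^sup>2 \<le> 2 * (1 + (x\<^sup>2 + y\<^sup>2))" by argo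
  then have "sqrt ((bend x)\<^sup>2 + y\<^sup>2) \<le> sqrt (2 * (1 + (x\<^sup>2 + y\<^sup>2)))" by (rule real_sqrt_le_mono)
  then have "cmod (folded g z) \<le> sqrt (2 * (1 + (cmod (g z))\<^sup>2))"
    by (simp add: folded_def cmod_def x_def y_def)
  then have "ln (cmod (folded g z)) \<le> ln (sqrt (2 * (1 + (cmod (g z))\<^sup>2)))"
    using folded_notin by (intro ln_mono) auto
  also have "\<dots> = log_norm g z + ln 2 / 2"
  proof -
    have "1 + (cmod (g z))\<^sup>2 > 0" by (simp add: one_plus_square_pos)
    then have "ln (2 * (1 + (cmod (g z))\<^sup>2)) = ln 2 + ln (1 + (cmod (g z))\<^sup>2)"
      by (subst ln_mult) auto
    moreover have "ln (sqrt (2 * (1 + (cmod (g z))\<^sup>2))) = ln (2 * (1 + (cmod (g z))\<^sup>2)) / 2"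
      by (rule ln_sqrt) (simp add: one_plus_square_pos)
    ultimately show ?thesis unfolding log_norm_def by argo
  qed
  finally show ?thesis using folded_notin by (simp add: Re_Ln)
qed

text \<open>The Cauchy-Riemann equations for \<open>Ln (folded g)\<close> fail only where \<open>Re g > 0\<close>.\<close>

lemma dlog_folded_Cauchy_Riemann:
  "\<bar>Re (dlog_folded g z h) - Im (dlog_folded g z (\<i> * h))\<bar>
    \<le> (if Re (g z) > 0 then 16 * cmod (deriv g z) * cmod h / sqrt (1 + (cmod (g z))\<^sup>2) else 0)"
proof (cases "Re (g z) > 0")
  case False
  then have b: "bend' (Re (g z)) = -1" by (simp add: bend'_def)
  \<comment> \<open>With slope -1 the derivative is complex linear in \<open>h\<close>, which is the
    Cauchy-Riemann equation. In the other case nothing cancels and the two terms are bounded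
    separately.\<close>
  have "dlog_folded g z h = - (deriv g z * h) / folded g z" for h
    unfolding dlog_folded_def b by (rule arg_cong[of _ _ "\<lambda>w. w / folded g z"]) (simp add: complex_eq_iff)
  then have "dlog_folded g z (\<i> * h) = \<i> * dlog_folded g z h" by (simp add: algebra_simps)
  then show ?thesis using False by simp
next
  case True
  have n: "cmod (dlog_folded g z k) \<le> 8 * cmod (deriv g z) * cmod k / sqrt (1 + (cmod (g z))\<^sup>2)" for k
  proof -
    define w where "w = deriv g z * k"
    have "(bend' (Re (g z)) * Re w)\<^sup>2 \<le> (2 * Re w)\<^sup>2"
      using mult_right_mono[OF abs_bend'_le[of "Re (g z)"], of "\<bar>Re w\<bar>"]
      unfolding abs_le_square_iff[symmetric] abs_mult by simp
    moreover have "(2 * Re w)\<^sup>2 = 4 * (Re w)\<^sup>2" "(Im w)\<^sup>2 \<ge> 0" by (simp_all add: power_mult_distrib)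
    ultimately have "(bend' (Re (g z)) * Re w)\<^sup>2 + (Im w)\<^sup>2 \<le> 4 * ((Re w)\<^sup>2 + (Im w)\<^sup>2)"
      by argo
    then have "sqrt ((bend' (Re (g z)) * Re w)\<^sup>2 + (Im w)\<^sup>2) \<le> sqrt (4 * ((Re w)\<^sup>2 + (Im w)\<^sup>2))"
      by (rule real_sqrt_le_mono)
    moreover have "cmod (Complex (bend' (Re (g z)) * Re w) (- Im w)) = sqrt ((bend' (Re (g z)) * Re w)\<^sup>2 + (Im w)\<^sup>2)"
      by (simp add: cmod_def)
    moreover have "sqrt (4 * ((Re w)\<^sup>2 + (Im w)\<^sup>2)) = 2 * cmod w"
      by (simp only: real_sqrt_mult real_sqrt_four cmod_def)
    ultimately have "cmod (Complex (bend' (Re (g z)) * Re w) (- Im w)) \<le> 2 * cmod w"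
      by (simp only:)
    then have "cmod (dlog_folded g z k) \<le> 2 * cmod w / (sqrt (1 + (cmod (g z))\<^sup>2) / 4)"
      unfolding dlog_folded_def w_def norm_divide
      using norm_folded_ge[of g z] by (intro frac_le) (auto simp: one_plus_square_pos)
    then show ?thesis by (simp add: w_def norm_mult)
  qed
  have "\<bar>Re (dlog_folded g z h) - Im (dlog_folded g z (\<i> * h))\<bar> \<le>
      cmod (dlog_folded g z h) + cmod (dlog_folded g z (\<i> * h))"
    using abs_Re_le_cmod[of "dlog_folded g z h"] abs_Im_le_cmod[of "dlog_folded g z (\<i> * h)"] by linarith
  also have "\<dots> \<le> 8 * cmod (deriv g z) * cmod h / sqrt (1 + (cmod (g z))\<^sup>2) +
     8 * cmod (deriv g z) * cmod (\<i> * h) / sqrt (1 + (cmod (g z))\<^sup>2)"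
    by (intro add_mono n)
  finally show ?thesis using True by (simp add: norm_mult mult_ac)
qed

lemma continuous_on_folded:
  assumes "g holomorphic_on S" "open S"
  shows "continuous_on S (folded g)" "continuous_on S (\<lambda>z. Ln (folded g z))"
    "continuous_on S (\<lambda>z. dlog_folded g z h)"
proof -
  have g: "continuous_on S g" "continuous_on S (deriv g)"
    using assms by (auto intro: holomorphic_on_imp_continuous_on holomorphic_deriv)
  show f: "continuous_on S (folded g)"
    unfolding folded_def[abs_def] Complex_eq
    by (intro continuous_intros continuous_on_compose2[OF continuous_on_bend[of UNIV]] g) auto
  show "continuous_on S (\<lambda>z. Ln (folded g z))"
    by (intro continuous_intros f) (auto simp: folded_notin)
  show "continuous_on S (\<lambda>z. dlog_folded g z h)"
    unfolding dlog_folded_def[abs_def] Complex_eq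
    by (intro continuous_intros continuous_on_compose2[OF continuous_on_bend'[of UNIV]] g f)
      (auto simp: folded_notin)
qed

section \<open>The local area estimate\<close>

lemma measure_lborel_cball: "r \<ge> 0 \<Longrightarrow> measure lborel (cball c r :: complex set) = pi * r\<^sup>2"
  by (subst content_cball) (auto simp: unit_ball_vol_2 DIM_complex)

lemma cutoff_integral_ge:
  assumes "R > 0" "n > 0"
  shows "(1/2) ^ n * (pi * (R / 2)\<^sup>2) \<le> (\<integral>z. cutoff n p R z \<partial>lborel)"
proof -
  have "(1/2) ^ n * measure lborel (cball p (R / 2)) = (\<integral>z. (1/2) ^ n * indicator (cball p (R / 2)) z \<partial>lborel)"
    by simp
  also have "\<dots> \<le> (\<integral>z. cutoff n p R z \<partial>lborel)"
  proof (rule integral_mono)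
    show "integrable lborel (\<lambda>z. (1/2) ^ n * indicat_real (cball p (R / 2)) z)"
      by (intro integrable_mult_right integrable_real_indicator)
        (use emeasure_bounded_finite[of "cball p (R/2)"] in auto)
    show "integrable lborel (cutoff n p R)"
      using assms
      by (intro integrable_lborel_compact_support[of "cball p R"]) (auto intro!: continuous_intros cutoff_eq_0)
    fix z
    show "(1/2) ^ n * indicat_real (cball p (R / 2)) z \<le> cutoff n p R z"
    proof (cases "z \<in> cball p (R / 2)")
      case True
      then have "cmod (z - p) / R \<le> 1 / 2" using assms by (simp add: dist_norm norm_minus_commute field_simps)
      then have "(cmod (z - p) / R)\<^sup>2 \<le> (1 / 2)\<^sup>2" using assms by (intro power_mono) auto
      moreover have "(1 / 2)\<^sup>2 = (1 / 4 :: real)" by (simp add: power2_eq_square)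
      ultimately have "1 / 2 \<le> max 0 (1 - (cmod (z - p) / R)\<^sup>2)" by linarith
      then have "(1 / 2) ^ n \<le> cutoff n p R z" unfolding cutoff_def by (rule power_mono) simp
      then show ?thesis using True by simp
    qed auto
  qed
  finally show ?thesis using assms by (simp add: measure_lborel_cball)
qed

lemma cutoff_integral_pos:
  assumes "R > 0" "n > 0"
  shows "(\<integral>z. cutoff n p R z \<partial>lborel) > 0"
proof -
  have "(1/2) ^ n * (pi * (R / 2)\<^sup>2) > 0" using assms by simp
  then show ?thesis using cutoff_integral_ge[OF assms, of p] by linarith
qed

text \<open>Turns an unweighted energy on the disc of radius 2, which contains all translates of the
  unit bump, into the weighted one that \<open>energy_bound\<close> controls;
  \<open>(5/9)^3 = 125/729\<close> exceeds 1/6.\<close>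

lemma cutoff_shift_ge:
  assumes "z \<in> cball p 2"
  shows "1 / 6 \<le> cutoff 3 p 3 z"
proof -
  have "cmod (z - p) / 3 \<le> 2 / 3" using assms by (simp add: dist_norm norm_minus_commute)
  then have "(cmod (z - p) / 3)\<^sup>2 \<le> (2 / 3)\<^sup>2" by (intro power_mono) auto
  moreover have "(2 / 3)\<^sup>2 = (4 / 9 :: real)" by (simp add: power2_eq_square)
  ultimately have "5 / 9 \<le> max 0 (1 - (cmod (z - p) / 3)\<^sup>2)" by linarith
  then have "(5 / 9) ^ 3 \<le> cutoff 3 p 3 z" unfolding cutoff_def by (rule power_mono) simp
  then show ?thesis by (simp add: power3_eq_cube)
qed

text \<open>The averages of \<open>Re (Ln (folded g))\<close> against a bump moving from \<open>- 2 * e\<close> to \<open>0\<close> are compared.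
  Their derivative in the direction \<open>e\<close> is, by the Cauchy-Riemann equations, an average of the derivative
  of \<open>Im (Ln (folded g))\<close> in the direction \<open>\<i> * e\<close>, which stays bounded after integration by parts, up to an
  error supported where \<open>Re g > 0\<close>; this error is split by \<open>2 x \<le> k + x\<^sup>2 / k\<close> into area and energy.\<close>

lemma log_norm_variation_le:
  fixes e :: complex
  assumes e: "cmod e = 1" and g: "g holomorphic_on ball (- e) 4"
    and k: "k > 0" and B: "\<And>z. z \<in> cball (- e) 3 \<Longrightarrow> log_norm g z \<le> B"
  defines "I \<equiv> (\<integral>z. cutoff 2 0 1 z \<partial>lborel)"
  shows "log_norm g 0 * I - ln 4 * I \<le> (\<integral>z. cutoff 2 0 1 z * (log_norm g (z - 2 * e) + ln 2 / 2) \<partial>lborel)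
    + 8 * pi\<^sup>2 + 16 * k * measure lborel {z\<in>cball (- e) 2. Re (g z) > 0} + 1152 * pi * (B + 1)\<^sup>2 / k"
proof -
  define S where "S = ball (- e) 4"
  have S: "open S" and g: "g holomorphic_on S" using g by (auto simp: S_def)
  define L where "L z = Ln (folded g z)" for z
  define Ld where "Ld z h = dlog_folded g z h" for z h
  \<comment> \<open>The bump is centred at \<open>- 2 * e\<close> for \<open>s = 0\<close> and at
    the origin for \<open>s = 1\<close>; in between its support stays in
    \<open>cball (- e) 2\<close>.\<close>
  define sh where "sh s z = z + of_real (s - 1) * (2 * e)" for s z
  have sh: "sh s z \<in> cball (- e) 2" if "s \<in> {0..1}" "z \<in> cball 0 1" for s z
  proof -
    have "sh s z + e = z + of_real (2 * s - 1) * e" by (simp add: sh_def algebra_simps)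
    also have "cmod \<dots> \<le> cmod z + \<bar>2 * s - 1\<bar> * cmod e"
      by (metis norm_triangle_ineq norm_mult norm_of_real)
    also have "\<dots> \<le> 1 + 1 * 1" using that e by (intro add_mono mult_mono) auto
    finally show ?thesis by (simp add: dist_norm norm_minus_commute[of "-e"] add.commute)
  qed
  have sub: "cball (- e) 2 \<subseteq> S" "cball (- e) 3 \<subseteq> S" by (auto simp: S_def)
  have shS: "sh s z \<in> S" if "s \<in> {0..1}" "z \<in> cball 0 1" for s z
    using sh[OF that] sub by auto
  have csh: "continuous_on ({0..1} \<times> cball 0 1) (\<lambda>x. F (sh (fst x) (snd x)))" if "continuous_on S F"
    for F :: "complex \<Rightarrow> real"
  proof (rule continuous_on_compose2[OF that])
    show "continuous_on ({0..1} \<times> cball 0 1) (\<lambda>x. sh (fst x) (snd x))"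
      unfolding sh_def by (intro continuous_intros)
  qed (use shS in auto)
  have csh': "continuous_on (cball 0 1) (\<lambda>z. F (sh s z))" if "continuous_on S F" "s \<in> {0..1}"
    for F :: "complex \<Rightarrow> real" and s
  proof (rule continuous_on_compose2[OF that(1)])
    show "continuous_on (cball 0 1) (sh s)"
      unfolding sh_def[abs_def] by (intro continuous_intros)
  qed (use shS that in auto)
  note cont = continuous_on_folded[OF g S, folded L_def Ld_def]
  have cLd: "continuous_on S (\<lambda>z. Re (Ld z h))" "continuous_on S (\<lambda>z. Im (Ld z h))" for h
    by (intro continuous_intros cont)+
  have cL: "continuous_on S (\<lambda>z. Re (L z))" "continuous_on S (\<lambda>z. Im (L z))"
    by (intro continuous_intros cont)+
  define c where "c = cutoff 2 0 1"
  have c: "continuous_on UNIV c" "\<And>z. z \<notin> ball 0 1 \<Longrightarrow> c z = 0"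
    unfolding c_def by (intro continuous_intros continuous_on_id) (auto intro: cutoff_eq_0)
  have c': "c z = 0" if "z \<notin> cball 0 1" for z using c(2)[of z] that by auto
  have int_c: "integrable lborel (\<lambda>z. c z * F z)" if "continuous_on (cball 0 1) F" for F :: "complex \<Rightarrow> real"
  proof (rule integrable_lborel_compact_support)
    show "continuous_on (cball 0 1) (\<lambda>z. c z * F z)"
      by (intro continuous_intros that continuous_on_subset[OF c(1)]) auto
  qed (use c' in auto)
  define \<Phi> where "\<Phi> s = (\<integral>z. c z * Re (L (sh s z)) \<partial>lborel)" for s
  define \<Phi>' where "\<Phi>' s = (\<integral>z. c z * Re (Ld (sh s z) (2 * e)) \<partial>lborel)" for s
  have der: "(\<Phi> has_real_derivative \<Phi>' s) (at s within {0..1})" if "s \<in> {0..1}" for s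
    unfolding \<Phi>_def[abs_def] \<Phi>'_def
  proof (rule has_field_derivative_lborel_integral_cutoff[OF c _ _ _ that])
    show "continuous_on ({0..1} \<times> cball 0 1) (\<lambda>(s, z). Re (L (sh s z)))"
      "continuous_on ({0..1} \<times> cball 0 1) (\<lambda>(s, z). Re (Ld (sh s z) (2 * e)))"
      unfolding case_prod_beta by (rule csh[OF cL(1)], rule csh[OF cLd(1)])
    fix s :: real and z :: complex assume "s \<in> {0..1}" "z \<in> cball 0 1"
    then have 1: "((\<lambda>t. Re (L (sh s z + of_real t * (2 * e)))) has_real_derivative Re (Ld (sh s z) (2 * e))) (at 0)"
      unfolding L_def Ld_def by (intro Ln_folded_line[OF g S] shS)
    have eq: "z - 2 * e + of_real t * (2 * e) = sh t z" for t by (simp add: sh_def algebra_simps)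
    have "((\<lambda>t. Re (L (z - 2 * e + of_real t * (2 * e)))) has_real_derivative Re (Ld (sh s z) (2 * e))) (at s)"
      by (rule has_real_derivative_shift[of "\<lambda>z. Re (L z)"]) (use 1 in \<open>simp only: eq\<close>)
    then show "((\<lambda>s. Re (L (sh s z))) has_real_derivative Re (Ld (sh s z) (2 * e))) (at s within {0..1})"
      unfolding eq by (rule has_field_derivative_at_within)
  qed
  define E where "E = {z\<in>cball (- e) 2. Re (g z) > 0}"
  define en where "en z = (cmod (deriv g z))\<^sup>2 / (1 + (cmod (g z))\<^sup>2)" for z
  have cg: "continuous_on S g" "continuous_on S (deriv g)"
    using g S by (auto intro: holomorphic_on_imp_continuous_on holomorphic_deriv)
  have cen: "continuous_on S en" unfolding en_def[abs_def]
    by (intro continuous_intros cg) (auto simp: add_nonneg_eq_0_iff)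
  have E: "E \<in> sets borel"
  proof -
    have "open {z\<in>S. Re (g z) > 0}"
      using continuous_open_preimage[OF continuous_on_Re[OF cg(1)] S, of "{0<..}"]
      by (simp add: vimage_def Int_def conj_commute)
    moreover have "E = cball (- e) 2 \<inter> {z\<in>S. Re (g z) > 0}" using sub by (auto simp: E_def)
    ultimately show ?thesis by auto
  qed
  have Efin: "emeasure lborel E < \<infinity>"
    by (rule emeasure_bounded_finite[of E]) (auto simp: E_def intro: bounded_subset[OF bounded_cball])
  have energy: "(\<integral>z. cutoff 3 (-e) 3 z * en z \<partial>lborel) \<le> 12 * (B + 1)\<^sup>2 * pi"
    using energy_bound[OF g S sub(2) _ B] by (simp add: en_def[abs_def] measure_lborel_cball mult_ac)
  have int_en: "integrable lborel (\<lambda>z. cutoff 3 (-e) 3 z * en z)"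
    by (rule integrable_mult_supported[OF S sub(2) _ _ cen]) (auto intro!: continuous_intros continuous_on_id cutoff_eq_0)
  have bound: "\<Phi>' s \<le> 8 * pi\<^sup>2 + 16 * k * measure lborel E + 1152 * pi * (B + 1)\<^sup>2 / k"
    if s: "s \<in> {0..1}" for s
  proof -
    \<comment> \<open>The derivative is moved onto the bump: \<open>|b'| \<le> 8\<close>, the
      argument is at most \<open>pi\<close>, and the unit disc has area \<open>pi\<close>.\<close>
    have 1: "(\<integral>z. c z * Im (Ld (sh s z) (\<i> * (2 * e))) \<partial>lborel) \<le> 8 * pi\<^sup>2"
    proof -
      define S' where "S' = (\<lambda>z. sh s z) -` S"
      have "open S'" unfolding S'_def sh_def by (intro open_vimage S continuous_intros)
      have "cball 0 1 \<subseteq> S'" using shS s by (auto simp: S'_def)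
      have cS': "continuous_on S' (\<lambda>z. F (sh s z))" if "continuous_on S F" for F :: "complex \<Rightarrow> real"
      proof (rule continuous_on_compose2[OF that])
        show "continuous_on S' (sh s)" unfolding sh_def[abs_def] by (intro continuous_intros)
      qed (auto simp: S'_def)
      define b' where "b' z = real (Suc (Suc 0)) * cutoff (Suc 0) 0 1 z * (- 2 * ((z - 0) \<bullet> (\<i> * (2 * e))) / 1\<^sup>2)" for z
      have "(\<integral>z. c z * Im (Ld (sh s z) (\<i> * (2 * e))) \<partial>lborel) = - (\<integral>z. b' z * Im (L (sh s z)) \<partial>lborel)"
      proof (rule lborel_integration_by_parts)
        show "open S'" "cball 0 1 \<subseteq> S'" by fact+
        show "((\<lambda>t. c (z + of_real t * (\<i> * (2 * e)))) has_real_derivative b' z) (at 0)" for z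
          unfolding c_def b'_def using cutoff_has_derivative[of 0 0 1 z] by (simp only: numeral_2_eq_2)
        show "continuous_on UNIV c" by fact
        show "continuous_on UNIV b'" unfolding b'_def[abs_def] by (intro continuous_intros) auto
        show "z \<notin> cball 0 1 \<Longrightarrow> c z = 0" "z \<notin> cball 0 1 \<Longrightarrow> b' z = 0" for z
          using c' by (auto simp: b'_def cutoff_eq_0)
        show "continuous_on S' (\<lambda>z. Im (L (sh s z)))" "continuous_on S' (\<lambda>z. Im (Ld (sh s z) (\<i> * (2 * e))))"
          by (rule cS', rule cL, rule cS', rule cLd)
        fix z assume "z \<in> S'"
        then have "((\<lambda>t. Im (L (sh s z + of_real t * (\<i> * (2 * e))))) has_real_derivative Im (Ld (sh s z) (\<i> * (2 * e)))) (at 0)"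
          unfolding L_def Ld_def S'_def by (intro Ln_folded_line[OF g S]) auto
        then show "((\<lambda>t. Im (L (sh s (z + of_real t * (\<i> * (2 * e)))))) has_real_derivative Im (Ld (sh s z) (\<i> * (2 * e)))) (at 0)"
          by (simp add: sh_def algebra_simps)
      qed
      also have "\<dots> \<le> (\<integral>z. 8 * pi * indicator (cball (0::complex) 1) z \<partial>lborel)"
        unfolding integral_minus[symmetric]
      proof (rule integral_mono)
        have cb': "continuous_on UNIV b'" unfolding b'_def[abs_def] by (intro continuous_intros) auto
        show "integrable lborel (\<lambda>z. - (b' z * Im (L (sh s z))))"
          by (intro Bochner_Integration.integrable_minus integrable_mult_supported[OF \<open>open S'\<close> \<open>cball 0 1 \<subseteq> S'\<close> cb'] cS' cL)
            (auto simp: b'_def cutoff_eq_0)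
        show "integrable lborel (\<lambda>z. 8 * pi * indicat_real (cball (0::complex) 1) z)"
          by (intro integrable_mult_right integrable_real_indicator)
            (use emeasure_bounded_finite[of "cball (0::complex) 1"] in auto)
        fix z :: complex
        show "- (b' z * Im (L (sh s z))) \<le> 8 * pi * indicat_real (cball 0 1) z"
        proof (cases "z \<in> cball 0 1")
          case True
          have "\<bar>z \<bullet> (\<i> * (2 * e))\<bar> \<le> cmod z * cmod (\<i> * (2 * e))" by (rule Cauchy_Schwarz_ineq2)
          also have "\<dots> \<le> 1 * 2" using True e by (intro mult_mono) (auto simp: norm_mult)
          finally have "\<bar>z \<bullet> (\<i> * (2 * e))\<bar> \<le> 2" by simp
          then have "cutoff (Suc 0) 0 1 z * \<bar>z \<bullet> (\<i> * (2 * e))\<bar> \<le> 1 * 2"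
            by (intro mult_mono cutoff_le_1) auto
          then have "\<bar>b' z\<bar> \<le> 8" by (simp add: b'_def abs_mult)
          moreover have "\<bar>Im (L (sh s z))\<bar> \<le> pi"
            using folded_notin(2) mpi_less_Im_Ln Im_Ln_le_pi unfolding L_def
            by (smt (verit))
          ultimately have "\<bar>b' z\<bar> * \<bar>Im (L (sh s z))\<bar> \<le> 8 * pi" by (intro mult_mono) auto
          then show ?thesis using True by (simp add: abs_mult[symmetric])
        next
          case False
          then show ?thesis by (simp add: b'_def cutoff_eq_0)
        qed
      qed
      also have "\<dots> = 8 * pi\<^sup>2" by (simp add: measure_lborel_cball power2_eq_square)
      finally show ?thesis .
    qed
    let ?v = "of_real (s - 1) * (2 * e)"
    let ?en = "\<lambda>z. cutoff 3 (- e) 3 z * en z"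
    \<comment> \<open>For a direction of length 2 the Cauchy-Riemann defect is at most
      \<open>32 * t\<close>, which splits into \<open>16 * k\<close> and
      \<open>16 * t^2 / k\<close>. The factor 6 from \<open>cutoff_shift_ge\<close> gives 96, and
      \<open>96 * 12 = 1152\<close> by the energy bound.\<close>
    have 2: "(\<integral>z. c z * (Re (Ld (sh s z) (2 * e)) - Im (Ld (sh s z) (\<i> * (2 * e)))) \<partial>lborel)
       \<le> 16 * k * measure lborel E + 1152 * pi * (B + 1)\<^sup>2 / k"
    proof -
      have iE: "integrable lborel (\<lambda>z. indicat_real E (?v + z))"
        "(\<integral>z. indicat_real E (?v + z) \<partial>lborel) = measure lborel E"
      proof -
        have "integrable (distr lborel borel ((+) (?v))) (indicat_real E)"
          unfolding lborel_distr_plus using E Efin by (intro integrable_real_indicator) auto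
        then show "integrable lborel (\<lambda>z. indicat_real E (?v + z))"
          by (subst (asm) integrable_distr_eq) (use E in auto)
        show "(\<integral>z. indicat_real E (?v + z) \<partial>lborel) = measure lborel E"
          using E by (subst lborel_integral_translate) auto
      qed
      have ien: "integrable lborel (\<lambda>z. ?en (?v + z))"
        "(\<integral>z. ?en (?v + z) \<partial>lborel) \<le> 12 * (B + 1)\<^sup>2 * pi"
      proof -
        have m: "?en \<in> borel_measurable borel"
          using int_en by auto
        have "integrable (distr lborel borel ((+) (?v))) ?en"
          unfolding lborel_distr_plus by (rule int_en)
        then show "integrable lborel (\<lambda>z. ?en (?v + z))"
          by (subst (asm) integrable_distr_eq) (use m in auto)
        show "(\<integral>z. ?en (?v + z) \<partial>lborel) \<le> 12 * (B + 1)\<^sup>2 * pi"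
          using lborel_integral_translate[OF m, of "?v"] energy by simp
      qed
      have "(\<integral>z. c z * (Re (Ld (sh s z) (2 * e)) - Im (Ld (sh s z) (\<i> * (2 * e)))) \<partial>lborel) \<le>
        (\<integral>z. 16 * k * indicat_real E (?v + z) + 96 / k *
          (?en (?v + z)) \<partial>lborel)"
      proof (rule integral_mono)
        show "integrable lborel (\<lambda>z. c z * (Re (Ld (sh s z) (2 * e)) - Im (Ld (sh s z) (\<i> * (2 * e)))))"
          by (intro int_c continuous_intros csh'[OF cLd(1) s] csh'[OF cLd(2) s])
        show "integrable lborel (\<lambda>z. 16 * k * indicat_real E (?v + z) + 96 / k *
          (?en (?v + z)))"
          by (intro Bochner_Integration.integrable_add integrable_mult_right iE ien)
        fix z :: complex
        have shz: "?v + z = sh s z" by (simp add: sh_def add.commute)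
        define w where "w = sh s z"
        have en0: "en w \<ge> 0" by (simp add: en_def)
        show "c z * (Re (Ld (sh s z) (2 * e)) - Im (Ld (sh s z) (\<i> * (2 * e)))) \<le>
          16 * k * indicat_real E (?v + z) + 96 / k *
          (?en (?v + z))"
          unfolding shz w_def[symmetric]
        proof (cases "z \<in> cball 0 1")
          case False
          then show "c z * (Re (Ld w (2 * e)) - Im (Ld w (\<i> * (2 * e)))) \<le>
            16 * k * indicat_real E w + 96 / k * (cutoff 3 (-e) 3 w * en w)"
            using c'[of z] k en0 by (simp add: add_nonneg_nonneg)
        next
          case True
          then have w: "w \<in> cball (-e) 2" unfolding w_def by (rule sh[OF s])
          define t where "t = sqrt (en w)"
          have t: "t \<ge> 0" "t\<^sup>2 = en w" using en0 by (auto simp: t_def)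
          have teq: "t = cmod (deriv g w) / sqrt (1 + (cmod (g w))\<^sup>2)"
            by (simp add: t_def en_def real_sqrt_divide)
          have cz: "0 \<le> c z" "c z \<le> 1" by (auto simp: c_def cutoff_le_1)
          have "\<bar>Re (Ld w (2 * e)) - Im (Ld w (\<i> * (2 * e)))\<bar> \<le> (if Re (g w) > 0 then 32 * t else 0)"
            using dlog_folded_Cauchy_Riemann[of g w "2 * e"] e unfolding Ld_def teq
            by (cases "Re (g w) > 0") (simp_all add: norm_mult)
          also have "\<dots> = 32 * t * indicat_real E w" using w by (auto simp: E_def)
          finally have "Re (Ld w (2 * e)) - Im (Ld w (\<i> * (2 * e))) \<le> 32 * t * indicat_real E w" by linarith
          then have "c z * (Re (Ld w (2 * e)) - Im (Ld w (\<i> * (2 * e)))) \<le> c z * (32 * t * indicat_real E w)"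
            using cz by (intro mult_left_mono)
          also have "\<dots> \<le> 1 * (32 * t * indicat_real E w)" using cz t by (intro mult_right_mono) auto
          also have "\<dots> \<le> (16 * k + 16 * t\<^sup>2 / k) * indicat_real E w"
          proof -
            have "0 \<le> (k - t)\<^sup>2 / k" using k by simp
            also have "\<dots> = k - 2 * t + t\<^sup>2 / k" using k by (simp add: field_simps power2_eq_square)
            finally have "2 * t \<le> k + t\<^sup>2 / k" by simp
            then have "1 * (32 * t) \<le> 16 * k + 16 * t\<^sup>2 / k" by simp
            then show ?thesis by (metis mult_right_mono indicator_pos_le mult.assoc)
          qed
          also have "\<dots> = 16 * k * indicat_real E w + 16 / k * (en w * indicat_real E w)"
            by (simp add: t algebra_simps)
          also have "\<dots> \<le> 16 * k * indicat_real E w + 16 / k * (6 * (cutoff 3 (-e) 3 w * en w))"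
          proof -
            have "en w * indicat_real E w \<le> en w * 1" using en0 by (intro mult_left_mono) auto
            also have "\<dots> \<le> en w * (6 * cutoff 3 (-e) 3 w)"
              using en0 cutoff_shift_ge[OF w] by (intro mult_left_mono) auto
            finally show ?thesis using k by (intro add_left_mono mult_left_mono) (auto simp: algebra_simps)
          qed
          finally show "c z * (Re (Ld w (2 * e)) - Im (Ld w (\<i> * (2 * e)))) \<le>
            16 * k * indicat_real E w + 96 / k * (cutoff 3 (-e) 3 w * en w)" by simp
        qed
      qed
      also have "\<dots> = 16 * k * measure lborel E + 96 / k *
        (\<integral>z. ?en (?v + z) \<partial>lborel)"
        using iE ien(1) by simp
      also have "\<dots> \<le> 16 * k * measure lborel E + 96 / k * (12 * (B + 1)\<^sup>2 * pi)"
        using k ien(2) by (intro add_left_mono mult_left_mono) auto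
      finally show ?thesis by (simp add: mult_ac)
    qed
    have "\<Phi>' s = (\<integral>z. c z * Im (Ld (sh s z) (\<i> * (2 * e))) + c z * (Re (Ld (sh s z) (2 * e)) - Im (Ld (sh s z) (\<i> * (2 * e)))) \<partial>lborel)"
      unfolding \<Phi>'_def by (intro Bochner_Integration.integral_cong) (auto simp: algebra_simps)
    also have "\<dots> = (\<integral>z. c z * Im (Ld (sh s z) (\<i> * (2 * e))) \<partial>lborel) +
      (\<integral>z. c z * (Re (Ld (sh s z) (2 * e)) - Im (Ld (sh s z) (\<i> * (2 * e)))) \<partial>lborel)"
      by (intro Bochner_Integration.integral_add int_c continuous_intros csh'[OF cLd(1) s] csh'[OF cLd(2) s])
    finally show ?thesis using 1 2 by linarith
  qed
  have "\<exists>s\<in>{0<..<1}. \<Phi> 1 - \<Phi> 0 = \<Phi>' s * (1 - 0)"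
    using der by (intro mvt_simple) (auto simp: has_field_derivative_def mult_commute_abs)
  then obtain s where "s \<in> {0<..<1}" "\<Phi> 1 - \<Phi> 0 = \<Phi>' s" by auto
  with bound[of s] have diff: "\<Phi> 1 \<le> \<Phi> 0 + 8 * pi\<^sup>2 + 16 * k * measure lborel E + 1152 * pi * (B + 1)\<^sup>2 / k"
    by simp
  obtain Yx Yy Yxx Yyy where Y: "C2_on S (log_norm g) Yx Yy Yxx Yyy"
    and l: "\<And>z. Yxx z + Yyy z = 2 * (cmod (deriv g z))\<^sup>2 / (1 + (cmod (g z))\<^sup>2)\<^sup>2"
    using C2_on_log_norm[OF g S] by metis
  have s1: "sh 1 z = z" "sh 0 z = z - 2 * e" for z by (simp_all add: sh_def)
  have b1: "cball 0 1 \<subseteq> S" using shS[of 1] s1 by auto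
  have cY: "continuous_on S (log_norm g)" by (rule C2_on_continuous[OF Y])
  have intc: "integrable lborel c" using int_c[of "\<lambda>_. 1"] by simp
  \<comment> \<open>At the end point 0 subharmonicity replaces the average by the value at the
    centre; at the other end point the average itself is kept.\<close>
  have "log_norm g 0 * I \<le> (\<integral>z. c z * log_norm g z \<partial>lborel)"
    unfolding I_def c_def by (rule cutoff_submean[OF Y b1]) (auto simp: l)
  also have "(\<integral>z. c z * log_norm g z \<partial>lborel) \<le> (\<integral>z. c z * Re (L z) + ln 4 * c z \<partial>lborel)"
  proof (rule integral_mono)
    show "integrable lborel (\<lambda>z. c z * log_norm g z)"
      by (intro int_c continuous_on_subset[OF cY b1])
    show "integrable lborel (\<lambda>z. c z * Re (L z) + ln 4 * c z)"
      by (intro Bochner_Integration.integrable_add integrable_mult_right int_c intc continuous_on_subset[OF cL(1) b1])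
    show "c z * log_norm g z \<le> c z * Re (L z) + ln 4 * c z" for z
      using mult_left_mono[OF Re_Ln_folded_ge[of g z], of "c z"] by (simp add: c_def L_def algebra_simps)
  qed
  also have "\<dots> = \<Phi> 1 + ln 4 * I"
    unfolding \<Phi>_def s1 I_def c_def[symmetric]
    by (subst Bochner_Integration.integral_add)
      (auto intro!: int_c intc continuous_on_subset[OF cL(1) b1])
  finally have A: "log_norm g 0 * I - ln 4 * I \<le> \<Phi> 1" by simp
  have "\<Phi> 0 \<le> (\<integral>z. c z * (log_norm g (z - 2 * e) + ln 2 / 2) \<partial>lborel)"
    unfolding \<Phi>_def s1
  proof (rule integral_mono)
    show "integrable lborel (\<lambda>z. c z * Re (L (z - 2 * e)))"
      using csh'[OF cL(1), of 0] by (intro int_c) (simp add: s1)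
    show "integrable lborel (\<lambda>z. c z * (log_norm g (z - 2 * e) + ln 2 / 2))"
      using csh'[OF cY, of 0] by (intro int_c continuous_intros) (simp add: s1)
    show "c z * Re (L (z - 2 * e)) \<le> c z * (log_norm g (z - 2 * e) + ln 2 / 2)" for z
      unfolding L_def c_def by (intro mult_left_mono Re_Ln_folded_le) auto
  qed
  with A diff show ?thesis unfolding E_def c_def by linarith
qed

text \<open>Apply \<open>log_norm_variation_le\<close> with \<open>k\<close> proportional to
  \<open>D\<close>. The energy term is then linear in \<open>D\<close> and can be made a quarter of
  the gain \<open>D * I\<close>; another quarter pays for the bounded terms once \<open>D\<close> is
  large. The rest must come from \<open>16 * k * area\<close>, and since \<open>k\<close> is
  proportional to \<open>D\<close> as well, the area bound does not depend on
  \<open>D\<close>.\<close>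

lemma local_area_bound:
  assumes K: "K \<ge> 0"
  obtains c D0 where "c > 0" "D0 > 0"
    "\<And>e g D. cmod e = 1 \<Longrightarrow> g holomorphic_on ball (- e) 4 \<Longrightarrow> D \<ge> D0 \<Longrightarrow>
      (\<And>z. z \<in> cball (- 2 * e) 1 \<Longrightarrow> cmod (g z) \<le> 1) \<Longrightarrow> cmod (g 0) \<ge> exp D \<Longrightarrow>
      (\<And>z. z \<in> cball (- e) 3 \<Longrightarrow> cmod (g z) \<le> exp (K * D)) \<Longrightarrow>
      c \<le> measure lborel {z\<in>cball (- e) 2. Re (g z) > 0}"
proof -
  define I where "I = (\<integral>z. cutoff 2 0 1 z \<partial>lborel)"
  have I: "I > 0" unfolding I_def by (rule cutoff_integral_pos) auto
  \<comment> \<open>\<open>4608 = 4 * 1152\<close> makes the energy term at most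
    \<open>D * I / 4\<close>.\<close>
  define \<kappa> where "\<kappa> = 4608 * pi * (K + 2)\<^sup>2 / I"
  have \<kappa>: "\<kappa> > 0" unfolding \<kappa>_def using I K by (intro divide_pos_pos mult_pos_pos) auto
  \<comment> \<open>From this value on the bounded terms \<open>3 * I + 8 * pi^2\<close> are at most
    \<open>D * I / 4\<close>.\<close>
  define D0 where "D0 = max 1 (4 * (3 * I + 8 * pi\<^sup>2) / I)"
  have "I / (32 * \<kappa>) \<le> measure lborel {z\<in>cball (- e) 2. Re (g z) > 0}"
    if e: "cmod e = 1" and g: "g holomorphic_on ball (- e) 4" and D: "D \<ge> D0"
      and left: "\<And>z. z \<in> cball (- 2 * e) 1 \<Longrightarrow> cmod (g z) \<le> 1" and mid: "cmod (g 0) \<ge> exp D"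
      and big: "\<And>z. z \<in> cball (- e) 3 \<Longrightarrow> cmod (g z) \<le> exp (K * D)" for e g D
  proof -
    define A where "A = measure lborel {z\<in>cball (- e) 2. Re (g z) > 0}"
    have D1: "D \<ge> 1" using D by (simp add: D0_def)
    have ln2: "0 \<le> ln (2::real)" "ln (2::real) \<le> 1" using ln_2_less_1 by auto
    have ln4: "ln (4::real) = 2 * ln 2" using ln_realpow[of 2 2] by simp
    have B: "log_norm g z \<le> K * D + 1" if "z \<in> cball (- e) 3" for z
      using log_norm_le[of g z "K * D"] big[OF that] K D1 ln2 by (simp add: mult_nonneg_nonneg)
    have var: "log_norm g 0 * I - ln 4 * I \<le> (\<integral>z. cutoff 2 0 1 z * (log_norm g (z - 2 * e) + ln 2 / 2) \<partial>lborel)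
      + 8 * pi\<^sup>2 + 16 * (\<kappa> * D) * A + 1152 * pi * (K * D + 1 + 1)\<^sup>2 / (\<kappa> * D)"
      unfolding I_def A_def using \<kappa> D1 by (intro log_norm_variation_le[OF e g _ B]) auto
    have int: "integrable lborel (cutoff 2 (0::complex) 1)"
      by (intro integrable_lborel_compact_support[of "cball 0 1"]) (auto intro!: continuous_intros cutoff_eq_0)
    have "(\<integral>z. cutoff 2 0 1 z * (log_norm g (z - 2 * e) + ln 2 / 2) \<partial>lborel) \<le> (\<integral>z. cutoff 2 0 1 z * 1 \<partial>lborel)"
    proof (cases "integrable lborel (\<lambda>z. cutoff 2 0 1 z * (log_norm g (z - 2 * e) + ln 2 / 2))")
      case True
      then show ?thesis
      proof (rule integral_mono)
        fix z
        show "cutoff 2 0 1 z * (log_norm g (z - 2 * e) + ln 2 / 2) \<le> cutoff 2 0 1 z * 1"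
        proof (cases "z \<in> cball 0 1")
          case True
          then have "z - 2 * e \<in> cball (- 2 * e) 1" by (simp add: dist_norm)
          then have "cmod (g (z - 2 * e)) \<le> exp 0" using left by simp
          then have "log_norm g (z - 2 * e) \<le> 0 + ln 2 / 2" by (rule log_norm_le) simp
          then show ?thesis using ln2 by (intro mult_left_mono) auto
        qed (auto simp: cutoff_eq_0)
      qed (use int in simp)
    next
      \<comment> \<open>A non-integrable integrand has integral 0 by convention, which is below
        \<open>I\<close>.\<close>
      case False
      then show ?thesis using I by (simp add: not_integrable_integral_eq I_def)
    qed
    then have low: "(\<integral>z. cutoff 2 0 1 z * (log_norm g (z - 2 * e) + ln 2 / 2) \<partial>lborel) \<le> I" by (simp add: I_def)
    have "D * I \<le> log_norm g 0 * I" using log_norm_ge[of D g 0, OF mid] I by (intro mult_right_mono) auto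
    moreover have "ln 4 * I \<le> 2 * I" using ln2 ln4 I by (intro mult_right_mono) auto
    moreover have "1152 * pi * (K * D + 1 + 1)\<^sup>2 / (\<kappa> * D) \<le> D * I / 4"
    proof -
      have "K * D + 1 + 1 \<le> (K + 2) * D" using D1 by (simp add: algebra_simps)
      then have "(K * D + 1 + 1)\<^sup>2 \<le> ((K + 2) * D)\<^sup>2" using K D1 by (intro power_mono) auto
      then have "1152 * pi * (K * D + 1 + 1)\<^sup>2 / (\<kappa> * D) \<le> 1152 * pi * ((K + 2) * D)\<^sup>2 / (\<kappa> * D)"
        using \<kappa> D1 by (intro divide_right_mono mult_left_mono) auto
      also have "\<dots> = D * I / 4"
      proof -
        define P where "P = (K + 2)\<^sup>2"
        have "P > 0" using K by (simp add: P_def)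
        then show ?thesis
          unfolding \<kappa>_def power_mult_distrib P_def[symmetric] using I D1
          by (simp add: field_simps power2_eq_square)
      qed
      finally show ?thesis .
    qed
    moreover have "3 * I + 8 * pi\<^sup>2 \<le> D * I / 4"
    proof -
      have "4 * (3 * I + 8 * pi\<^sup>2) / I \<le> D" using D by (simp add: D0_def)
      then show ?thesis using I by (simp add: field_simps)
    qed
    ultimately have "D * I / 2 \<le> 16 * (\<kappa> * D) * A" using var low by linarith
    then have "I / (32 * \<kappa>) \<le> A" using \<kappa> D1 by (simp add: field_simps)
    then show ?thesis by (simp add: A_def)
  qed
  moreover have "D0 \<ge> 1" by (simp add: D0_def)
  then have "D0 > 0" by linarith
  moreover have "I / (32 * \<kappa>) > 0" using I \<kappa> by simp
  ultimately show thesis by (intro that[of "I / (32 * \<kappa>)" D0]) auto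
qed

section \<open>Growth of a harmonic function with few sign changes\<close>

lemma mono_chain:
  fixes x :: "nat \<Rightarrow> real"
  assumes "\<And>i. i < n \<Longrightarrow> x i < x (Suc i)" "i < j" "j \<le> n"
  shows "x i < x j"
  using assms(2,3)
proof (induction j)
  case (Suc j)
  show ?case
  proof (cases "i = j")
    case True
    then show ?thesis using assms(1)[of j] Suc by simp
  next
    case False
    then have "x i < x j" using Suc by simp
    also have "\<dots> < x (Suc j)" using assms(1)[of j] Suc by simp
    finally show ?thesis .
  qed
qed simp

text \<open>There are \<open>n + 1\<close> points, and \<open>s * v\<close> is negative at the first
  one; replacing \<open>s\<close> by \<open>- s\<close> gives the pattern that starts
  positive.\<close>

definition alternating :: "nat \<Rightarrow> (real \<Rightarrow> real) \<Rightarrow> real \<Rightarrow> real \<Rightarrow> real \<Rightarrow> (nat \<Rightarrow> real) \<Rightarrow> bool" where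
  "alternating n v s a b x \<longleftrightarrow> (\<forall>i\<le>n. x i \<in> {a..b} \<and> s * (-1) ^ i * v (x i) < 0) \<and> (\<forall>i<n. x i < x (Suc i))"

text \<open>The first node is the infimum \<open>t0\<close> of the points where \<open>s * v\<close>
  is negative. To its right the induction hypothesis applies with sign \<open>- s\<close>: an
  alternating chain there could be prolonged to the left by a point where \<open>s * v < 0\<close>,
  against the assumption.\<close>

lemma sign_polynomial_exists:
  assumes "continuous_on {a..b} v" "a \<le> b" "\<And>x. \<not> alternating n v s a b x"
  shows "\<exists>t. (\<forall>i<n. t i \<in> {a..b}) \<and> (\<forall>x\<in>{a..b}. 0 \<le> s * v x * (\<Prod>i<n. t i - x))"
  using assms
proof (induction n arbitrary: a s)
  case 0
  have "0 \<le> s * v x" if "x \<in> {a..b}" for x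
    using 0(3)[of "\<lambda>_. x"] that by (auto simp: alternating_def)
  then show ?case by auto
next
  case (Suc n)
  define N where "N = {x\<in>{a..b}. s * v x < 0}"
  show ?case
  proof (cases "N = {}")
    case True
    then have "0 \<le> s * v x * (\<Prod>i<Suc n. b - x)" if "x \<in> {a..b}" for x
      using that by (intro mult_nonneg_nonneg[of "s * v x"] prod_nonneg) (auto simp: N_def not_less)
    then show ?thesis using Suc.prems by (intro exI[of _ "\<lambda>_. b"]) auto
  next
    case False
    define t0 where "t0 = Inf N"
    have bdd: "bdd_below N" by (rule bdd_belowI[of _ a]) (auto simp: N_def)
    have t0: "t0 \<in> {a..b}"
      using False bdd cInf_lower[OF _ bdd] unfolding t0_def
      by (auto simp: N_def intro!: cInf_greatest intro: order_trans)
    have before: "0 \<le> s * v x" if "x \<in> {a..b}" "x < t0" for x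
      using that cInf_lower[OF _ bdd, of x] unfolding t0_def by (force simp: N_def)
    have after: "\<exists>y\<in>N. t0 \<le> y \<and> y < x" if "t0 < x" for x
      using cInf_less_iff[OF False bdd, of x] cInf_lower[OF _ bdd] that unfolding t0_def by blast
    have no: "\<not> alternating n v (- s) t0 b x" for x
    proof
      assume alt: "alternating n v (- s) t0 b x"
      have x0: "x 0 \<in> {t0..b}" "s * v (x 0) > 0" using alt by (auto simp: alternating_def)
      have "\<exists>y\<in>N. y < x 0"
      proof (cases "x 0 = t0")
        case False
        then show ?thesis using after[of "x 0"] x0 by auto
      next
        case True
        \<comment> \<open>A chain starting at \<open>t0\<close> itself is impossible:
          \<open>s * v\<close> would be positive near \<open>t0\<close>, while points of
          \<open>N\<close> accumulate there or \<open>t0\<close> lies in \<open>N\<close>.\<close>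
        have "continuous_on {a..b} (\<lambda>x. s * v x)" by (intro continuous_intros Suc.prems)
        then have "\<exists>d>0. \<forall>y\<in>{a..b}. dist y t0 < d \<longrightarrow> dist (s * v y) (s * v t0) < s * v t0"
          using t0 x0 True unfolding continuous_on_iff by blast
        then obtain d where d: "d > 0" "\<And>y. y \<in> {a..b} \<Longrightarrow> dist y t0 < d \<Longrightarrow> dist (s * v y) (s * v t0) < s * v t0"
          by blast
        obtain y where y: "y \<in> N" "t0 \<le> y" "y < t0 + d" using after[of "t0 + d"] d by auto
        then have "dist (s * v y) (s * v t0) < s * v t0" by (intro d) (auto simp: N_def dist_real_def)
        then have "s * v y > 0" by (simp add: dist_real_def abs_if split: if_splits)
        then show ?thesis using y by (auto simp: N_def)
      qed
      then obtain y where y: "y \<in> N" "y < x 0" by blast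
      have "alternating (Suc n) v s a b (case_nat y x)"
        unfolding alternating_def
      proof (intro conjI allI impI)
        fix i assume "i \<le> Suc n"
        then show "case_nat y x i \<in> {a..b}" "s * (- 1) ^ i * v (case_nat y x i) < 0"
          using y alt t0 by (cases i; force simp: alternating_def N_def)+
      next
        fix i assume "i < Suc n"
        then show "case_nat y x i < case_nat y x (Suc i)"
          using y alt by (cases i) (auto simp: alternating_def)
      qed
      then show False using Suc.prems(3) by blast
    qed
    have "continuous_on {t0..b} v"
      by (rule continuous_on_subset[OF Suc.prems(1)]) (use t0 in auto)
    then have "\<exists>t. (\<forall>i<n. t i \<in> {t0..b}) \<and> (\<forall>x\<in>{t0..b}. 0 \<le> - s * v x * (\<Prod>i<n. t i - x))"
      by (rule Suc.IH) (use no t0 in auto)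
    then obtain t where
      t: "\<And>i. i < n \<Longrightarrow> t i \<in> {t0..b}" "\<And>x. x \<in> {t0..b} \<Longrightarrow> 0 \<le> - s * v x * (\<Prod>i<n. t i - x)"
      by blast
    have "0 \<le> s * v x * (\<Prod>i<Suc n. case_nat t0 t i - x)" if x: "x \<in> {a..b}" for x
    proof (cases "x < t0")
      case True
      have "0 \<le> case_nat t0 t i - x" if "i < Suc n" for i
        using that t(1)[of "i - 1"] True by (cases i) auto
      then show ?thesis using before[OF x True]
        by (intro mult_nonneg_nonneg[of "s * v x"] prod_nonneg) auto
    next
      case False
      then have "0 \<le> (x - t0) * (- s * v x * (\<Prod>i<n. t i - x))"
        using x t(2)[of x] by (intro mult_nonneg_nonneg[of "x - t0"]) auto
      then show ?thesis by (simp add: prod.lessThan_Suc_shift algebra_simps del: prod.lessThan_Suc)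
    qed
    moreover have "case_nat t0 t i \<in> {a..b}" if "i < Suc n" for i
      using that t(1)[of "i - 1"] t0 by (cases i) auto
    ultimately show ?thesis by (intro exI[of _ "case_nat t0 t"]) blast
  qed
qed

text \<open>Put the point \<open>\<theta>\<close>, where \<open>u\<close> is positive, in front of
  the \<open>n + 1\<close> alternating points. As \<open>n\<close> is even, the last value is
  negative like the first, so the wrap-around back to \<open>\<theta>\<close> is a sign change too
  and \<open>n + 2 > d\<close> changes arise.\<close>

lemma sign_changes_not_alternating:
  assumes sc: "sign_changes u \<le> enat d" and n: "even n" "n + 2 > d" and pos: "u (cis \<theta>) > 0"
  shows "\<not> alternating n (\<lambda>t. u (cis t)) 1 \<theta> (\<theta> + 2 * pi) x"
proof
  assume alt: "alternating n (\<lambda>t. u (cis t)) 1 \<theta> (\<theta> + 2 * pi) x"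
  then have x: "\<And>i. i \<le> n \<Longrightarrow> x i \<in> {\<theta>..\<theta> + 2 * pi}" "\<And>i. i \<le> n \<Longrightarrow> (-1) ^ i * u (cis (x i)) < 0"
      "\<And>i. i < n \<Longrightarrow> x i < x (Suc i)" by (auto simp: alternating_def)
  define y where "y = case_nat \<theta> x"
  have per: "cis (\<theta> + 2 * pi) = cis \<theta>" by (simp add: cis_mult[symmetric])
  have x0: "\<theta> < x 0" using x(1)[of 0] x(2)[of 0] pos by (cases "x 0 = \<theta>") auto
  have xn: "x n < \<theta> + 2 * pi"
    using x(1)[of n] x(2)[of n] pos n per by (cases "x n = \<theta> + 2 * pi") auto
  have ychain: "y i < y (Suc i)" if "i < Suc n" for i
    using that x0 x(3) by (cases i) (auto simp: y_def)
  have mono: "y i < y j" if "i < j" "j \<le> Suc n" for i j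
    using mono_chain[of "Suc n" y] ychain that by blast
  have "cyclically_ordered (n + 2) (\<lambda>j. cis (y j))"
    unfolding cyclically_ordered_def
  proof (intro exI[of _ y] conjI allI impI)
    show "strict_mono_on {..<n + 2} y"
      by (rule strict_mono_onI) (use mono in auto)
    fix i j assume "i < n + 2" "j < n + 2"
    then have "y j \<le> y (Suc n)" "\<theta> \<le> y i"
      using mono[of j "Suc n"] mono[of 0 i] by (cases "j = Suc n"; cases "i = 0"; force simp: y_def)+
    moreover have "y (Suc n) < \<theta> + 2 * pi" using xn by (simp add: y_def)
    ultimately show "y j < y i + 2 * pi" by linarith
  qed simp
  moreover have "u (cis (y j)) * u (cis (y ((j + 1) mod (n + 2)))) < 0" if "j < n + 2" for j
  proof -
    have "j = 0 \<or> (\<exists>i. j = Suc i \<and> i < n) \<or> j = Suc n" using that by (cases j) auto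
    then consider "j = 0" | i where "j = Suc i" "i < n" | "j = Suc n" by blast
    then show ?thesis
    proof cases
      case 1
      then show ?thesis using x(2)[of 0] pos by (simp add: y_def mult_pos_neg)
    next
      case (2 i)
      have "u (cis (x i)) * u (cis (x (Suc i))) < 0"
        using 2 x(2)[of i] x(2)[of "Suc i"] by (cases "even i") (auto simp: mult_less_0_iff)
      then show ?thesis using 2 by (simp add: y_def)
    next
      case 3
      then show ?thesis using x(2)[of n] n pos by (simp add: y_def mult_neg_pos)
    qed
  qed
  ultimately have "enat (n + 2) \<le> sign_changes u"
    unfolding sign_changes_def by (intro Sup_upper) auto
  then have "enat (n + 2) \<le> enat d" using sc by (rule order_trans)
  then show False using n by simp
qed

section \<open>Fourier moments of the real part on the unit circle\<close>

lemma has_integral_Cauchy_unit_circle: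
  fixes h :: "complex \<Rightarrow> complex"
  assumes h: "h holomorphic_on ball 0 R" and R: "R > 1" and w: "cmod w < 1"
  shows "((\<lambda>\<theta>. h (cis \<theta>) * (cis \<theta> / (cis \<theta> - w))) has_integral 2 * pi * h w) {0..2 * pi}"
proof -
  have "h holomorphic_on cball 0 1"
    by (rule holomorphic_on_subset[OF h]) (use R in auto)
  then have "((\<lambda>u. h u / (u - w)) has_contour_integral 2 * of_real pi * \<i> * h w) (circlepath 0 1)"
    using w by (intro Cauchy_integral_circlepath_simple) auto
  then have "((\<lambda>t. h (0 + 1 * cis t) / (0 + 1 * cis t - w) * 1 * \<i> * cis t) has_integral 2 * of_real pi * \<i> * h w) {0..2*pi}"
    unfolding circlepath_def using has_contour_integral_part_circlepath_iff[of 0 "2 * pi" _ _ 0 1] by simp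
  then have "((\<lambda>t. (h (0 + 1 * cis t) / (0 + 1 * cis t - w) * 1 * \<i> * cis t) * - \<i>) has_integral 2 * of_real pi * \<i> * h w * - \<i>) {0..2*pi}"
    by (rule has_integral_mult_left)
  moreover have "(h (0 + 1 * cis t) / (0 + 1 * cis t - w) * 1 * \<i> * cis t) * - \<i> = h (cis t) * (cis t / (cis t - w))" for t
    by (simp add: divide_inverse mult_ac)
  moreover have "2 * of_real pi * \<i> * h w * - \<i> = 2 * pi * h w" by simp
  ultimately show ?thesis by (simp only:)
qed

lemma has_integral_mean_unit_circle:
  fixes h :: "complex \<Rightarrow> complex"
  assumes "h holomorphic_on ball 0 R" "R > 1"
  shows "((\<lambda>\<theta>. h (cis \<theta>)) has_integral 2 * pi * h 0) {0..2 * pi}"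
  using has_integral_Cauchy_unit_circle[OF assms, of 0] by simp

lemma has_integral_coeff_unit_circle:
  fixes h :: "complex \<Rightarrow> complex"
  assumes h: "h holomorphic_on ball 0 R" and R: "R > 1"
  shows "((\<lambda>\<theta>. h (cis \<theta>) * cis (- (real k * \<theta>))) has_integral 2 * pi / fact k * (deriv ^^ k) h 0) {0..2 * pi}"
proof -
  have hc: "h holomorphic_on cball 0 1"
    by (rule holomorphic_on_subset[OF h]) (use R in auto)
  then have "((\<lambda>u. h u / (u - 0) ^ Suc k) has_contour_integral (2 * pi * \<i>) / fact k * (deriv ^^ k) h 0) (circlepath 0 1)"
    by (intro Cauchy_has_contour_integral_higher_derivative_circlepath holomorphic_on_imp_continuous_on)
      (auto intro: holomorphic_on_subset)
  then have "((\<lambda>t. h (0 + 1 * cis t) / (0 + 1 * cis t - 0) ^ Suc k * 1 * \<i> * cis t) has_integral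
      (2 * pi * \<i>) / fact k * (deriv ^^ k) h 0) {0..2*pi}"
    unfolding circlepath_def using has_contour_integral_part_circlepath_iff[of 0 "2 * pi" _ _ 0 1] by simp
  then have "((\<lambda>t. (h (0 + 1 * cis t) / (0 + 1 * cis t - 0) ^ Suc k * 1 * \<i> * cis t) * - \<i>) has_integral
      (2 * pi * \<i>) / fact k * (deriv ^^ k) h 0 * - \<i>) {0..2*pi}"
    by (rule has_integral_mult_left)
  moreover have "(h (0 + 1 * cis t) / (0 + 1 * cis t - 0) ^ Suc k * 1 * \<i> * cis t) * - \<i> = h (cis t) * cis (- (real k * t))" for t
  proof -
    have "cis (- (real k * t)) = inverse (cis t ^ k)" by (simp add: Complex.DeMoivre)
    then show ?thesis by (simp add: divide_inverse mult_ac cis_mult)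
  qed
  moreover have "(2 * pi * \<i>) / fact k * (deriv ^^ k) h 0 * - \<i> = 2 * pi / fact k * (deriv ^^ k) h 0"
    by (simp add: divide_inverse mult_ac)
  ultimately show ?thesis by (simp only:)
qed

text \<open>Write \<open>Re h = (h + cnj h) / 2\<close>. Against a fixed frequency one summand
  integrates to 0, because \<open>h\<close> has no negative frequencies and \<open>h 0 = 0\<close>;
  the other gives a Taylor coefficient at 0, bounded by Cauchy's inequality on the circle of radius
  \<open>\<rho>\<close>. Thus low moments on the unit circle are seen from a small disc.\<close>

lemma circle_moment_bound:
  fixes h :: "complex \<Rightarrow> complex"
  assumes h: "h holomorphic_on ball 0 R" and R: "R > 1" and h0: "h 0 = 0"
    and \<rho>: "0 < \<rho>" "\<rho> < 1" and B: "\<And>w. w \<in> cball 0 \<rho> \<Longrightarrow> cmod (h w) \<le> B"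
    and j: "\<bar>j\<bar> \<le> int n"
  shows "cmod (integral {0..2*pi} (\<lambda>\<theta>. of_real (Re (h (cis \<theta>))) * cis (of_int j * \<theta>))) \<le> pi * B / \<rho> ^ n"
proof -
  define k where "k = nat \<bar>j\<bar>"
  have k: "k \<le> n" using j by (simp add: k_def)
  have B0: "0 \<le> B" using B[of 0] h0 \<rho> by simp
  define a where "a = complex_of_real (2 * pi / fact k) * (deriv ^^ k) h 0"
  have a: "((\<lambda>\<theta>. h (cis \<theta>) * cis (- (real k * \<theta>))) has_integral a) {0..2 * pi}"
    using has_integral_coeff_unit_circle[OF h R, of k] by (simp add: a_def)
  have "(\<lambda>w. h w * w ^ k) holomorphic_on ball 0 R" by (intro holomorphic_intros h)
  from has_integral_mean_unit_circle[OF this R]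
  have b: "((\<lambda>\<theta>. h (cis \<theta>) * cis (real k * \<theta>)) has_integral 0) {0..2 * pi}"
    by (simp add: h0 Complex.DeMoivre)
  have c: "((\<lambda>\<theta>. cnj (F \<theta>)) has_integral cnj I) {0..2 * pi}" if "(F has_integral I) {0..2 * pi}" for F I
    using has_integral_linear[OF that bounded_linear_cnj] by (simp add: o_def)
  have re: "of_real (Re w) = (w + cnj w) / 2" for w by (simp add: complex_eq_iff)
  have "((\<lambda>\<theta>. of_real (Re (h (cis \<theta>))) * cis (of_int j * \<theta>)) has_integral (if j \<ge> 0 then cnj a else a) / 2) {0..2 * pi}"
  proof (cases "j \<ge> 0")
    case True
    then have jk: "of_int j = real k" by (simp add: k_def)
    have "((\<lambda>\<theta>. (h (cis \<theta>) * cis (real k * \<theta>) + cnj (h (cis \<theta>) * cis (- (real k * \<theta>)))) / 2) has_integral (0 + cnj a) / 2) {0..2 * pi}"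
      by (intro has_integral_divide has_integral_add b c a)
    then show ?thesis using True unfolding jk re by (simp add: cis_cnj algebra_simps)
  next
    case False
    then have jk: "of_int j = - real k" by (simp add: k_def)
    have "((\<lambda>\<theta>. (h (cis \<theta>) * cis (- (real k * \<theta>)) + cnj (h (cis \<theta>) * cis (real k * \<theta>))) / 2) has_integral (a + cnj 0) / 2) {0..2 * pi}"
      by (intro has_integral_divide has_integral_add b c a)
    then show ?thesis using False unfolding jk re by (simp add: cis_cnj algebra_simps)
  qed
  then have "cmod (integral {0..2*pi} (\<lambda>\<theta>. of_real (Re (h (cis \<theta>))) * cis (of_int j * \<theta>))) = cmod a / 2"
    by (simp add: integral_unique norm_divide)
  also have "cmod a / 2 \<le> pi * B / \<rho> ^ k"
  proof -
    have sub: "cball 0 \<rho> \<subseteq> ball 0 R" using \<rho> R by auto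
    have "cmod ((deriv ^^ k) h 0) \<le> fact k * B / \<rho> ^ k"
    proof (rule Cauchy_inequality)
      show "h holomorphic_on ball 0 \<rho>" using h sub by (meson ball_subset_cball holomorphic_on_subset order_trans)
      show "continuous_on (cball 0 \<rho>) h" using h sub by (meson holomorphic_on_imp_continuous_on holomorphic_on_subset)
      show "cmod (h x) \<le> B" if "cmod (0 - x) = \<rho>" for x using that B by simp
    qed fact
    then have "2 * pi / fact k * cmod ((deriv ^^ k) h 0) \<le> 2 * pi / fact k * (fact k * B / \<rho> ^ k)"
      by (intro mult_left_mono) auto
    then show ?thesis by (simp add: a_def norm_mult norm_divide)
  qed
  also have "\<dots> \<le> pi * B / \<rho> ^ n"
    using k \<rho> B0 by (intro divide_left_mono power_decreasing) auto
  finally show ?thesis .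
qed

lemma circle_moment_sum_bound:
  fixes h :: "complex \<Rightarrow> complex"
  assumes h: "h holomorphic_on ball 0 R" and R: "R > 1" and h0: "h 0 = 0"
    and \<rho>: "0 < \<rho>" "\<rho> < 1" and B: "\<And>w. w \<in> cball 0 \<rho> \<Longrightarrow> cmod (h w) \<le> B"
    and X: "finite X" "\<And>x. x \<in> X \<Longrightarrow> cmod (c x) \<le> 1" "\<And>x. x \<in> X \<Longrightarrow> \<bar>j x\<bar> \<le> int n"
  shows "cmod (integral {0..2*pi} (\<lambda>\<theta>. of_real (Re (h (cis \<theta>))) * (\<Sum>x\<in>X. c x * cis (of_int (j x) * \<theta>))))
    \<le> card X * (pi * B / \<rho> ^ n)"
proof -
  have hc: "continuous_on {0..2*pi} (\<lambda>\<theta>. h (cis \<theta>))"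
    using R by (intro continuous_on_compose2[OF holomorphic_on_imp_continuous_on[OF h]] continuous_intros) auto
  have "integral {0..2*pi} (\<lambda>\<theta>. of_real (Re (h (cis \<theta>))) * (\<Sum>x\<in>X. c x * cis (of_int (j x) * \<theta>))) =
     integral {0..2*pi} (\<lambda>\<theta>. \<Sum>x\<in>X. c x * (of_real (Re (h (cis \<theta>))) * cis (of_int (j x) * \<theta>)))"
    by (simp add: sum_distrib_left mult_ac)
  also have "\<dots> = (\<Sum>x\<in>X. integral {0..2*pi} (\<lambda>\<theta>. c x * (of_real (Re (h (cis \<theta>))) * cis (of_int (j x) * \<theta>))))"
    using X(1) by (intro integral_sum integrable_continuous_real continuous_intros hc)
  also have "cmod \<dots> \<le> (\<Sum>x\<in>X. cmod (integral {0..2*pi} (\<lambda>\<theta>. c x * (of_real (Re (h (cis \<theta>))) * cis (of_int (j x) * \<theta>)))))"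
    by (rule norm_sum)
  also have "\<dots> \<le> (\<Sum>x\<in>X. pi * B / \<rho> ^ n)"
  proof (rule sum_mono)
    fix x assume x: "x \<in> X"
    have "cmod (c x) * cmod (integral {0..2*pi} (\<lambda>\<theta>. of_real (Re (h (cis \<theta>))) * cis (of_int (j x) * \<theta>))) \<le> 1 * (pi * B / \<rho> ^ n)"
      by (intro mult_mono X(2) x circle_moment_bound[OF h R h0 \<rho> B X(3)]) auto
    then show "cmod (integral {0..2*pi} (\<lambda>\<theta>. c x * (of_real (Re (h (cis \<theta>))) * cis (of_int (j x) * \<theta>)))) \<le> pi * B / \<rho> ^ n"
      by (simp add: norm_mult)
  qed
  finally show ?thesis by simp
qed

section \<open>Polynomials with zeros on the unit circle\<close>

definition circle_poly :: "nat \<Rightarrow> (nat \<Rightarrow> real) \<Rightarrow> complex \<Rightarrow> complex" where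
  "circle_poly n t z = (\<Prod>i<n. cis (t i) - z)"

text \<open>The expansion is indexed by subsets rather than by degree: every term is unimodular, and
  the number \<open>2 ^ n\<close> of subsets takes the place of bounds for elementary symmetric
  functions.\<close>

definition circle_coeff :: "nat \<Rightarrow> (nat \<Rightarrow> real) \<Rightarrow> nat set \<Rightarrow> complex" where
  "circle_coeff n t A = (\<Prod>i\<in>A. cis (t i)) * (-1) ^ (n - card A)"

lemma circle_poly_expand:
  "circle_poly n t z = (\<Sum>A\<in>Pow {..<n}. circle_coeff n t A * z ^ (n - card A))"
proof -
  have "circle_poly n t z = (\<Prod>i<n. cis (t i) + - z)" by (simp add: circle_poly_def)
  also have "\<dots> = (\<Sum>A\<in>Pow {..<n}. (\<Prod>i\<in>A. cis (t i)) * (\<Prod>i\<in>{..<n} - A. - z))"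
    by (rule prod_add) simp
  also have "\<dots> = (\<Sum>A\<in>Pow {..<n}. circle_coeff n t A * z ^ (n - card A))"
  proof (rule sum.cong)
    fix A assume "A \<in> Pow {..<n}"
    then have "card ({..<n} - A) = n - card A"
      by (subst card_Diff_subset) (auto intro: finite_subset)
    then show "(\<Prod>i\<in>A. cis (t i)) * (\<Prod>i\<in>{..<n} - A. - z) = circle_coeff n t A * z ^ (n - card A)"
      by (simp add: circle_coeff_def power_minus[of z] mult_ac)
  qed simp
  finally show ?thesis .
qed

lemma norm_circle_coeff: "cmod (circle_coeff n t A) = 1"
  by (simp add: circle_coeff_def norm_mult norm_power prod_norm[symmetric])

text \<open>Each factor is \<open>- \<i> * cis (- a / 2) * cis (- \<theta> / 2) * (cis a - cis
  \<theta>)\<close>. An even number of factors combines the half angles into an integer frequency,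
  so only integer moments occur when the product is integrated.\<close>

lemma sin_prod_eq_circle_poly:
  "complex_of_real (\<Prod>i<2 * m. 2 * sin ((t i - \<theta>) / 2)) =
    ((- \<i>) ^ (2 * m) * (\<Prod>i<2 * m. cis (- (t i / 2)))) * cis (- (real m * \<theta>)) * circle_poly (2 * m) t (cis \<theta>)"
proof -
  have fac: "complex_of_real (2 * sin ((a - \<theta>) / 2)) = - \<i> * cis (- (a / 2)) * cis (- (\<theta> / 2)) * (cis a - cis \<theta>)" for a
  proof -
    have "cis (- (a / 2)) * cis (- (\<theta> / 2)) * (cis a - cis \<theta>) = cis ((a - \<theta>) / 2) - cis (- ((a - \<theta>) / 2))"
      by (simp add: cis_mult algebra_simps) (simp add: diff_divide_distrib add_divide_distrib)
    also have "\<dots> = \<i> * complex_of_real (2 * sin ((a - \<theta>) / 2))" by (simp add: complex_eq_iff)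
    finally show ?thesis by (simp add: mult.assoc)
  qed
  have "complex_of_real (\<Prod>i<2 * m. 2 * sin ((t i - \<theta>) / 2)) =
      (\<Prod>i<2 * m. - \<i> * cis (- (t i / 2)) * cis (- (\<theta> / 2)) * (cis (t i) - cis \<theta>))"
    unfolding of_real_prod fac ..
  also have "\<dots> = (- \<i>) ^ (2 * m) * (\<Prod>i<2 * m. cis (- (t i / 2))) * cis (- (\<theta> / 2)) ^ (2 * m) * circle_poly (2 * m) t (cis \<theta>)"
    unfolding prod.distrib circle_poly_def by simp
  also have "cis (- (\<theta> / 2)) ^ (2 * m) = cis (- (real m * \<theta>))" by (simp add: Complex.DeMoivre)
  finally show ?thesis .
qed

text \<open>The Cauchy kernel \<open>1 / (\<zeta> - z)\<close> is interpolated in \<open>\<zeta>\<close> at the zeros of the circle polynomial: the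
  interpolant involves only low moments of \<open>Re h\<close>, which are controlled by \<open>h\<close> on a small disc, and the
  remainder is a multiple of the circle polynomial.\<close>

lemma circle_growth_aux:
  fixes h :: "complex \<Rightarrow> complex"
  assumes h: "h holomorphic_on ball 0 R" and R: "R > 1" and h0: "h 0 = 0"
    and \<rho>: "0 < \<rho>" "\<rho> < 1" and B: "\<And>w. w \<in> cball 0 \<rho> \<Longrightarrow> cmod (h w) \<le> B"
    and z: "cmod z < 1"
  shows "pi * cmod (circle_poly n t z) * cmod (h z) \<le> real n * 2 ^ n * (pi * B / \<rho> ^ n) +
    integral {0..2*pi} (\<lambda>\<theta>. \<bar>Re (h (cis \<theta>))\<bar> * cmod (circle_poly n t (cis \<theta>))) / (1 - cmod z)"
proof -
  define Q where "Q = circle_poly n t"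
  define v where "v \<theta> = Re (h (cis \<theta>))" for \<theta>
  have hc: "continuous_on {0..2*pi} (\<lambda>\<theta>. h (cis \<theta>))"
    using R by (intro continuous_on_compose2[OF holomorphic_on_imp_continuous_on[OF h]] continuous_intros) auto
  have vc: "continuous_on {0..2*pi} v" unfolding v_def by (intro continuous_intros hc)
  have Qc: "continuous_on {0..2*pi} (\<lambda>\<theta>. Q (cis \<theta>))"
    unfolding Q_def circle_poly_def by (intro continuous_intros)
  have ne: "cis \<theta> \<noteq> z" for \<theta> using z by (metis norm_cis less_irrefl)
  have 1: "((\<lambda>\<theta>. h (cis \<theta>) * (cis \<theta> / (cis \<theta> - z))) has_integral 2 * pi * h z) {0..2 * pi}"
    by (rule has_integral_Cauchy_unit_circle[OF h R z])
  \<comment> \<open>On the circle the Cauchy kernel is the conjugate of a function holomorphic in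
    the disc, so the conjugate of \<open>h\<close> contributes only the value
    \<open>h 0 = 0\<close>.\<close>
  have 2: "((\<lambda>\<theta>. cnj (h (cis \<theta>)) * (cis \<theta> / (cis \<theta> - z))) has_integral 0) {0..2 * pi}"
  proof -
    \<comment> \<open>The pole of \<open>1 / (1 - cnj z * w)\<close> has modulus
      \<open>1 / cmod z\<close>; for \<open>z = 0\<close> there is no pole, and 2 is just some
      radius above 1.\<close>
    define R' where "R' = min R (if z = 0 then 2 else 1 / cmod z)"
    have R': "R' > 1" using R z by (auto simp: R'_def)
    have nz: "1 - cnj z * w \<noteq> 0" if "w \<in> ball 0 R'" for w
    proof
      assume "1 - cnj z * w = 0"
      then have "cmod (cnj z * w) = 1" by (metis eq_iff_diff_eq_0 norm_one)
      then have eq: "cmod z * cmod w = 1" by (simp add: norm_mult)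
      then have "z \<noteq> 0" by auto
      then have "cmod w < 1 / cmod z" using that by (simp add: R'_def)
      then show False using eq \<open>z \<noteq> 0\<close> by (simp add: field_simps)
    qed
    have "(\<lambda>w. h w / (1 - cnj z * w)) holomorphic_on ball 0 R'"
      by (intro holomorphic_intros holomorphic_on_subset[OF h] nz) (auto simp: R'_def)
    from has_integral_linear[OF has_integral_mean_unit_circle[OF this R'] bounded_linear_cnj]
    have "((\<lambda>\<theta>. cnj (h (cis \<theta>) / (1 - cnj z * cis \<theta>))) has_integral 0) {0..2 * pi}"
      by (simp add: o_def h0)
    moreover have "cnj (h (cis \<theta>) / (1 - cnj z * cis \<theta>)) = cnj (h (cis \<theta>)) * (cis \<theta> / (cis \<theta> - z))" for \<theta>
    proof -
      have "cis \<theta> - z = cis \<theta> * (1 - z * cis (- \<theta>))"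
        using cis_mult[of \<theta> "- \<theta>"] by (simp add: algebra_simps)
      then show ?thesis by (simp add: cis_cnj)
    qed
    ultimately show ?thesis by (simp only:)
  qed
  \<comment> \<open>A Schwarz formula: half the sum of the two integrals recovers \<open>h z\<close>
    from \<open>Re h\<close> on the circle.\<close>
  have 3: "((\<lambda>\<theta>. of_real (v \<theta>) * (cis \<theta> / (cis \<theta> - z))) has_integral pi * h z) {0..2 * pi}"
  proof -
    have "((\<lambda>\<theta>. (h (cis \<theta>) * (cis \<theta> / (cis \<theta> - z)) + cnj (h (cis \<theta>)) * (cis \<theta> / (cis \<theta> - z))) / 2)
      has_integral (2 * pi * h z + 0) / 2) {0..2 * pi}"
      by (intro has_integral_divide has_integral_add 1 2)
    moreover have "(h (cis \<theta>) * (cis \<theta> / (cis \<theta> - z)) + cnj (h (cis \<theta>)) * (cis \<theta> / (cis \<theta> - z))) / 2 =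
        of_real (v \<theta>) * (cis \<theta> / (cis \<theta> - z))" for \<theta>
    proof -
      have "(h (cis \<theta>) + cnj (h (cis \<theta>))) / 2 = of_real (v \<theta>)" by (simp add: complex_eq_iff v_def)
      then show ?thesis by (metis distrib_right times_divide_eq_left)
    qed
    moreover have "(2 * pi * h z + 0) / 2 = pi * h z" by simp
    ultimately show ?thesis by (simp only:)
  qed
  define X where "X = (SIGMA A:Pow {..<n}. {..<n - card A})"
  define c where "c x = circle_coeff n t (fst x) * z ^ (n - card (fst x) - Suc (snd x))" for x
  have X: "finite X" "card X \<le> n * 2 ^ n"
  proof -
    show "finite X" unfolding X_def by (intro finite_SigmaI) auto
    have "card X = (\<Sum>A\<in>Pow {..<n}. n - card A)" unfolding X_def by simp
    also have "\<dots> \<le> (\<Sum>A\<in>Pow {..<n}. n)" by (intro sum_mono) auto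
    finally show "card X \<le> n * 2 ^ n" by (simp add: card_Pow mult.commute)
  qed
  \<comment> \<open>The divided difference of \<open>Q\<close> is a polynomial; the extra factor
    \<open>cis \<theta>\<close> shifts its frequencies to 1 up to \<open>n\<close>, with one term
    for each pair of subset and power in \<open>X\<close>.\<close>
  have diff: "cis \<theta> * ((Q (cis \<theta>) - Q z) / (cis \<theta> - z)) = (\<Sum>x\<in>X. c x * cis (of_int (int (Suc (snd x))) * \<theta>))" for \<theta>
  proof -
    have "Q (cis \<theta>) - Q z = (\<Sum>A\<in>Pow {..<n}. circle_coeff n t A * (cis \<theta> ^ (n - card A) - z ^ (n - card A)))"
      unfolding Q_def circle_poly_expand by (simp add: sum_subtractf right_diff_distrib)
    also have "\<dots> = (\<Sum>A\<in>Pow {..<n}. circle_coeff n t A * ((cis \<theta> - z) * (\<Sum>i<n - card A. z ^ (n - card A - Suc i) * cis \<theta> ^ i)))"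
      by (simp only: power_diff_sumr2)
    also have "\<dots> = (cis \<theta> - z) * (\<Sum>A\<in>Pow {..<n}. \<Sum>i<n - card A. c (A, i) * cis \<theta> ^ i)"
      by (simp add: sum_distrib_left c_def mult_ac)
    also have "(\<Sum>A\<in>Pow {..<n}. \<Sum>i<n - card A. c (A, i) * cis \<theta> ^ i) = (\<Sum>x\<in>X. c x * cis \<theta> ^ snd x)"
      unfolding X_def by (subst sum.Sigma) (auto simp: case_prod_beta)
    finally have "cis \<theta> * ((Q (cis \<theta>) - Q z) / (cis \<theta> - z)) = cis \<theta> * (\<Sum>x\<in>X. c x * cis \<theta> ^ snd x)"
      using ne[of \<theta>] by simp
    also have "\<dots> = (\<Sum>x\<in>X. c x * cis \<theta> ^ Suc (snd x))"
      by (simp add: sum_distrib_left mult_ac)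
    finally show ?thesis by (simp only: Complex.DeMoivre of_int_of_nat_eq)
  qed
  define S where "S \<theta> = (\<Sum>x\<in>X. c x * cis (of_int (int (Suc (snd x))) * \<theta>))" for \<theta>
  have Sc: "continuous_on {0..2*pi} S" unfolding S_def by (intro continuous_intros)
  have S: "cmod (integral {0..2*pi} (\<lambda>\<theta>. of_real (v \<theta>) * S \<theta>)) \<le> card X * (pi * B / \<rho> ^ n)"
    unfolding v_def S_def
  proof (rule circle_moment_sum_bound[OF h R h0 \<rho> B X(1)])
    fix x assume x: "x \<in> X"
    show "cmod (c x) \<le> 1" using z by (simp add: c_def norm_mult norm_circle_coeff norm_power power_le_one)
    show "\<bar>int (Suc (snd x))\<bar> \<le> int n" using x by (auto simp: X_def)
  qed
  have kc: "continuous_on {0..2*pi} (\<lambda>\<theta>. cis \<theta> / (cis \<theta> - z))"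
    using ne by (intro continuous_intros) auto
  have i1: "(\<lambda>\<theta>. of_real (v \<theta>) * (Q (cis \<theta>) * (cis \<theta> / (cis \<theta> - z)))) integrable_on {0..2*pi}"
    by (intro integrable_continuous_real continuous_intros vc Qc kc)
  have i2: "(\<lambda>\<theta>. of_real (v \<theta>) * S \<theta>) integrable_on {0..2*pi}"
    by (intro integrable_continuous_real continuous_intros vc Sc)
  have "((\<lambda>\<theta>. Q z * (of_real (v \<theta>) * (cis \<theta> / (cis \<theta> - z)))) has_integral Q z * (pi * h z)) {0..2 * pi}"
    by (rule has_integral_mult_right[OF 3])
  moreover have "Q z * (of_real (v \<theta>) * (cis \<theta> / (cis \<theta> - z))) =
      of_real (v \<theta>) * (Q (cis \<theta>) * (cis \<theta> / (cis \<theta> - z))) - of_real (v \<theta>) * S \<theta>" for \<theta>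
    unfolding S_def diff[symmetric] by (simp add: divide_inverse algebra_simps)
  ultimately have "((\<lambda>\<theta>. of_real (v \<theta>) * (Q (cis \<theta>) * (cis \<theta> / (cis \<theta> - z))) - of_real (v \<theta>) * S \<theta>)
      has_integral Q z * (pi * h z)) {0..2 * pi}"
    by (simp only:)
  then have "Q z * (pi * h z) = integral {0..2*pi} (\<lambda>\<theta>. of_real (v \<theta>) * (Q (cis \<theta>) * (cis \<theta> / (cis \<theta> - z))) - of_real (v \<theta>) * S \<theta>)"
    by (rule integral_unique[symmetric])
  also have "\<dots> = integral {0..2*pi} (\<lambda>\<theta>. of_real (v \<theta>) * (Q (cis \<theta>) * (cis \<theta> / (cis \<theta> - z)))) -
      integral {0..2*pi} (\<lambda>\<theta>. of_real (v \<theta>) * S \<theta>)"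
    by (rule Henstock_Kurzweil_Integration.integral_diff[OF i1 i2])
  finally have eq: "Q z * (pi * h z) = integral {0..2*pi} (\<lambda>\<theta>. of_real (v \<theta>) * (Q (cis \<theta>) * (cis \<theta> / (cis \<theta> - z)))) -
      integral {0..2*pi} (\<lambda>\<theta>. of_real (v \<theta>) * S \<theta>)" .
  have "cmod (Q z * (pi * h z)) \<le> cmod (integral {0..2*pi} (\<lambda>\<theta>. of_real (v \<theta>) * (Q (cis \<theta>) * (cis \<theta> / (cis \<theta> - z))))) +
      cmod (integral {0..2*pi} (\<lambda>\<theta>. of_real (v \<theta>) * S \<theta>))"
    unfolding eq by (rule norm_triangle_ineq4)
  moreover have "cmod (integral {0..2*pi} (\<lambda>\<theta>. of_real (v \<theta>) * (Q (cis \<theta>) * (cis \<theta> / (cis \<theta> - z))))) \<le>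
      integral {0..2*pi} (\<lambda>\<theta>. \<bar>v \<theta>\<bar> * cmod (Q (cis \<theta>)) / (1 - cmod z))"
  proof (rule integral_norm_bound_integral[OF i1])
    show "(\<lambda>\<theta>. \<bar>v \<theta>\<bar> * cmod (Q (cis \<theta>)) / (1 - cmod z)) integrable_on {0..2*pi}"
      using z by (intro integrable_continuous_real continuous_intros vc Qc) auto
    fix \<theta> :: real
    have "1 - cmod z \<le> cmod (cis \<theta> - z)" using norm_triangle_ineq2[of "cis \<theta>" z] by simp
    then have "\<bar>v \<theta>\<bar> * cmod (Q (cis \<theta>)) / cmod (cis \<theta> - z) \<le> \<bar>v \<theta>\<bar> * cmod (Q (cis \<theta>)) / (1 - cmod z)"
      using z by (intro divide_left_mono mult_nonneg_nonneg mult_pos_pos) auto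
    then show "cmod (of_real (v \<theta>) * (Q (cis \<theta>) * (cis \<theta> / (cis \<theta> - z)))) \<le> \<bar>v \<theta>\<bar> * cmod (Q (cis \<theta>)) / (1 - cmod z)"
      by (simp add: norm_mult norm_divide)
  qed
  moreover have "real (card X) * (pi * B / \<rho> ^ n) \<le> real n * 2 ^ n * (pi * B / \<rho> ^ n)"
  proof (rule mult_right_mono)
    show "real (card X) \<le> real n * 2 ^ n" using of_nat_mono[OF X(2), where 'a = real] by simp
    show "0 \<le> pi * B / \<rho> ^ n" using B[of 0] h0 \<rho> by simp
  qed
  moreover have "cmod (Q z * (pi * h z)) = pi * cmod (Q z) * cmod (h z)" by (simp add: norm_mult)
  ultimately show ?thesis using S unfolding Q_def v_def by simp
qed

text \<open>Where \<open>Re f\<close> and the sine product have a common sign up to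
  \<open>s\<close>, the absolute integral of their product is the modulus of its plain integral, a
  combination of low moments and hence controlled by \<open>B\<close>. This bounds the remainder in
  \<open>circle_growth_aux\<close>; the modulus of the circle polynomial at \<open>z\<close> is at
  least \<open>(1/8) ^ n\<close>. The dilation to radius \<open>r\<close> is needed because
  \<open>f\<close> itself has no assumed boundary values.\<close>

lemma growth_of_sign_polynomial:
  fixes f :: "complex \<Rightarrow> complex"
  assumes f: "f holomorphic_on ball 0 1" and f0: "f 0 = 0"
    and u: "continuous_on (cball 0 1) u" "\<And>z. z \<in> ball 0 1 \<Longrightarrow> u z = Re (f z)"
    and s: "\<bar>s\<bar> = 1"
    and sgn: "\<And>\<theta>. \<theta> \<in> {0..2*pi} \<Longrightarrow> 0 \<le> s * u (cis \<theta>) * (\<Prod>i<2 * m. 2 * sin ((t i - \<theta>) / 2))"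
    and \<rho>: "0 < \<rho>" "\<rho> < 1" and B: "\<And>w. w \<in> cball 0 \<rho> \<Longrightarrow> cmod (f w) \<le> B"
    and w: "cmod w \<le> 3 / 4"
  defines "n \<equiv> 2 * m"
  shows "cmod (f w) \<le> 8 ^ n * ((real n + 8) * 2 ^ n) * (B / \<rho> ^ n)"
proof (rule field_le_epsilon)
  fix \<epsilon>' :: real assume \<epsilon>': "\<epsilon>' > 0"
  \<comment> \<open>The approximation error enters the final estimate with the factor
    \<open>8 ^ n * 32 * 2 ^ n\<close>.\<close>
  define \<epsilon> where "\<epsilon> = \<epsilon>' / (8 ^ n * 32 * 2 ^ n)"
  have \<epsilon>: "\<epsilon> > 0" using \<epsilon>' by (simp add: \<epsilon>_def)
  have "uniformly_continuous_on (cball 0 1) u"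
    by (rule compact_uniformly_continuous[OF u(1)]) simp
  then obtain \<delta> where \<delta>: "\<delta> > 0" "\<And>x y. x \<in> cball 0 1 \<Longrightarrow> y \<in> cball 0 1 \<Longrightarrow> dist y x < \<delta> \<Longrightarrow> dist (u y) (u x) < \<epsilon>"
    using \<epsilon> unfolding uniformly_continuous_on_def by metis
  \<comment> \<open>At least 6/7, so that \<open>cmod w \<le> 3/4\<close> gives
    \<open>cmod z \<le> 7/8\<close>; and within \<open>\<delta>\<close> of 1 for uniform continuity
    of \<open>u\<close>.\<close>
  define r where "r = max (6 / 7) (1 - \<delta> / 2)"
  have r: "6 / 7 \<le> r" "r < 1" "1 - r < \<delta>" using \<delta>(1) by (auto simp: r_def)
  define h where "h z = f (of_real r * z)" for z
  have h: "h holomorphic_on ball 0 (1 / r)"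
    unfolding h_def
  proof (rule holomorphic_on_compose_gen[of "\<lambda>z. of_real r * z" _ f "ball 0 1", unfolded o_def])
    show "(*) (complex_of_real r) ` ball 0 (1 / r) \<subseteq> ball 0 1"
      using r by (auto simp: norm_mult field_simps)
  qed (use f in \<open>auto intro!: holomorphic_intros\<close>)
  have R: "1 / r > 1" using r by simp
  have h0: "h 0 = 0" by (simp add: h_def f0)
  have hB: "cmod (h x) \<le> B" if "x \<in> cball 0 \<rho>" for x
  proof -
    have "r * cmod x \<le> 1 * cmod x" using r by (intro mult_right_mono) auto
    then show ?thesis using that r unfolding h_def by (intro B) (simp add: norm_mult)
  qed
  have close: "\<bar>Re (h (cis \<theta>)) - u (cis \<theta>)\<bar> \<le> \<epsilon>" for \<theta>
  proof -
    have "Re (h (cis \<theta>)) = u (of_real r * cis \<theta>)" using r by (simp add: h_def u(2) norm_mult)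
    moreover have "dist (of_real r * cis \<theta>) (cis \<theta>) < \<delta>"
    proof -
      have "of_real r * cis \<theta> - cis \<theta> = of_real (r - 1) * cis \<theta>" by (simp add: algebra_simps)
      then show ?thesis using r by (simp add: dist_norm norm_mult del: of_real_diff)
    qed
    ultimately show ?thesis
      using \<delta>(2)[of "cis \<theta>" "of_real r * cis \<theta>"] r by (simp add: norm_mult dist_real_def)
  qed
  define z where "z = w / of_real r"
  have z: "cmod z \<le> 7 / 8"
  proof -
    have "cmod z = cmod w / r" using r by (simp add: z_def norm_divide)
    also have "\<dots> \<le> (3 / 4) / (6 / 7)" using w r by (intro frac_le) auto
    finally show ?thesis by simp
  qed
  have hz: "h z = f w" using r by (simp add: h_def z_def)
  define T where "T \<theta> = (\<Prod>i<n. 2 * sin ((t i - \<theta>) / 2))" for \<theta>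
  define M where "M = pi * B / \<rho> ^ n"
  have absT: "\<bar>T \<theta>\<bar> = cmod (circle_poly n t (cis \<theta>))" for \<theta>
  proof -
    have "\<bar>T \<theta>\<bar> = cmod (complex_of_real (T \<theta>))" by simp
    also have "\<dots> = cmod (circle_poly n t (cis \<theta>))"
      unfolding T_def n_def sin_prod_eq_circle_poly by (simp add: norm_mult norm_power prod_norm[symmetric])
    finally show ?thesis .
  qed
  have T2: "\<bar>T \<theta>\<bar> \<le> 2 ^ n" for \<theta>
  proof -
    have "\<bar>T \<theta>\<bar> = (\<Prod>i<n. \<bar>2 * sin ((t i - \<theta>) / 2)\<bar>)" by (simp add: T_def abs_prod)
    also have "\<dots> \<le> (\<Prod>i<n. 2)" by (intro prod_mono) (auto simp: abs_mult)
    finally show ?thesis by simp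
  qed
  have hc: "continuous_on {0..2*pi} (\<lambda>\<theta>. h (cis \<theta>))"
    using R by (intro continuous_on_compose2[OF holomorphic_on_imp_continuous_on[OF h]] continuous_intros) auto
  have Tc: "continuous_on {0..2*pi} T" unfolding T_def by (intro continuous_intros) auto
  have iT: "(\<lambda>\<theta>. Re (h (cis \<theta>)) * T \<theta>) integrable_on {0..2*pi}"
    by (intro integrable_continuous_real continuous_intros hc Tc)
  have intT: "\<bar>integral {0..2*pi} (\<lambda>\<theta>. Re (h (cis \<theta>)) * T \<theta>)\<bar> \<le> 2 ^ n * M"
  proof -
    define \<omega> where "\<omega> = (- \<i>) ^ (2 * m) * (\<Prod>i<2 * m. cis (- (t i / 2)))"
    have \<omega>: "cmod \<omega> = 1" by (simp add: \<omega>_def norm_mult norm_power prod_norm[symmetric])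
    have eq: "of_real (Re (h (cis \<theta>)) * T \<theta>) = of_real (Re (h (cis \<theta>))) *
       (\<Sum>A\<in>Pow {..<n}. \<omega> * circle_coeff n t A * cis (of_int (int (n - card A) - int m) * \<theta>))" for \<theta>
    proof -
      have "complex_of_real (T \<theta>) = \<omega> * cis (- (real m * \<theta>)) * (\<Sum>A\<in>Pow {..<n}. circle_coeff n t A * cis \<theta> ^ (n - card A))"
        unfolding T_def n_def \<omega>_def sin_prod_eq_circle_poly circle_poly_expand ..
      also have "\<dots> = (\<Sum>A\<in>Pow {..<n}. \<omega> * circle_coeff n t A * (cis (- (real m * \<theta>)) * cis \<theta> ^ (n - card A)))"
        by (simp add: sum_distrib_left mult_ac)
      also have "\<dots> = (\<Sum>A\<in>Pow {..<n}. \<omega> * circle_coeff n t A * cis (of_int (int (n - card A) - int m) * \<theta>))"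
      proof -
        have "cis (- (real m * \<theta>)) * cis \<theta> ^ k = cis (of_int (int k - int m) * \<theta>)" for k
          unfolding Complex.DeMoivre cis_mult by (simp add: algebra_simps)
        then show ?thesis by (simp only:)
      qed
      finally show ?thesis by simp
    qed
    have "complex_of_real (integral {0..2*pi} (\<lambda>\<theta>. Re (h (cis \<theta>)) * T \<theta>)) =
       integral {0..2*pi} (\<lambda>\<theta>. complex_of_real (Re (h (cis \<theta>)) * T \<theta>))"
      using integral_linear[OF iT bounded_linear_of_real[where 'a=complex]] by (simp add: o_def)
    then have "\<bar>integral {0..2*pi} (\<lambda>\<theta>. Re (h (cis \<theta>)) * T \<theta>)\<bar> =
       cmod (integral {0..2*pi} (\<lambda>\<theta>. complex_of_real (Re (h (cis \<theta>)) * T \<theta>)))"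
      by (metis norm_of_real)
    also have "\<dots> \<le> real (card (Pow {..<n})) * (pi * B / \<rho> ^ n)"
      unfolding eq
    proof (rule circle_moment_sum_bound[OF h R h0 \<rho> hB])
      fix A assume "A \<in> Pow {..<n}"
      show "cmod (\<omega> * circle_coeff n t A) \<le> 1" using \<omega> by (simp add: norm_mult norm_circle_coeff)
      show "\<bar>int (n - card A) - int m\<bar> \<le> int n" unfolding n_def by linarith
    qed auto
    finally show ?thesis by (simp add: card_Pow M_def)
  qed
  \<comment> \<open>The sign condition holds for \<open>u\<close>, not for the dilated function;
    replacing one by the other costs \<open>\<epsilon> * 2 ^ n\<close> twice, once when the absolute
    value is opened and once on the way back.\<close>
  have "integral {0..2*pi} (\<lambda>\<theta>. \<bar>Re (h (cis \<theta>))\<bar> * cmod (circle_poly n t (cis \<theta>))) \<le>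
      integral {0..2*pi} (\<lambda>\<theta>. s * (Re (h (cis \<theta>)) * T \<theta>) + 2 * \<epsilon> * 2 ^ n)"
  proof (rule integral_le)
    show "(\<lambda>\<theta>. \<bar>Re (h (cis \<theta>))\<bar> * cmod (circle_poly n t (cis \<theta>))) integrable_on {0..2*pi}"
      unfolding absT[symmetric] by (intro integrable_continuous_real continuous_intros hc Tc)
    show "(\<lambda>\<theta>. s * (Re (h (cis \<theta>)) * T \<theta>) + 2 * \<epsilon> * 2 ^ n) integrable_on {0..2*pi}"
      by (intro integrable_continuous_real continuous_intros hc Tc)
    fix \<theta> assume \<theta>: "\<theta> \<in> {0..2*pi}"
    have sg: "0 \<le> s * (u (cis \<theta>) * T \<theta>)" using sgn[OF \<theta>] by (simp add: T_def n_def mult.assoc)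
    have abs_eq: "\<bar>s * x\<bar> = \<bar>x\<bar>" for x using s by (simp add: abs_mult)
    have d: "\<bar>(Re (h (cis \<theta>)) - u (cis \<theta>)) * T \<theta>\<bar> \<le> \<epsilon> * 2 ^ n"
      unfolding abs_mult by (intro mult_mono close T2) (use \<epsilon> in auto)
    have e1: "Re (h (cis \<theta>)) * T \<theta> = (Re (h (cis \<theta>)) - u (cis \<theta>)) * T \<theta> + u (cis \<theta>) * T \<theta>"
      by (simp add: algebra_simps)
    have e2: "s * (Re (h (cis \<theta>)) * T \<theta>) = s * ((Re (h (cis \<theta>)) - u (cis \<theta>)) * T \<theta>) + s * (u (cis \<theta>) * T \<theta>)"
      by (simp add: algebra_simps)
    have "\<bar>Re (h (cis \<theta>))\<bar> * cmod (circle_poly n t (cis \<theta>)) = \<bar>Re (h (cis \<theta>)) * T \<theta>\<bar>"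
      by (simp add: absT abs_mult)
    moreover have "\<bar>u (cis \<theta>) * T \<theta>\<bar> = s * (u (cis \<theta>) * T \<theta>)" using sg abs_eq[of "u (cis \<theta>) * T \<theta>"] by simp
    moreover have "\<bar>s * ((Re (h (cis \<theta>)) - u (cis \<theta>)) * T \<theta>)\<bar> \<le> \<epsilon> * 2 ^ n" using d by (simp only: abs_eq)
    ultimately show "\<bar>Re (h (cis \<theta>))\<bar> * cmod (circle_poly n t (cis \<theta>)) \<le> s * (Re (h (cis \<theta>)) * T \<theta>) + 2 * \<epsilon> * 2 ^ n"
      using d e1 e2 by linarith
  qed
  also have "\<dots> = s * integral {0..2*pi} (\<lambda>\<theta>. Re (h (cis \<theta>)) * T \<theta>) + 4 * pi * \<epsilon> * 2 ^ n"
  proof -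
    have "((\<lambda>\<theta>. s * (Re (h (cis \<theta>)) * T \<theta>) + 2 * \<epsilon> * 2 ^ n) has_integral
        s * integral {0..2*pi} (\<lambda>\<theta>. Re (h (cis \<theta>)) * T \<theta>) + (2 * pi - 0) * (2 * \<epsilon> * 2 ^ n)) {0..2*pi}"
      using has_integral_const_real[of "2 * \<epsilon> * 2 ^ n" 0 "2 * pi"]
      by (intro has_integral_add has_integral_mult_right integrable_integral iT) simp
    then show ?thesis by (simp add: integral_unique mult_ac)
  qed
  also have "s * integral {0..2*pi} (\<lambda>\<theta>. Re (h (cis \<theta>)) * T \<theta>) \<le> 2 ^ n * M"
  proof -
    have "s = 1 \<or> s = -1" using s by linarith
    then show ?thesis using intT by auto
  qed
  finally have I: "integral {0..2*pi} (\<lambda>\<theta>. \<bar>Re (h (cis \<theta>))\<bar> * cmod (circle_poly n t (cis \<theta>))) \<le> 2 ^ n * M + 4 * pi * \<epsilon> * 2 ^ n"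
    by simp
  have B0: "0 \<le> B" using B[of 0] f0 \<rho> by simp
  then have M0: "0 \<le> M" using \<rho> by (simp add: M_def)
  have "pi * cmod (circle_poly n t z) * cmod (f w) \<le> real n * 2 ^ n * M +
    integral {0..2*pi} (\<lambda>\<theta>. \<bar>Re (h (cis \<theta>))\<bar> * cmod (circle_poly n t (cis \<theta>))) / (1 - cmod z)"
    using circle_growth_aux[OF h R h0 \<rho> hB, of z n t] z unfolding hz M_def by simp
  also have "\<dots> \<le> real n * 2 ^ n * M + (2 ^ n * M + 4 * pi * \<epsilon> * 2 ^ n) / (1 / 8)"
    using z I M0 \<epsilon> by (intro add_left_mono frac_le) auto
  also have "\<dots> = (real n + 8) * 2 ^ n * M + pi * (32 * \<epsilon> * 2 ^ n)" by (simp add: algebra_simps)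
  finally have A: "pi * cmod (circle_poly n t z) * cmod (f w) \<le> (real n + 8) * 2 ^ n * M + pi * (32 * \<epsilon> * 2 ^ n)" .
  have "(1 / 8) ^ n \<le> cmod (circle_poly n t z)"
  proof -
    have "(\<Prod>i<n. 1 / 8) \<le> (\<Prod>i<n. cmod (cis (t i) - z))"
    proof (rule prod_mono)
      fix i
      have "1 - cmod z \<le> cmod (cis (t i) - z)" using norm_triangle_ineq2[of "cis (t i)" z] by simp
      then show "0 \<le> (1 / 8 :: real) \<and> 1 / 8 \<le> cmod (cis (t i) - z)" using z by simp
    qed
    then show ?thesis by (simp add: circle_poly_def prod_norm)
  qed
  then have "pi * (1 / 8) ^ n * cmod (f w) \<le> pi * cmod (circle_poly n t z) * cmod (f w)"
    by (intro mult_right_mono mult_left_mono) auto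
  with A have "pi * (1 / 8) ^ n * cmod (f w) \<le> (real n + 8) * 2 ^ n * M + pi * (32 * \<epsilon> * 2 ^ n)" by linarith
  also have "\<dots> = pi * ((real n + 8) * 2 ^ n * (B / \<rho> ^ n) + 32 * \<epsilon> * 2 ^ n)" by (simp add: M_def algebra_simps)
  finally have "(1 / 8) ^ n * cmod (f w) \<le> (real n + 8) * 2 ^ n * (B / \<rho> ^ n) + 32 * \<epsilon> * 2 ^ n"
    by (simp only: mult.assoc mult_le_cancel_left_pos[OF pi_gt_zero])
  then have "8 ^ n * ((1 / 8) ^ n * cmod (f w)) \<le> 8 ^ n * ((real n + 8) * 2 ^ n * (B / \<rho> ^ n) + 32 * \<epsilon> * 2 ^ n)"
    by (intro mult_left_mono) auto
  moreover have "8 ^ n * ((1 / 8) ^ n * cmod (f w)) = cmod (f w)"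
    by (simp add: power_one_over)
  moreover have "8 ^ n * (32 * \<epsilon> * 2 ^ n) = \<epsilon>'" by (simp add: \<epsilon>_def)
  ultimately show "cmod (f w) \<le> 8 ^ n * ((real n + 8) * 2 ^ n) * (B / \<rho> ^ n) + \<epsilon>'"
    by (simp only: distrib_left mult.assoc)
qed

text \<open>Lets the linear factors of a sign polynomial on an interval of length
  \<open>2 * pi\<close> be replaced by half-angle sines without changing the sign of the
  product.\<close>

lemma sin_half_sign:
  assumes "\<bar>x\<bar> \<le> 2 * pi"
  shows "\<exists>c\<ge>0. 2 * sin (x / 2) = c * x"
proof (cases "x = 0")
  case False
  have "0 \<le> 2 * sin (x / 2) / x"
  proof (cases "x > 0")
    case True
    then show ?thesis using assms sin_ge_zero[of "x / 2"] by simp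
  next
    case False
    then have "sin (- x / 2) \<ge> 0" using assms by (intro sin_ge_zero) auto
    then show ?thesis using False \<open>x \<noteq> 0\<close> by (auto intro: divide_nonpos_neg)
  qed
  then show ?thesis using False by (intro exI[of _ "2 * sin (x / 2) / x"]) auto
qed auto

text \<open>Rotate a point with positive boundary value to angle 0. Sign changes on a circle come in
  even numbers, so \<open>2 * (d div 2)\<close> nodes suffice for a sign polynomial on one full
  turn.\<close>

lemma growth_of_sign_changes:
  fixes f :: "complex \<Rightarrow> complex"
  assumes f: "f holomorphic_on ball 0 1" and f0: "f 0 = 0"
    and u: "continuous_on (cball 0 1) u" "\<And>z. z \<in> ball 0 1 \<Longrightarrow> u z = Re (f z)"
    and sc: "sign_changes u \<le> enat d"
    and \<rho>: "0 < \<rho>" "\<rho> < 1" and B: "\<And>w. w \<in> cball 0 \<rho> \<Longrightarrow> cmod (f w) \<le> B"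
    and w: "cmod w \<le> 3 / 4"
  shows "cmod (f w) \<le> 8 ^ d * ((real d + 8) * 2 ^ d) * (B / \<rho> ^ d)"
proof -
  have B0: "0 \<le> B" using B[of 0] f0 \<rho> by simp
  have "\<exists>m. 2 * m \<le> d \<and> cmod (f w) \<le> 8 ^ (2 * m) * ((real (2 * m) + 8) * 2 ^ (2 * m)) * (B / \<rho> ^ (2 * m))"
  proof (cases "\<exists>\<alpha>. u (cis \<alpha>) > 0")
    \<comment> \<open>Without a positive boundary value the empty product with \<open>s = -1\<close>
      is a sign polynomial.\<close>
    case False
    have "cmod (f w) \<le> 8 ^ (2 * 0) * ((real (2 * 0) + 8) * 2 ^ (2 * 0)) * (B / \<rho> ^ (2 * 0))"
      by (rule growth_of_sign_polynomial[OF f f0 u, of "-1"]) (use False \<rho> B w in \<open>auto simp: not_less\<close>)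
    then show ?thesis by (intro exI[of _ 0]) auto
  next
    case True
    then obtain \<alpha> where \<alpha>: "u (cis \<alpha>) > 0" by blast
    define m where "m = d div 2"
    have m: "2 * m \<le> d" "2 * m + 2 > d" by (auto simp: m_def)
    have cu: "continuous_on A (\<lambda>t. u (cis t))" for A
      by (intro continuous_on_compose2[OF u(1)] continuous_intros) auto
    have ex: "\<exists>t. (\<forall>i<2 * m. t i \<in> {\<alpha>..\<alpha> + 2 * pi}) \<and>
        (\<forall>x\<in>{\<alpha>..\<alpha> + 2 * pi}. 0 \<le> 1 * u (cis x) * (\<Prod>i<2 * m. t i - x))"
      by (rule sign_polynomial_exists[OF cu])
        (use sign_changes_not_alternating[OF sc _ m(2) \<alpha>] in auto)
    then obtain t where t: "\<And>i. i < 2 * m \<Longrightarrow> t i \<in> {\<alpha>..\<alpha> + 2 * pi}"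
      "\<And>x. x \<in> {\<alpha>..\<alpha> + 2 * pi} \<Longrightarrow> 0 \<le> u (cis x) * (\<Prod>i<2 * m. t i - x)"
      using ex unfolding mult_1 by blast
    define g where "g z = f (cis \<alpha> * z)" for z
    have "cmod (g (cis (- \<alpha>) * w)) \<le> 8 ^ (2 * m) * ((real (2 * m) + 8) * 2 ^ (2 * m)) * (B / \<rho> ^ (2 * m))"
    proof (rule growth_of_sign_polynomial[where f = g and w = "cis (- \<alpha>) * w" and u = "\<lambda>z. u (cis \<alpha> * z)" and s = 1 and t = "\<lambda>i. t i - \<alpha>"])
      show "g holomorphic_on ball 0 1"
        unfolding g_def
        by (rule holomorphic_on_compose_gen[of "\<lambda>z. cis \<alpha> * z" _ f "ball 0 1", unfolded o_def])
          (use f in \<open>auto intro!: holomorphic_intros simp: norm_mult\<close>)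
      show "continuous_on (cball 0 1) (\<lambda>z. u (cis \<alpha> * z))"
        by (intro continuous_on_compose2[OF u(1)] continuous_intros) (auto simp: norm_mult)
      show "u (cis \<alpha> * z) = Re (g z)" if "z \<in> ball 0 1" for z
        using that by (simp add: g_def u(2) norm_mult)
      show "cmod (g x) \<le> B" if "x \<in> cball 0 \<rho>" for x
        using that by (simp add: g_def B norm_mult)
      show "cmod (cis (- \<alpha>) * w) \<le> 3 / 4" using w by (simp add: norm_mult)
      fix \<theta> :: real assume \<theta>: "\<theta> \<in> {0..2*pi}"
      define x where "x = \<alpha> + \<theta>"
      have x: "x \<in> {\<alpha>..\<alpha> + 2 * pi}" using \<theta> by (simp add: x_def)
      have "\<exists>c\<ge>0. 2 * sin ((t i - x) / 2) = c * (t i - x)" if "i < 2 * m" for i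
        by (rule sin_half_sign) (use t(1)[OF that] x in auto)
      then obtain c where c: "\<And>i. i < 2 * m \<Longrightarrow> c i \<ge> 0 \<and> 2 * sin ((t i - x) / 2) = c i * (t i - x)"
        by metis
      have "(\<Prod>i<2 * m. 2 * sin ((t i - x) / 2)) = (\<Prod>i<2 * m. c i * (t i - x))"
        using c by (intro prod.cong) auto
      then have "u (cis x) * (\<Prod>i<2 * m. 2 * sin ((t i - x) / 2)) = (\<Prod>i<2 * m. c i) * (u (cis x) * (\<Prod>i<2 * m. t i - x))"
        by (simp add: prod.distrib)
      also have "\<dots> \<ge> 0" using c by (intro mult_nonneg_nonneg[OF prod_nonneg] t(2) x) auto
      finally have "0 \<le> u (cis x) * (\<Prod>i<2 * m. 2 * sin ((t i - x) / 2))" .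
      then show "0 \<le> 1 * u (cis \<alpha> * cis \<theta>) * (\<Prod>i<2 * m. 2 * sin ((t i - \<alpha> - \<theta>) / 2))"
        by (simp add: x_def cis_mult algebra_simps)
    qed (use \<rho> f0 in \<open>auto simp: g_def\<close>)
    moreover have "g (cis (- \<alpha>) * w) = f w"
      by (simp add: g_def mult.assoc[symmetric] cis_mult)
    ultimately show ?thesis using m(1) by (intro exI[of _ m]) simp
  qed
  then obtain n where n: "n \<le> d" "cmod (f w) \<le> 8 ^ n * ((real n + 8) * 2 ^ n) * (B / \<rho> ^ n)" by blast
  note n(2)
  also have "8 ^ n * ((real n + 8) * 2 ^ n) * (B / \<rho> ^ n) \<le> 8 ^ d * ((real d + 8) * 2 ^ d) * (B / \<rho> ^ d)"
    using n(1) \<rho> B0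
    by (intro mult_mono divide_left_mono power_increasing power_decreasing add_right_mono) auto
  finally show ?thesis .
qed

section \<open>Harmonic functions and the maximum principle\<close>

lemma second_difference_mean_value:
  fixes F Fe Fee :: "complex \<Rightarrow> real"
  assumes h: "h > 0" and e: "cmod e1 \<le> 1" "cmod e2 \<le> 1" and S: "cball z (2 * h) \<subseteq> S"
    and F: "\<And>w. w \<in> S \<Longrightarrow> ((\<lambda>t. F (w + of_real t * e1)) has_real_derivative Fe w) (at 0)"
      "\<And>w. w \<in> S \<Longrightarrow> ((\<lambda>t. Fe (w + of_real t * e2)) has_real_derivative Fee w) (at 0)"
  shows "\<exists>\<xi>\<in>cball z (2 * h). F (z + of_real h * e1 + of_real h * e2) - F (z + of_real h * e1)
    - F (z + of_real h * e2) + F z = h * h * Fee \<xi>"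
proof -
  have inS: "z + of_real s * e1 + of_real t * e2 \<in> cball z (2 * h)" if "0 \<le> s" "s \<le> h" "0 \<le> t" "t \<le> h" for s t
  proof -
    have "cmod (of_real s * e1 + of_real t * e2) \<le> s * cmod e1 + t * cmod e2"
      using norm_triangle_ineq[of "of_real s * e1" "of_real t * e2"] that by (simp add: norm_mult)
    also have "\<dots> \<le> h * 1 + h * 1" using that e by (intro add_mono mult_mono) auto
    finally have "cmod (of_real s * e1 + of_real t * e2) \<le> 2 * h" by simp
    moreover have "dist z (z + of_real s * e1 + of_real t * e2) = cmod (of_real s * e1 + of_real t * e2)"
      unfolding dist_norm by (subst norm_minus_commute) (simp add: add.assoc)
    ultimately show ?thesis by simp
  qed
  define \<phi> where "\<phi> s = F (z + of_real s * e1 + of_real h * e2) - F (z + of_real s * e1)" for s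
  have d\<phi>: "(\<phi> has_real_derivative Fe (z + of_real s * e1 + of_real h * e2) - Fe (z + of_real s * e1)) (at s)"
    if "0 \<le> s" "s \<le> h" for s
  proof -
    have "((\<lambda>s. F (z + of_real h * e2 + of_real s * e1)) has_real_derivative Fe (z + of_real h * e2 + of_real s * e1)) (at s)"
      by (rule has_real_derivative_shift, rule F(1))
        (use inS[of s h] S that h in \<open>auto simp: algebra_simps\<close>)
    moreover have "((\<lambda>s. F (z + of_real s * e1)) has_real_derivative Fe (z + of_real s * e1)) (at s)"
      by (rule has_real_derivative_shift, rule F(1)) (use inS[of s 0] S that h in auto)
    ultimately show ?thesis unfolding \<phi>_def[abs_def] by (intro DERIV_diff) (auto simp: algebra_simps)
  qed
  obtain s where s: "0 < s" "s < h" "\<phi> h - \<phi> 0 = (h - 0) * (Fe (z + of_real s * e1 + of_real h * e2) - Fe (z + of_real s * e1))"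
    using MVT2[of 0 h \<phi> "\<lambda>s. Fe (z + of_real s * e1 + of_real h * e2) - Fe (z + of_real s * e1)"] h d\<phi> by auto
  have d2: "((\<lambda>t. Fe (z + of_real s * e1 + of_real t * e2)) has_real_derivative Fee (z + of_real s * e1 + of_real t * e2)) (at t)"
    if "0 \<le> t" "t \<le> h" for t
    by (rule has_real_derivative_shift, rule F(2)) (use inS[of s t] S that s in auto)
  obtain t where t: "0 < t" "t < h" "Fe (z + of_real s * e1 + of_real h * e2) - Fe (z + of_real s * e1 + of_real 0 * e2) =
      (h - 0) * Fee (z + of_real s * e1 + of_real t * e2)"
    using MVT2[of 0 h "\<lambda>t. Fe (z + of_real s * e1 + of_real t * e2)" "\<lambda>t. Fee (z + of_real s * e1 + of_real t * e2)"] h d2 by auto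
  show ?thesis
    using s t inS[of s t]
    by (intro bexI[of _ "z + of_real s * e1 + of_real t * e2"]) (auto simp: \<phi>_def)
qed

text \<open>Schwarz' theorem. The second difference over a small square is symmetric in the two
  axes, and by the mean value theorem it equals either mixed derivative at some nearby point;
  continuity does the rest.\<close>

lemma mixed_partials_eq:
  fixes u p q :: "complex \<Rightarrow> real"
  assumes S: "open S" and z: "z \<in> S"
    and u: "\<And>z. z \<in> S \<Longrightarrow> (u has_derivative (\<lambda>h. p z * Re h + q z * Im h)) (at z)"
    and p: "\<And>z. z \<in> S \<Longrightarrow> (p has_derivative (\<lambda>h. pxx z * Re h + pxy z * Im h)) (at z)"
    and q: "\<And>z. z \<in> S \<Longrightarrow> (q has_derivative (\<lambda>h. qyx z * Re h + qyy z * Im h)) (at z)"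
    and cont: "continuous_on S pxy" "continuous_on S qyx"
  shows "pxy z = qyx z"
proof (rule ccontr)
  assume ne: "pxy z \<noteq> qyx z"
  define \<epsilon> where "\<epsilon> = \<bar>pxy z - qyx z\<bar> / 2"
  have \<epsilon>: "\<epsilon> > 0" using ne by (simp add: \<epsilon>_def)
  obtain r where r: "r > 0" "cball z r \<subseteq> S" using S z open_contains_cball by blast
  obtain d1 where d1: "d1 > 0" "\<And>w. w \<in> S \<Longrightarrow> dist w z < d1 \<Longrightarrow> dist (pxy w) (pxy z) < \<epsilon>"
    using cont(1) z \<epsilon> unfolding continuous_on_iff by metis
  obtain d2 where d2: "d2 > 0" "\<And>w. w \<in> S \<Longrightarrow> dist w z < d2 \<Longrightarrow> dist (qyx w) (qyx z) < \<epsilon>"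
    using cont(2) z \<epsilon> unfolding continuous_on_iff by metis
  define h where "h = min r (min d1 d2) / 3"
  have h: "h > 0" "2 * h < d1" "2 * h < d2" "2 * h \<le> r" using r d1 d2 by (auto simp: h_def)
  have sub: "cball z (2 * h) \<subseteq> S" using r h by auto
  have lu: "((\<lambda>t. u (w + of_real t * e)) has_real_derivative p w * Re e + q w * Im e) (at 0)"
    and lp: "((\<lambda>t. p (w + of_real t * e)) has_real_derivative pxx w * Re e + pxy w * Im e) (at 0)"
    and lq: "((\<lambda>t. q (w + of_real t * e)) has_real_derivative qyx w * Re e + qyy w * Im e) (at 0)"
    if "w \<in> S" for w e
    using has_derivative_along_line[OF u[OF that], of e] has_derivative_along_line[OF p[OF that], of e]
      has_derivative_along_line[OF q[OF that], of e] by simp_all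
  obtain \<xi> where \<xi>: "\<xi> \<in> cball z (2 * h)" "u (z + of_real h * 1 + of_real h * \<i>) - u (z + of_real h * 1)
      - u (z + of_real h * \<i>) + u z = h * h * pxy \<xi>"
    using second_difference_mean_value[OF h(1) _ _ sub, of 1 \<i> u p pxy] lu[of _ 1] lp[of _ \<i>] by auto
  obtain \<xi>' where \<xi>': "\<xi>' \<in> cball z (2 * h)" "u (z + of_real h * \<i> + of_real h * 1) - u (z + of_real h * \<i>)
      - u (z + of_real h * 1) + u z = h * h * qyx \<xi>'"
    using second_difference_mean_value[OF h(1) _ _ sub, of \<i> 1 u q qyx] lu[of _ \<i>] lq[of _ 1] by auto
  have "h * h * pxy \<xi> = h * h * qyx \<xi>'"
    unfolding \<xi>(2)[symmetric] \<xi>'(2)[symmetric] by (simp add: add.assoc add.commute add.left_commute)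
  then have eq: "pxy \<xi> = qyx \<xi>'" using h by simp
  have "dist (pxy \<xi>) (pxy z) < \<epsilon>" using \<xi>(1) sub h by (intro d1) (auto simp: dist_commute)
  moreover have "dist (qyx \<xi>') (qyx z) < \<epsilon>" using \<xi>'(1) sub h by (intro d2) (auto simp: dist_commute)
  moreover have "\<bar>pxy z - qyx z\<bar> \<le> dist (pxy \<xi>) (pxy z) + dist (qyx \<xi>') (qyx z)"
    unfolding eq dist_real_def by linarith
  ultimately show False unfolding \<epsilon>_def by argo
qed

text \<open>The function \<open>p - \<i> * q\<close> is holomorphic: its Cauchy-Riemann equations
  are the Laplace equation and the equality of mixed derivatives. On the convex disc it has a
  primitive, whose real part differs from \<open>u\<close> by a constant.\<close>

lemma harmonic_on_imp_Re_holomorphic: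
  assumes u: "harmonic_on u (ball 0 1)" and u0: "u 0 = 0"
  obtains f where "f holomorphic_on ball 0 1" "f 0 = 0" "\<And>z. z \<in> ball 0 1 \<Longrightarrow> u z = Re (f z)"
proof -
  obtain p q pxx pxy qyx qyy where
    d: "\<And>z. z \<in> ball 0 1 \<Longrightarrow> (u has_derivative (\<lambda>h. p z * Re h + q z * Im h)) (at z)"
      "\<And>z. z \<in> ball 0 1 \<Longrightarrow> (p has_derivative (\<lambda>h. pxx z * Re h + pxy z * Im h)) (at z)"
      "\<And>z. z \<in> ball 0 1 \<Longrightarrow> (q has_derivative (\<lambda>h. qyx z * Re h + qyy z * Im h)) (at z)"
    and c: "continuous_on (ball 0 1) pxy" "continuous_on (ball 0 1) qyx"
    and lap: "\<And>z. z \<in> ball 0 1 \<Longrightarrow> pxx z + qyy z = 0"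
    using u unfolding harmonic_on_def by blast
  have mixed: "pxy z = qyx z" if "z \<in> ball 0 1" for z
    by (rule mixed_partials_eq[OF open_ball that d c])
  define F where "F z = Complex (p z) (- q z)" for z
  have F: "(F has_field_derivative Complex (pxx z) (- qyx z)) (at z)" if "z \<in> ball 0 1" for z
  proof -
    have Feq: "F = (\<lambda>z. of_real (p z) - \<i> * of_real (q z))"
      by (simp add: fun_eq_iff F_def complex_eq_iff)
    have "(F has_derivative (\<lambda>h. of_real (pxx z * Re h + pxy z * Im h) - \<i> * of_real (qyx z * Re h + qyy z * Im h))) (at z)"
      unfolding Feq using that
      by (intro has_derivative_diff has_derivative_mult_right has_derivative_of_real d)
    moreover have "qyy z = - pxx z" using lap[OF that] by simp
    then have "of_real (pxx z * Re h + pxy z * Im h) - \<i> * of_real (qyx z * Re h + qyy z * Im h) = Complex (pxx z) (- qyx z) * h" for h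
      using mixed[OF that] by (simp add: complex_eq_iff)
    ultimately show ?thesis by (simp add: has_field_derivative_def)
  qed
  then have "F holomorphic_on ball 0 1"
    unfolding holomorphic_on_def field_differentiable_def by (meson has_field_derivative_at_within)
  then obtain g where g: "\<And>z. z \<in> ball 0 1 \<Longrightarrow> (g has_field_derivative F z) (at z within ball 0 1)"
    using holomorphic_convex_primitive'[of "ball 0 1" F] by auto
  define f where "f z = g z - g 0" for z
  have f: "f holomorphic_on ball 0 1"
  proof -
    have "g holomorphic_on ball 0 1"
      unfolding holomorphic_on_def field_differentiable_def using g by blast
    then show ?thesis unfolding f_def by (intro holomorphic_intros)
  qed
  have diff: "u z - Re (g z) = u 0 - Re (g 0)" if "z \<in> ball 0 1" for z
  proof (rule has_derivative_zero_unique[of "ball 0 1" "\<lambda>z. u z - Re (g z)"])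
    fix x :: complex assume x: "x \<in> ball 0 1"
    have "(g has_derivative (\<lambda>h. F x * h)) (at x within ball 0 1)"
      using g[OF x] by (simp add: has_field_derivative_def)
    from has_derivative_diff[OF has_derivative_at_withinI[OF d(1)[OF x]] has_derivative_Re[OF this]]
    show "((\<lambda>z. u z - Re (g z)) has_derivative (\<lambda>h. 0)) (at x within ball 0 1)"
      by (simp add: F_def)
  qed (use that in auto)
  have "u z = Re (f z)" if "z \<in> ball 0 1" for z
    using diff[OF that] u0 by (simp add: f_def)
  with f show thesis by (intro that[of f]) (auto simp: f_def)
qed

text \<open>The map \<open>w / (2 * A - w)\<close> sends the half-plane \<open>Re w < A\<close> into
  the unit disc and fixes 0. Schwarz' lemma at half the radius gives
  \<open>2 * |f| \<le> |2 * A - f|\<close>, which is at most \<open>2 * A + |f|\<close>.\<close>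

lemma Borel_Caratheodory_half:
  fixes f :: "complex \<Rightarrow> complex"
  assumes f: "f holomorphic_on ball 0 R" and f0: "f 0 = 0" and R: "R > 0"
    and A: "\<And>z. z \<in> ball 0 R \<Longrightarrow> Re (f z) < A" and z: "cmod z \<le> R / 2"
  shows "cmod (f z) \<le> 2 * A"
proof -
  have A0: "A > 0" using A[of 0] f0 R by simp
  have ne: "2 * of_real A - f w \<noteq> 0" if "w \<in> ball 0 R" for w
    using A[OF that] A0 by (auto simp: complex_eq_iff)
  have lt: "cmod (f w) < cmod (2 * of_real A - f w)" if "w \<in> ball 0 R" for w
  proof -
    have "(cmod (2 * of_real A - f w))\<^sup>2 - (cmod (f w))\<^sup>2 = 4 * A * (A - Re (f w))"
      unfolding cmod_power2 by (simp add: power2_eq_square algebra_simps)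
    also have "\<dots> > 0" using A[OF that] A0 by simp
    finally show ?thesis by (simp add: power_less_imp_less_base)
  qed
  define g where "g w = f (of_real R * w) / (2 * of_real A - f (of_real R * w))" for w
  have img: "of_real R * w \<in> ball 0 R" if "w \<in> ball 0 1" for w :: complex
    using that R by (simp add: norm_mult)
  have fh: "(\<lambda>w. f (of_real R * w)) holomorphic_on ball 0 1"
    by (rule holomorphic_on_compose_gen[of "\<lambda>w. of_real R * w" _ f "ball 0 R", unfolded o_def])
      (use f img in \<open>auto intro!: holomorphic_intros\<close>)
  have "cmod (g (z / of_real R)) \<le> cmod (z / of_real R)"
  proof (rule Schwarz_Lemma(1))
    show "g holomorphic_on ball 0 1"
      unfolding g_def using ne img by (intro holomorphic_intros fh) auto
    show "cmod (g w) < 1" if "cmod w < 1" for w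
      using lt[OF img[of w]] ne[OF img[of w]] that by (simp add: g_def norm_divide divide_less_eq)
  qed (use R z f0 in \<open>auto simp: g_def norm_divide\<close>)
  moreover have "cmod (z / of_real R) \<le> 1 / 2" using R z by (simp add: norm_divide field_simps)
  ultimately have "cmod (g (z / of_real R)) \<le> 1 / 2" by linarith
  then have "cmod (f z) / cmod (2 * of_real A - f z) \<le> 1 / 2" using R by (simp add: g_def norm_divide)
  moreover have zb: "z \<in> ball 0 R" using z R by simp
  moreover have "cmod (2 * of_real A - f z) > 0" using ne[OF zb] by simp
  ultimately have "2 * cmod (f z) \<le> cmod (2 * of_real A - f z)" by (simp add: field_simps)
  also have "\<dots> \<le> 2 * A + cmod (f z)"
    using norm_triangle_ineq4[of "2 * of_real A" "f z"] A0 by (simp add: norm_mult)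
  finally show ?thesis by simp
qed

section \<open>Maximum modulus and three circles\<close>

definition max_modulus :: "(complex \<Rightarrow> complex) \<Rightarrow> real \<Rightarrow> real" where
  "max_modulus f r = (SUP z\<in>cball 0 r. cmod (f z))"

lemma max_modulus_attained:
  assumes f: "f holomorphic_on ball 0 1" and r: "0 < r" "r < 1"
  obtains z where "cmod z = r" "cmod (f z) = max_modulus f r"
    and "\<And>w. cmod w \<le> r \<Longrightarrow> cmod (f w) \<le> max_modulus f r"
proof -
  have fc: "continuous_on (cball 0 r) f" and fi: "f holomorphic_on ball 0 r"
    using f r by (auto intro!: holomorphic_on_imp_continuous_on intro: holomorphic_on_subset)
  have "continuous_on (sphere 0 r) (\<lambda>z. cmod (f z))"
    using fc by (intro continuous_intros) (auto intro: continuous_on_subset)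
  moreover have "compact (sphere (0::complex) r)" "sphere (0::complex) r \<noteq> {}" using r by auto
  ultimately obtain z where z: "z \<in> sphere 0 r" "\<And>w. w \<in> sphere 0 r \<Longrightarrow> cmod (f w) \<le> cmod (f z)"
    using continuous_attains_sup[of "sphere 0 r" "\<lambda>z. cmod (f z)"] by auto
  have le: "cmod (f w) \<le> cmod (f z)" if "w \<in> cball 0 r" for w
    by (rule maximum_modulus_frontier[of f "cball 0 r"]) (use fc fi z that in auto)
  have "max_modulus f r = cmod (f z)"
    unfolding max_modulus_def by (rule cSup_eq_maximum) (use z le in auto)
  then show thesis using z le by (intro that[of z]) auto
qed

lemma max_modulus_ge:
  assumes "f holomorphic_on ball 0 1" "r < 1" "cmod w \<le> r"
  shows "cmod (f w) \<le> max_modulus f r"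
proof (cases "r = 0")
  case True
  then show ?thesis using assms by (simp add: max_modulus_def)
next
  case False
  then have "0 < r" using assms(3) norm_ge_zero[of w] by linarith
  then show ?thesis using max_modulus_attained[OF assms(1), of r] assms by metis
qed

lemma max_modulus_nonneg:
  assumes "f holomorphic_on ball 0 1" "0 \<le> r" "r < 1"
  shows "0 \<le> max_modulus f r"
  by (rule order_trans[OF norm_ge_zero max_modulus_ge[OF assms(1,3), of 0]]) (use assms in simp)

text \<open>Hadamard's three circles theorem for radii in geometric progression: apply the maximum principle
  to \<open>f z * cnj (f (s\<^sup>2 / cnj z))\<close>, whose modulus on the circle of radius \<open>s\<close> is \<open>|f|\<^sup>2\<close>.\<close>

lemma max_modulus_three_circles:
  assumes f: "f holomorphic_on ball 0 1" and s: "s > 0" and q: "q > 1" "s * q < 1"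
  shows "(max_modulus f s)\<^sup>2 \<le> max_modulus f (s * q) * max_modulus f (s / q)"
proof -
  define S where "S = {z::complex. s / q < cmod z \<and> cmod z < s * q}"
  define S' where "S' = {z::complex. s / q \<le> cmod z \<and> cmod z \<le> s * q}"
  have sq: "s / q < s" "s < s * q" "0 < s / q" using s q by (auto simp: field_simps)
  have s1: "s < 1" using sq q by linarith
  have nn: "0 \<le> max_modulus f (s * q)" "0 \<le> max_modulus f (s / q)"
    using sq q s s1 by (auto intro!: max_modulus_nonneg[OF f])
  have oS: "open S" unfolding S_def by (intro open_Collect_conj open_Collect_less continuous_intros)
  have cS': "closed S'" unfolding S'_def by (intro closed_Collect_conj closed_Collect_le continuous_intros)
  have SS': "S \<subseteq> S'" by (auto simp: S_def S'_def)
  then have clS: "closure S \<subseteq> S'" using cS' by (rule closure_minimal)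
  have frS: "frontier S \<subseteq> S' - S" using clS oS by (auto simp: frontier_def interior_open)
  define F where "F z = f z * cnj (f (cnj (of_real (s\<^sup>2) / z)))" for z
  have inv: "cnj (of_real (s\<^sup>2) / z) \<in> ball 0 1" "z \<in> ball 0 1" "z \<noteq> 0" if "z \<in> S'" for z
  proof -
    show z0: "z \<noteq> 0" using that sq by (auto simp: S'_def)
    have "s\<^sup>2 / cmod z \<le> s\<^sup>2 / (s / q)" using that sq by (intro divide_left_mono mult_pos_pos) (auto simp: S'_def)
    also have "\<dots> = s * q" using s q by (simp add: power2_eq_square)
    finally show "cnj (of_real (s\<^sup>2) / z) \<in> ball 0 1" using q by (simp add: norm_divide norm_power)
    show "z \<in> ball 0 1" using that q by (simp add: S'_def)
  qed
  have inv': "cmod (of_real (s\<^sup>2) / z) < 1" if "z \<in> S" for z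
    using inv(1)[of z] that SS' by (auto simp: norm_divide)
  have fb: "(cnj \<circ> f \<circ> cnj) holomorphic_on ball 0 1"
  proof (rule holomorphic_on_compose_cnj_cnj)
    have "cnj ` ball 0 1 = ball 0 1" by (force simp: image_iff intro: bexI[of _ "cnj x" for x])
    then show "f holomorphic_on cnj ` ball 0 1" using f by simp
  qed simp
  have gh: "(\<lambda>z. cnj (f (cnj (of_real (s\<^sup>2) / z)))) holomorphic_on S"
    by (rule holomorphic_on_compose_gen[of "\<lambda>z. of_real (s\<^sup>2) / z" _ "\<lambda>z. cnj (f (cnj z))" "ball 0 1", unfolded o_def])
      (use fb[unfolded o_def] inv(3) inv' SS' in \<open>auto intro!: holomorphic_intros\<close>)
  have Fh: "F holomorphic_on S"
    unfolding F_def by (intro holomorphic_on_mult gh holomorphic_on_subset[OF f]) (use inv SS' in auto)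
  have fc: "continuous_on (ball 0 1) f" by (rule holomorphic_on_imp_continuous_on[OF f])
  have Fc: "continuous_on S' F"
    unfolding F_def
    by (intro continuous_intros continuous_on_compose2[OF fc]) (use inv in auto)
  \<comment> \<open>The reflection in the circle of radius \<open>s\<close> swaps the two boundary
    circles, so each boundary value of \<open>F\<close> pairs one value of \<open>f\<close> from
    either circle.\<close>
  have bound: "cmod (F w) \<le> max_modulus f (s * q) * max_modulus f (s / q)" if "w \<in> S'" "w \<notin> S" for w
  proof -
    have w0: "w \<noteq> 0" using inv that by auto
    have eq: "cmod (F w) = cmod (f w) * cmod (f (cnj (of_real (s\<^sup>2) / w)))" by (simp add: F_def norm_mult)
    have n: "cmod (cnj (of_real (s\<^sup>2) / w)) = s\<^sup>2 / cmod w" by (simp add: norm_divide norm_power)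
    have "cmod w = s * q \<or> cmod w = s / q" using that by (auto simp: S_def S'_def)
    then consider "cmod w = s * q" | "cmod w = s / q" by blast
    then show ?thesis
    proof cases
      case 1
      then have "cmod (cnj (of_real (s\<^sup>2) / w)) = s / q" using s q n by (simp add: power2_eq_square)
      then show ?thesis unfolding eq using 1 q sq s1
        by (intro mult_mono max_modulus_ge[OF f]) (use nn in auto)
    next
      case 2
      then have "cmod (cnj (of_real (s\<^sup>2) / w)) = s * q" using s q n by (simp add: power2_eq_square)
      then have "cmod (f (cnj (of_real (s\<^sup>2) / w))) * cmod (f w) \<le> max_modulus f (s * q) * max_modulus f (s / q)"
        using 2 q sq s1
        by (intro mult_mono max_modulus_ge[OF f]) (use nn in auto)
      then show ?thesis unfolding eq by (simp add: mult.commute)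
    qed
  qed
  have "s < 1" using sq q by linarith
  then obtain z where z: "cmod z = s" "cmod (f z) = max_modulus f s"
    using max_modulus_attained[OF f s] by metis
  have zS: "z \<in> S" using z sq by (simp add: S_def)
  have "cmod (F z) \<le> max_modulus f (s * q) * max_modulus f (s / q)"
  proof (rule maximum_modulus_frontier[of F S])
    show "F holomorphic_on interior S" using Fh oS by (simp add: interior_open)
    show "continuous_on (closure S) F" by (rule continuous_on_subset[OF Fc clS])
    show "bounded S" by (rule bounded_subset[of "ball 0 1"]) (use q in \<open>auto simp: S_def\<close>)
  qed (use bound frS zS in auto)
  moreover have "cnj (of_real (s\<^sup>2) / z) = z"
  proof -
    have "z \<noteq> 0" using z s by auto
    moreover have "of_real (s\<^sup>2) = z * cnj z" using z by (simp add: complex_norm_square[symmetric])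
    ultimately show ?thesis by simp
  qed
  ultimately show ?thesis using z(2) by (simp add: F_def norm_mult power2_eq_square)
qed

section \<open>Area of the positivity set on concentric annuli\<close>

lemma measure_lborel_affine_vimage:
  fixes a :: complex
  assumes c: "c > 0" and A: "A \<in> sets borel"
  shows "measure lborel A = c\<^sup>2 * measure lborel ((\<lambda>z. a + of_real c * z) -` A)"
proof -
  have T: "(\<lambda>x. a + c *\<^sub>R x) = (\<lambda>z. a + of_real c * z)" by (simp add: scaleR_conv_of_real)
  have "emeasure lborel A = emeasure (density (distr lborel borel (\<lambda>x. a + c *\<^sub>R x)) (\<lambda>_. \<bar>c\<bar> ^ DIM(complex))) A"
    using c by (intro arg_cong[where f = "\<lambda>M. emeasure M A"] lborel_affine) auto
  also have "\<dots> = ennreal (c\<^sup>2) * emeasure (distr lborel borel (\<lambda>x. a + c *\<^sub>R x)) A"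
    using A c by (subst emeasure_density_const) auto
  also have "emeasure (distr lborel borel (\<lambda>x. a + c *\<^sub>R x)) A = emeasure lborel ((\<lambda>z. a + of_real c * z) -` A)"
    using A unfolding T by (subst emeasure_distr) auto
  finally show ?thesis by (simp add: measure_def enn2real_mult)
qed

lemma disjoint_annuli_measure:
  fixes E :: "complex set" and G :: "nat set"
  assumes E: "open E" "bounded E" and G: "finite G"
    and b: "\<And>i j. i \<in> G \<Longrightarrow> j \<in> G \<Longrightarrow> i < j \<Longrightarrow> b i \<le> a j"
    and c: "\<And>k. k \<in> G \<Longrightarrow> c \<le> measure lborel {z\<in>E. a k < cmod z \<and> cmod z < b k}"
  shows "real (card G) * c \<le> measure lborel E"
proof -
  define A where "A k = {z\<in>E. a k < cmod z \<and> cmod z < b k}" for k :: nat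
  have fin: "emeasure lborel B \<noteq> \<infinity>" if "B \<subseteq> E" for B
    using emeasure_bounded_finite[OF bounded_subset[OF E(2) that]] by auto
  have Ao: "open (A k)" for k
  proof -
    have "A k = E \<inter> {z. a k < cmod z \<and> cmod z < b k}" by (auto simp: A_def)
    moreover have "open {z. a k < cmod z \<and> cmod z < b k}"
      by (intro open_Collect_conj open_Collect_less continuous_intros)
    ultimately show ?thesis using E by auto
  qed
  have "real (card G) * c = (\<Sum>k\<in>G. c)" by simp
  also have "\<dots> \<le> (\<Sum>k\<in>G. measure lborel (A k))" by (intro sum_mono) (auto simp: A_def c)
  also have "\<dots> = measure lborel (\<Union>k\<in>G. A k)"
  proof (rule measure_finite_Union[symmetric])
    show "disjoint_family_on A G"
      unfolding disjoint_family_on_def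
    proof (intro ballI impI)
      fix i j assume ij: "i \<in> G" "j \<in> G" "i \<noteq> j"
      show "A i \<inter> A j = {}"
        using b[of i j] b[of j i] ij by (cases "i < j") (force simp: A_def)+
    qed
    show "emeasure lborel (A k) \<noteq> \<infinity>" if "k \<in> G" for k by (rule fin) (auto simp: A_def)
  qed (use G Ao in auto)
  also have "\<dots> \<le> measure lborel E"
    using fin[of E] Ao E(1) by (intro measure_mono_fmeasurable) (auto simp: A_def fmeasurable_def top.not_eq_extremum)
  finally show ?thesis .
qed

text \<open>In the weighted mean value inequality at \<open>p\<close> only points with
  \<open>Re f > 0\<close> help, each by at most \<open>A\<close>. The constant is
  \<open>(1/2)^2 * pi * (h/2)^2\<close>, a lower bound for the integral of the bump.\<close>

lemma positive_part_mean_bound: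
  assumes f: "f holomorphic_on ball 0 1" and h: "h > 0" and sub: "cball p h \<subseteq> ball 0 1"
    and A: "\<And>z. z \<in> cball p h \<Longrightarrow> Re (f z) \<le> A" and p: "Re (f p) \<ge> 0"
    and E: "E \<in> sets borel" "bounded E" "{z\<in>ball p h. Re (f z) > 0} \<subseteq> E"
  shows "Re (f p) * (pi / 16 * h\<^sup>2) \<le> A * measure lborel E"
proof -
  have A0: "A \<ge> 0" using A[of p] p h by simp
  note C2 = C2_on_Re_holomorphic[OF f open_ball]
  have "Re (f p) * (pi / 16 * h\<^sup>2) \<le> Re (f p) * (\<integral>z. cutoff 2 p h z \<partial>lborel)"
    using cutoff_integral_ge[of h 2 p] h p by (intro mult_left_mono) (auto simp: power2_eq_square)
  also have "\<dots> \<le> (\<integral>z. cutoff 2 p h z * Re (f z) \<partial>lborel)"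
    by (rule cutoff_submean[OF C2 sub h]) simp
  also have "\<dots> \<le> (\<integral>z. A * indicator E z \<partial>lborel)"
  proof (rule integral_mono)
    show "integrable lborel (\<lambda>z. cutoff 2 p h z * Re (f z))"
      using h by (intro integrable_mult_supported[OF open_ball sub])
        (auto intro!: continuous_intros cutoff_eq_0 holomorphic_on_imp_continuous_on[OF f])
    show "integrable lborel (\<lambda>z. A * indicator E z)"
      using E emeasure_bounded_finite[OF E(2)] by (intro integrable_mult_right integrable_real_indicator) auto
    fix z
    show "cutoff 2 p h z * Re (f z) \<le> A * indicator E z"
    proof (cases "z \<in> ball p h \<and> Re (f z) > 0")
      case True
      then have "cutoff 2 p h z * Re (f z) \<le> 1 * A"
        using A[of z] by (intro mult_mono cutoff_le_1) auto
      then show ?thesis using True E(3) by auto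
    next
      case False
      then have "cutoff 2 p h z * Re (f z) \<le> 0"
        using cutoff_eq_0[of 2 h z p] h by (auto simp: mult_nonneg_nonpos not_less)
      also have "0 \<le> A * indicator E z" using A0 by simp
      finally show ?thesis .
    qed
  qed
  finally show ?thesis by simp
qed

text \<open>\<open>local_area_bound\<close> in a disc of radius comparable to \<open>\<eta> * cmod p\<close> around \<open>p\<close>.\<close>

definition local_area_constants :: "real \<Rightarrow> real \<Rightarrow> real \<Rightarrow> bool" where
  "local_area_constants K c D0 \<longleftrightarrow> (\<forall>f \<eta> p \<kappa> D. f holomorphic_on ball 0 1 \<longrightarrow> 0 < \<eta> \<longrightarrow> \<eta> \<le> 1 / 32 \<longrightarrow>
    p \<noteq> 0 \<longrightarrow> cmod p * exp (6 * \<eta>) \<le> 1 \<longrightarrow> \<kappa> > 0 \<longrightarrow> D \<ge> D0 \<longrightarrow>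
    (\<forall>z. cmod z \<le> cmod p * exp (- \<eta>) \<longrightarrow> cmod (f z) \<le> \<kappa>) \<longrightarrow> cmod (f p) \<ge> \<kappa> * exp D \<longrightarrow>
    (\<forall>z. cmod z \<le> cmod p * exp (4 * \<eta>) \<longrightarrow> cmod (f z) \<le> \<kappa> * exp (K * D)) \<longrightarrow>
    c * (2 * \<eta> * cmod p)\<^sup>2 \<le> measure lborel {z\<in>{z\<in>ball 0 1. Re (f z) > 0}.
      cmod p * exp (- 16 * \<eta>) < cmod z \<and> cmod z < cmod p * exp (8 * \<eta>)})"

text \<open>Pull \<open>f\<close> back by \<open>T z = p + 2 * \<eta> * cmod p * z\<close>, with
  \<open>e\<close> the radial direction of \<open>p\<close>. The discs of
  \<open>local_area_bound\<close> then lie between circles about the origin; the area picks up the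
  square of the scaling factor.\<close>

lemma local_area_constants_exist:
  assumes K: "K \<ge> 0"
  obtains c D0 where "c > 0" "D0 \<ge> 1" "local_area_constants K c D0"
proof -
  obtain c D1 where cD: "c > 0" "D1 > 0" and main:
    "\<And>e g D. cmod e = 1 \<Longrightarrow> g holomorphic_on ball (- e) 4 \<Longrightarrow> D \<ge> D1 \<Longrightarrow>
      (\<And>z. z \<in> cball (- 2 * e) 1 \<Longrightarrow> cmod (g z) \<le> 1) \<Longrightarrow> cmod (g 0) \<ge> exp D \<Longrightarrow>
      (\<And>z. z \<in> cball (- e) 3 \<Longrightarrow> cmod (g z) \<le> exp (K * D)) \<Longrightarrow>
      c \<le> measure lborel {z\<in>cball (- e) 2. Re (g z) > 0}"
    using local_area_bound[OF K] by blast
  have "local_area_constants K c (max 1 D1)"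
    unfolding local_area_constants_def
  proof (intro allI impI)
    fix f :: "complex \<Rightarrow> complex" and \<eta> \<kappa> D :: real and p :: complex
    assume f: "f holomorphic_on ball 0 1" and \<eta>: "0 < \<eta>" "\<eta> \<le> 1 / 32" and p: "p \<noteq> 0" "cmod p * exp (6 * \<eta>) \<le> 1"
      and \<kappa>: "\<kappa> > 0" and D1: "D \<ge> max 1 D1" and left: "\<forall>z. cmod z \<le> cmod p * exp (- \<eta>) \<longrightarrow> cmod (f z) \<le> \<kappa>"
      and mid: "cmod (f p) \<ge> \<kappa> * exp D" and big: "\<forall>z. cmod z \<le> cmod p * exp (4 * \<eta>) \<longrightarrow> cmod (f z) \<le> \<kappa> * exp (K * D)"
    have D: "D \<ge> D1" using D1 by simp
    define r where "r = cmod p"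
    have r: "r > 0" using p by (simp add: r_def)
    define e where "e = p / of_real r"
    have e: "cmod e = 1" "of_real r * e = p" using r by (simp_all add: e_def norm_divide r_def)
    define T where "T z = p + of_real (2 * \<eta> * r) * z" for z
    have Teq: "T (of_real x * e + w) = of_real r * (of_real (1 + 2 * \<eta> * x) * e + of_real (2 * \<eta>) * w)" for x w
      unfolding T_def e(2)[symmetric] by (simp add: algebra_simps)
    have Tup: "cmod (T (of_real x * e + w)) \<le> r * (1 + 2 * \<eta> * x + 2 * \<eta> * cmod w)" if "1 + 2 * \<eta> * x \<ge> 0" for x w
    proof -
      have "cmod (of_real (1 + 2 * \<eta> * x) * e + of_real (2 * \<eta>) * w) \<le> (1 + 2 * \<eta> * x) * 1 + 2 * \<eta> * cmod w"
        using norm_triangle_ineq[of "of_real (1 + 2 * \<eta> * x) * e" "of_real (2 * \<eta>) * w"] that e \<eta>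
        by (simp add: norm_mult del: of_real_add of_real_mult)
      then show ?thesis unfolding Teq norm_mult using r by simp
    qed
    have Tlow: "cmod (T (of_real x * e + w)) \<ge> r * (1 + 2 * \<eta> * x - 2 * \<eta> * cmod w)" if "1 + 2 * \<eta> * x \<ge> 0" for x w
    proof -
      have "cmod (of_real (1 + 2 * \<eta> * x) * e + of_real (2 * \<eta>) * w) \<ge> (1 + 2 * \<eta> * x) * 1 - 2 * \<eta> * cmod w"
        using norm_diff_ineq[of "of_real (1 + 2 * \<eta> * x) * e" "of_real (2 * \<eta>) * w"] that e \<eta>
        by (simp add: norm_mult del: of_real_add of_real_mult)
      then show ?thesis unfolding Teq norm_mult using r by simp
    qed
    \<comment> \<open>Extreme moduli of the images, divided by \<open>r\<close>:
      \<open>1 - 2 * \<eta>\<close> for the disc about \<open>- 2 * e\<close>,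
      \<open>1 + 4 * \<eta>\<close> and \<open>1 + 6 * \<eta>\<close> for radii 3 and 4 about
      \<open>- e\<close>, and \<open>1 - 6 * \<eta>\<close> as the lower edge for radius 2.\<close>
    have E1: "1 - 2 * \<eta> \<le> exp (- \<eta>)" using exp_ge_add_one_self[of "-\<eta>"] \<eta> by linarith
    have E2: "1 + 4 * \<eta> \<le> exp (4 * \<eta>)" "1 + 6 * \<eta> \<le> exp (6 * \<eta>)" "1 + 8 * \<eta> \<le> exp (8 * \<eta>)"
      using exp_ge_add_one_self[of "4 * \<eta>"] exp_ge_add_one_self[of "6 * \<eta>"] exp_ge_add_one_self[of "8 * \<eta>"] by auto
    have E3: "exp (- 16 * \<eta>) < 1 - 6 * \<eta>"
    proof -
      have "exp (- 16 * \<eta>) = inverse (exp (16 * \<eta>))" by (simp add: exp_minus)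
      also have "\<dots> \<le> inverse (1 + 16 * \<eta>)"
        using exp_ge_add_one_self[of "16 * \<eta>"] \<eta> by (intro le_imp_inverse_le) auto
      also have "\<dots> < 1 - 6 * \<eta>"
      proof -
        have "96 * \<eta> * \<eta> < 10 * \<eta>" using \<eta> by simp
        then have "1 < (1 - 6 * \<eta>) * (1 + 16 * \<eta>)" by (simp add: algebra_simps)
        then show ?thesis using \<eta> by (simp add: inverse_eq_divide divide_less_eq)
      qed
      finally show ?thesis .
    qed
    define g where "g z = f (T z) / of_real \<kappa>" for z
    have dec1: "z = of_real (-1) * e + (z + e)" and dec2: "z = of_real (-2) * e + (z + 2 * e)" for z by simp_all
    have Tin: "T z \<in> ball 0 1" if "z \<in> ball (- e) 4" for z
    proof -
      have "cmod (z + e) < 4" using that by (simp add: dist_norm norm_minus_commute[of "-e"])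
      then have "1 + 2 * \<eta> * (-1) + 2 * \<eta> * cmod (z + e) < 1 + 6 * \<eta>" using \<eta> by simp
      then have "r * (1 + 2 * \<eta> * (-1) + 2 * \<eta> * cmod (z + e)) < r * (1 + 6 * \<eta>)" using r by simp
      also have "\<dots> \<le> r * exp (6 * \<eta>)" using r E2 by simp
      also have "\<dots> \<le> 1" using p by (simp add: r_def)
      finally have "r * (1 + 2 * \<eta> * (-1) + 2 * \<eta> * cmod (z + e)) < 1" .
      then have "cmod (T (of_real (-1) * e + (z + e))) < 1"
        using Tup[of "-1" "z + e"] \<eta> by linarith
      then show ?thesis by (simp only: dec1[symmetric] mem_ball_0)
    qed
    have "(\<lambda>z. f (T z)) holomorphic_on ball (- e) 4"
      by (rule holomorphic_on_compose_gen[of T _ f "ball 0 1", unfolded o_def])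
        (use f Tin in \<open>auto simp: T_def[abs_def] intro!: holomorphic_intros\<close>)
    then have gh: "g holomorphic_on ball (- e) 4" unfolding g_def using \<kappa> by (intro holomorphic_intros) auto
    have gl: "cmod (g z) \<le> 1" if "z \<in> cball (- 2 * e) 1" for z
    proof -
      have "cmod (z + 2 * e) \<le> 1" using that by (simp add: dist_norm norm_minus_commute[of "-(2*e)"])
      then have "2 * \<eta> * cmod (z + 2 * e) \<le> 2 * \<eta> * 1" using \<eta> by (intro mult_left_mono) auto
      then have "1 + 2 * \<eta> * (-2) + 2 * \<eta> * cmod (z + 2 * e) \<le> exp (- \<eta>)" using E1 by linarith
      then have "r * (1 + 2 * \<eta> * (-2) + 2 * \<eta> * cmod (z + 2 * e)) \<le> r * exp (- \<eta>)" using r by (intro mult_left_mono) auto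
      then have "cmod (T (of_real (-2) * e + (z + 2 * e))) \<le> r * exp (- \<eta>)"
        using Tup[of "-2" "z + 2 * e"] \<eta> by linarith
      then have "cmod (T z) \<le> cmod p * exp (- \<eta>)" by (simp only: dec2[symmetric] r_def)
      from left[rule_format, OF this] show ?thesis using \<kappa> by (simp add: g_def norm_divide)
    qed
    have gm: "cmod (g 0) \<ge> exp D" using mid \<kappa> by (simp add: g_def T_def norm_divide field_simps)
    have gb: "cmod (g z) \<le> exp (K * D)" if "z \<in> cball (- e) 3" for z
    proof -
      have "cmod (z + e) \<le> 3" using that by (simp add: dist_norm norm_minus_commute[of "-e"])
      then have "2 * \<eta> * cmod (z + e) \<le> 2 * \<eta> * 3" using \<eta> by (intro mult_left_mono) auto
      then have "1 + 2 * \<eta> * (-1) + 2 * \<eta> * cmod (z + e) \<le> exp (4 * \<eta>)" using E2 by linarith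
      then have "r * (1 + 2 * \<eta> * (-1) + 2 * \<eta> * cmod (z + e)) \<le> r * exp (4 * \<eta>)" using r by (intro mult_left_mono) auto
      then have "cmod (T (of_real (-1) * e + (z + e))) \<le> r * exp (4 * \<eta>)"
        using Tup[of "-1" "z + e"] \<eta> by linarith
      then have "cmod (T z) \<le> cmod p * exp (4 * \<eta>)" by (simp only: dec1[symmetric] r_def)
      from big[rule_format, OF this] show ?thesis using \<kappa> by (simp add: g_def norm_divide field_simps)
    qed
    define A where "A = {z\<in>{z\<in>ball 0 1. Re (f z) > 0}. cmod p * exp (- 16 * \<eta>) < cmod z \<and> cmod z < cmod p * exp (8 * \<eta>)}"
    have Ao: "open A"
    proof -
      have "open {z\<in>ball 0 1. Re (f z) > 0}"
        using continuous_open_preimage[OF continuous_on_Re[OF holomorphic_on_imp_continuous_on[OF f]] open_ball, of "{0<..}"]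
        by (simp add: vimage_def Int_def conj_commute)
      moreover have "open {z. cmod p * exp (- 16 * \<eta>) < cmod z \<and> cmod z < cmod p * exp (8 * \<eta>)}"
        by (intro open_Collect_conj open_Collect_less continuous_intros)
      moreover have "A = {z\<in>ball 0 1. Re (f z) > 0} \<inter>
          {z. cmod p * exp (- 16 * \<eta>) < cmod z \<and> cmod z < cmod p * exp (8 * \<eta>)}"
        by (auto simp: A_def)
      ultimately show ?thesis by (simp only: open_Int)
    qed
    have sub: "{z\<in>cball (- e) 2. Re (g z) > 0} \<subseteq> T -` A"
    proof
      fix z assume z: "z \<in> {z\<in>cball (- e) 2. Re (g z) > 0}"
      then have "cmod (z + e) \<le> 2" by (simp add: dist_norm norm_minus_commute[of "-e"])
      then have n: "2 * \<eta> * cmod (z + e) \<le> 2 * \<eta> * 2" using \<eta> by (intro mult_left_mono) auto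
      then have "1 + 2 * \<eta> * (-1) + 2 * \<eta> * cmod (z + e) < exp (8 * \<eta>)"
        using E2(3) \<eta> by linarith
      then have "r * (1 + 2 * \<eta> * (-1) + 2 * \<eta> * cmod (z + e)) < r * exp (8 * \<eta>)"
        using r by (rule mult_strict_left_mono)
      then have 1: "cmod (T (of_real (-1) * e + (z + e))) < r * exp (8 * \<eta>)"
        using Tup[of "-1" "z + e"] \<eta> by linarith
      have "exp (- 16 * \<eta>) < 1 + 2 * \<eta> * (-1) - 2 * \<eta> * cmod (z + e)"
        using E3 n by linarith
      then have "r * exp (- 16 * \<eta>) < r * (1 + 2 * \<eta> * (-1) - 2 * \<eta> * cmod (z + e))"
        using r by (rule mult_strict_left_mono)
      then have 2: "r * exp (- 16 * \<eta>) < cmod (T (of_real (-1) * e + (z + e)))"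
        using Tlow[of "-1" "z + e"] \<eta> by linarith
      have "z \<in> ball (- e) 4" using z by auto
      then have "T z \<in> ball 0 1" by (rule Tin)
      moreover have "Re (f (T z)) > 0" using z \<kappa> by (simp add: g_def zero_less_divide_iff)
      ultimately show "z \<in> T -` A"
        using 1 2 unfolding A_def dec1[symmetric] r_def by simp
    qed
    have "c \<le> measure lborel {z\<in>cball (- e) 2. Re (g z) > 0}"
      by (rule main[OF e(1) gh D gl gm gb])
    also have "\<dots> \<le> measure lborel (T -` A)"
    proof (rule measure_mono_fmeasurable[OF sub])
      have "open {z\<in>ball (- e) 4. Re (g z) > 0}"
        using continuous_open_preimage[OF continuous_on_Re[OF holomorphic_on_imp_continuous_on[OF gh]] open_ball, of "{0<..}"]
        by (simp add: vimage_def Int_def conj_commute)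
      moreover have "{z\<in>cball (- e) 2. Re (g z) > 0} = cball (-e) 2 \<inter> {z\<in>ball (- e) 4. Re (g z) > 0}" by auto
      ultimately show "{z\<in>cball (- e) 2. Re (g z) > 0} \<in> sets lborel" by simp
      have "T -` A \<subseteq> cball (- p / of_real (2 * \<eta> * r)) (1 / (2 * \<eta> * r))"
      proof
        fix z assume "z \<in> T -` A"
        then have "cmod (p + of_real (2 * \<eta> * r) * z) \<le> 1" by (auto simp: A_def T_def)
        moreover have "p + of_real (2 * \<eta> * r) * z = of_real (2 * \<eta> * r) * (z - - p / of_real (2 * \<eta> * r))"
          using \<eta> r by (simp add: field_simps)
        ultimately have "(2 * \<eta> * r) * cmod (z - - p / of_real (2 * \<eta> * r)) \<le> 1"
          using \<eta> r by (simp only: norm_mult norm_of_real) simp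
        then show "z \<in> cball (- p / of_real (2 * \<eta> * r)) (1 / (2 * \<eta> * r))"
          using \<eta> r unfolding mem_cball dist_norm by (subst norm_minus_commute) (simp add: field_simps)
      qed
      then have "bounded (T -` A)" by (rule bounded_subset[OF bounded_cball])
      moreover have "open (T -` A)" unfolding T_def by (intro open_vimage Ao continuous_intros)
      ultimately show "T -` A \<in> fmeasurable lborel"
        using emeasure_bounded_finite[of "T -` A"] by (auto simp: fmeasurable_def)
    qed
    finally have "c * (2 * \<eta> * r)\<^sup>2 \<le> (2 * \<eta> * r)\<^sup>2 * measure lborel (T -` A)"
      by (simp add: mult.commute mult_right_mono)
    also have "\<dots> = measure lborel A"
      using measure_lborel_affine_vimage[of "2 * \<eta> * r" A p] Ao \<eta> r unfolding T_def[abs_def] by simp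
    finally show "c * (2 * \<eta> * cmod p)\<^sup>2 \<le> measure lborel {z\<in>{z\<in>ball 0 1. Re (f z) > 0}.
        cmod p * exp (- 16 * \<eta>) < cmod z \<and> cmod z < cmod p * exp (8 * \<eta>)}"
      unfolding A_def r_def .
  qed
  then show thesis using that[of c "max 1 D1"] cD by simp
qed

section \<open>Maximum modulus and maximal real part\<close>

lemma max_modulus_mono:
  assumes "f holomorphic_on ball 0 1" "0 < r" "r \<le> s" "s < 1"
  shows "max_modulus f r \<le> max_modulus f s"
proof -
  obtain z where "cmod z = r" "cmod (f z) = max_modulus f r"
    using max_modulus_attained[OF assms(1,2)] assms by (metis order.strict_trans1)
  then show ?thesis using max_modulus_ge[OF assms(1,4), of z] assms by simp
qed

lemma holomorphic_zero_on_ball: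
  assumes f: "f holomorphic_on ball 0 1" and r: "r > 0" and zero: "\<And>z. cmod z < r \<Longrightarrow> f z = 0" and z: "z \<in> ball 0 1"
  shows "f z = 0"
proof -
  define s where "s = min r 1"
  have s: "s > 0" using r by (simp add: s_def)
  show ?thesis
    by (rule analytic_continuation_open[of "ball 0 s" "ball 0 1" f "\<lambda>_. 0"])
      (use f z s zero in \<open>auto simp: s_def\<close>)
qed

lemma max_modulus_pos:
  assumes "f holomorphic_on ball 0 1" "0 < r" "r < 1" "z \<in> ball 0 1" "f z \<noteq> 0"
  shows "max_modulus f r > 0"
proof (rule ccontr)
  assume "\<not> max_modulus f r > 0"
  have "f w = 0" if "cmod w < r" for w
  proof -
    have "cmod (f w) \<le> max_modulus f r" using that by (intro max_modulus_ge[OF assms(1,3)]) auto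
    then have "cmod (f w) \<le> 0" using \<open>\<not> max_modulus f r > 0\<close> by linarith
    then show ?thesis by simp
  qed
  then show False using holomorphic_zero_on_ball[OF assms(1,2) _ assms(4)] assms(5) by blast
qed

text \<open>Read off from \<open>|exp f| = exp (Re f)\<close>, so that attainment on the circle is
  inherited from the maximum modulus principle.\<close>

definition max_re :: "(complex \<Rightarrow> complex) \<Rightarrow> real \<Rightarrow> real" where
  "max_re f r = ln (max_modulus (\<lambda>z. exp (f z)) r)"

lemma max_re_attained:
  assumes f: "f holomorphic_on ball 0 1" and r: "0 < r" "r < 1"
  obtains z where "cmod z = r" "Re (f z) = max_re f r" "\<And>w. cmod w \<le> r \<Longrightarrow> Re (f w) \<le> max_re f r"
proof -
  have "(\<lambda>z. exp (f z)) holomorphic_on ball 0 1" by (intro holomorphic_intros f)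
  then obtain z where z: "cmod z = r" "cmod (exp (f z)) = max_modulus (\<lambda>z. exp (f z)) r"
    "\<And>w. cmod w \<le> r \<Longrightarrow> cmod (exp (f w)) \<le> max_modulus (\<lambda>z. exp (f z)) r"
    using max_modulus_attained r by blast
  have eq: "max_re f r = Re (f z)" by (simp add: max_re_def z(2)[symmetric])
  show thesis
    by (rule that[OF z(1) eq[symmetric]]) (use z(3) in \<open>simp add: eq z(2)[symmetric]\<close>)
qed

lemma max_re_mono:
  assumes f: "f holomorphic_on ball 0 1" and r: "0 < r" "r \<le> s" "s < 1"
  shows "max_re f r \<le> max_re f s"
proof -
  obtain z where z: "cmod z = r" "Re (f z) = max_re f r" using max_re_attained[OF f r(1)] r by (metis order.strict_trans1)
  have "0 < s" using r by simp
  then show ?thesis using max_re_attained[OF f _ r(3)] z r by metis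
qed

lemma max_re_le_max_modulus:
  assumes f: "f holomorphic_on ball 0 1" and r: "0 < r" "r < 1"
  shows "max_re f r \<le> max_modulus f r"
proof -
  obtain z where z: "cmod z = r" "Re (f z) = max_re f r" using max_re_attained[OF f r] by metis
  show ?thesis using max_modulus_ge[OF f r(2), of z] complex_Re_le_cmod[of "f z"] z by simp
qed

text \<open>If \<open>Re f \<le> 0\<close> on a disc, then \<open>Borel_Caratheodory_half\<close>
  holds with arbitrarily small bound, so \<open>f\<close> vanishes near 0 and hence
  everywhere.\<close>

lemma max_re_pos:
  assumes f: "f holomorphic_on ball 0 1" "f 0 = 0" and r: "0 < r" "r < 1" and z: "z \<in> ball 0 1" "f z \<noteq> 0"
  shows "max_re f r > 0"
proof (rule ccontr)
  assume neg: "\<not> max_re f r > 0"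
  have le: "Re (f w) \<le> 0" if "cmod w \<le> r" for w
    using max_re_attained[OF f(1) r] neg that by (metis not_le order_trans linorder_not_less)
  have "f w = 0" if "cmod w < r / 2" for w
  proof -
    have "cmod (f w) \<le> 0 + \<epsilon>" if "\<epsilon> > 0" for \<epsilon>
    proof -
      have "cmod (f w) \<le> 2 * (\<epsilon> / 2)"
      proof (rule Borel_Caratheodory_half[where f = f and z = w and R = r])
        show "f holomorphic_on ball 0 r" by (rule holomorphic_on_subset[OF f(1)]) (use r in auto)
        show "Re (f z) < \<epsilon> / 2" if "z \<in> ball 0 r" for z using le[of z] that \<open>\<epsilon> > 0\<close> by auto
      qed (use f r \<open>cmod w < r / 2\<close> in auto)
      then show ?thesis by simp
    qed
    then have "cmod (f w) \<le> 0" by (rule field_le_epsilon)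
    then show ?thesis by simp
  qed
  moreover have "r / 2 > 0" using r by simp
  ultimately show False using holomorphic_zero_on_ball[OF f(1) _ _ z(1)] z(2) by blast
qed

lemma max_modulus_le_max_re:
  assumes f: "f holomorphic_on ball 0 1" "f 0 = 0" and r: "0 < r" "r < 1" and z: "z \<in> ball 0 1" "f z \<noteq> 0"
  shows "max_modulus f (r / 2) \<le> 4 * max_re f r"
proof -
  have pos: "max_re f r > 0" by (rule max_re_pos[OF f r z])
  have r2: "0 < r / 2" "r / 2 < 1" using r by auto
  obtain w where w: "cmod w = r / 2" "cmod (f w) = max_modulus f (r / 2)"
    using max_modulus_attained[OF f(1) r2] by metis
  \<comment> \<open>The strict bound demanded for the real part is met by doubling
    \<open>max_re f r\<close>.\<close>
  have "cmod (f w) \<le> 2 * (2 * max_re f r)"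
  proof (rule Borel_Caratheodory_half[where f = f and z = w and R = r])
    show "f holomorphic_on ball 0 r" by (rule holomorphic_on_subset[OF f(1)]) (use r in auto)
    fix z :: complex assume "z \<in> ball 0 r"
    then have "Re (f z) \<le> max_re f r" using max_re_attained[OF f(1) r] by (metis less_imp_le mem_ball_0)
    then show "Re (f z) < 2 * max_re f r" using pos by simp
  qed (use f r w in auto)
  then show ?thesis using w by simp
qed

section \<open>Counting along a geometric sequence of radii\<close>

lemma increment_count:
  fixes V :: "nat \<Rightarrow> real"
  assumes "\<And>k. k < n \<Longrightarrow> V k \<le> V (Suc k)" "\<And>k. k < n \<Longrightarrow> P k \<Longrightarrow> V k + t \<le> V (Suc k)"
  shows "V 0 + t * real (card {k. k < n \<and> P k}) \<le> V n"
  using assms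
proof (induction n)
  case (Suc n)
  have IH: "V 0 + t * real (card {k. k < n \<and> P k}) \<le> V n" using Suc by simp
  show ?case
  proof (cases "P n")
    case True
    then have "{k. k < Suc n \<and> P k} = insert n {k. k < n \<and> P k}" by (auto simp: less_Suc_eq)
    then have "real (card {k. k < Suc n \<and> P k}) = real (card {k. k < n \<and> P k}) + 1" by simp
    then have "V 0 + t * real (card {k. k < Suc n \<and> P k}) = V 0 + t * real (card {k. k < n \<and> P k}) + t"
      by (simp only: distrib_left mult_1_right add.assoc)
    then show ?thesis using IH Suc.prems(2)[of n] True by simp
  next
    case False
    then have "{k. k < Suc n \<and> P k} = {k. k < n \<and> P k}" by (auto simp: less_Suc_eq)
    then show ?thesis using IH Suc.prems(1)[of n] by simp
  qed
qed simp

lemma card_split: "card {k. k < n \<and> P k} + card {k. k < (n::nat) \<and> \<not> P k} = n"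
proof -
  have "card ({k. k < n \<and> P k} \<union> {k. k < n \<and> \<not> P k}) = card {k. k < n \<and> P k} + card {k. k < n \<and> \<not> P k}"
    by (rule card_Un_disjoint) auto
  moreover have "{k. k < n \<and> P k} \<union> {k. k < n \<and> \<not> P k} = {..<n}" by auto
  ultimately show ?thesis by simp
qed

text \<open>For \<open>m > 0\<close>, \<open>m\<close> steps double the radius: the indices
  \<open>0\<close>, \<open>m\<close>, \<open>2 * m\<close>, \<open>3 * m\<close>,
  \<open>4 * m\<close> mark 1/16, 1/8, 1/4, 1/2 and 1.\<close>

definition radius :: "nat \<Rightarrow> nat \<Rightarrow> real" where
  "radius m j = exp (ln 2 / real m * real j) / 16"

text \<open>The radii grow geometrically from \<open>1 / 16\<close> to \<open>1\<close>. By the three circles theorem the increments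
  \<open>N j\<close> of \<open>ln (max_modulus f (radius m j))\<close> increase with \<open>j\<close>. Between \<open>1 / 8\<close> and \<open>1 / 4\<close> either the positivity
  set is already large or \<open>max_re\<close> grows so fast that the later increments are large; between \<open>1 / 4\<close> and
  \<open>1 / 2\<close>, the increments can triple only in few of the blocks of 32 steps, and every other block contributes its share
  of area by \<open>local_area_constants\<close>.\<close>

context
  fixes f :: "complex \<Rightarrow> complex" and p m :: nat and l :: real and E :: "complex set"
  assumes f: "f holomorphic_on ball 0 1" and f0: "f 0 = 0" and ne: "\<exists>z\<in>ball 0 1. f z \<noteq> 0"
    and p: "p \<ge> 1"
  defines "m \<equiv> 64 * p" and "l \<equiv> ln 2 / real m" and "E \<equiv> {z\<in>ball 0 1. Re (f z) > 0}"
begin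

private lemma m_bounds: "m \<ge> 64" "m > 0"
  using p by (auto simp: m_def)

private lemma l_bounds: "l > 0" "l \<le> 1 / 64"
proof -
  have "ln 2 \<le> (1::real)" using ln_2_less_1 by simp
  then show "l \<le> 1 / 64" using m_bounds unfolding l_def by (intro frac_le) auto
  show "l > 0" using m_bounds by (simp add: l_def)
qed

private lemma radius_add: "radius m (j + i) = radius m j * exp (l * real i)"
  by (simp add: radius_def l_def exp_add[symmetric] algebra_simps add_divide_distrib)

private lemma radius_pos: "radius m j > 0"
  by (simp add: radius_def)

private lemma radius_mono: "i \<le> j \<Longrightarrow> radius m i \<le> radius m j"
  unfolding radius_def using m_bounds by (auto intro!: divide_right_mono mult_left_mono)

private lemma radius_mult: "radius m (k * m) = 2 ^ k / 16"
proof -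
  have "exp (ln 2 / real m * real (k * m)) = exp (real k * ln 2)" using m_bounds by (simp add: field_simps)
  also have "\<dots> = 2 ^ k" by (simp add: exp_of_nat_mult)
  finally show ?thesis by (simp add: radius_def)
qed

private lemma radius_less_1:
  assumes "j < 4 * m"
  shows "radius m j < 1"
proof -
  have "ln 2 / real m * real j < ln 2 / real m * real (4 * m)"
    using m_bounds assms by (intro mult_strict_left_mono) (auto simp del: of_nat_mult)
  then have "radius m j < radius m (4 * m)" by (simp add: radius_def)
  then show ?thesis by (simp add: radius_mult)
qed

private definition "\<mu> j = ln (max_modulus f (radius m j))"
private definition "N j = \<mu> (Suc j) - \<mu> j"

private lemma M_pos: "j < 4 * m \<Longrightarrow> max_modulus f (radius m j) > 0"
  using ne max_modulus_pos[OF f radius_pos radius_less_1] by blast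

private lemma N_mono_Suc:
  assumes "j + 2 < 4 * m"
  shows "N j \<le> N (Suc j)"
proof -
  have q: "exp l > 1" using l_bounds by simp
  have 1: "radius m (Suc j) * exp l = radius m (j + 2)" "radius m (Suc j) / exp l = radius m j"
    using radius_add[of "Suc j" 1] radius_add[of j 1] by (simp_all add: numeral_2_eq_2)
  have "(max_modulus f (radius m (Suc j)))\<^sup>2 \<le> max_modulus f (radius m (j + 2)) * max_modulus f (radius m j)"
    using max_modulus_three_circles[OF f radius_pos q, of "Suc j"] radius_less_1[OF assms] unfolding 1 by simp
  then have "ln ((max_modulus f (radius m (Suc j)))\<^sup>2) \<le> ln (max_modulus f (radius m (j + 2)) * max_modulus f (radius m j))"
    using M_pos[of "Suc j"] M_pos[of j] M_pos[of "j + 2"] assms by (intro ln_mono) auto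
  also have "\<dots> = \<mu> (j + 2) + \<mu> j"
    using M_pos[of j] M_pos[of "j + 2"] assms unfolding \<mu>_def by (subst ln_mult) auto
  finally have "2 * \<mu> (Suc j) \<le> \<mu> (j + 2) + \<mu> j"
    using M_pos[of "Suc j"] assms by (simp add: ln_realpow \<mu>_def)
  then show ?thesis by (simp add: N_def numeral_2_eq_2)
qed

private lemma N_mono:
  assumes "i \<le> j" "j + 1 < 4 * m"
  shows "N i \<le> N j"
  using assms
proof (induction j)
  case (Suc j)
  then show ?case using N_mono_Suc[of j] by (cases "i = Suc j") auto
qed simp

private lemma \<mu>_diff: "i \<le> j \<Longrightarrow> \<mu> j - \<mu> i = (\<Sum>k=i..<j. N k)"
  by (simp add: N_def sum_Suc_diff')

private lemma E_open: "open E"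
  unfolding E_def
  using continuous_open_preimage[OF continuous_on_Re[OF holomorphic_on_imp_continuous_on[OF f]] open_ball, of "{0<..}"]
  by (simp add: vimage_def Int_def conj_commute)

private lemma E_bounded: "bounded E"
  by (rule bounded_subset[of "ball 0 1"]) (auto simp: E_def)

text \<open>There are \<open>32 * p\<close> rings of two steps each. If a ring carries area at most
  \<open>C\<close>, the mean value inequality at a maximum point of \<open>Re f\<close> on its
  middle circle multiplies \<open>max_re\<close> by at least \<open>exp T\<close> across the ring.
  Either half of the rings have more area, or for \<open>T \<ge> 0\<close> the gains add up to
  \<open>16 * p * T\<close>. The \<open>ln 4\<close> is the price of passing from
  \<open>max_modulus\<close> to \<open>max_re\<close> at the double radius.\<close>

private lemma area_or_growth:
  fixes T :: real
  shows "pi * exp (- T) * (ln 2)\<^sup>2 / (1024\<^sup>2 * real p) \<le> measure lborel E \<or>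
    16 * real p * T - ln 4 \<le> \<mu> (2 * m) - \<mu> 0"
proof -
  obtain z0 where z0: "z0 \<in> ball 0 1" "f z0 \<noteq> 0" using ne by blast
  \<comment> \<open>All radii here are at least 1/8, so a single step has length at least
    \<open>l / 8 = 2 * h\<close>, and a disc of radius \<open>h\<close> about the middle circle
    stays inside the ring.\<close>
  define h where "h = l / 16"
  have h: "h > 0" using l_bounds by (simp add: h_def)
  \<comment> \<open>Chosen so that in the mean value inequality \<open>pi / 16 * h^2\<close> cancels
    and exactly the factor \<open>exp (- T)\<close> remains.\<close>
  define C where "C = pi / 16 * exp (- T) * h\<^sup>2"
  define a where "a k = radius m (m + 2 * k)" for k
  define Ek where "Ek k = {z\<in>E. a k < cmod z \<and> cmod z < a (Suc k)}" for k
  define P where "P k \<longleftrightarrow> measure lborel (Ek k) \<le> C" for k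
  define V where "V k = ln (max_re f (a k))" for k
  have a_lt: "a k < 1" "0 < a k" if "k \<le> 32 * p" for k
  proof -
    have "m + 2 * k < 4 * m" using that p by (simp add: m_def)
    then show "a k < 1" unfolding a_def by (rule radius_less_1)
    show "0 < a k" unfolding a_def by (rule radius_pos)
  qed
  have re_pos: "max_re f (a k) > 0" if "k \<le> 32 * p" for k
    by (rule max_re_pos[OF f f0 _ _ z0]) (use a_lt that in auto)
  have a_mono: "i \<le> j \<Longrightarrow> a i \<le> a j" for i j unfolding a_def by (rule radius_mono) simp
  have V1: "V k \<le> V (Suc k)" if "k < 32 * p" for k
    unfolding V_def using that re_pos[of k] re_pos[of "Suc k"] a_lt[of k] a_lt[of "Suc k"] a_mono[of k "Suc k"]
    by (intro ln_mono max_re_mono[OF f]) auto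
  have V2: "V k + T \<le> V (Suc k)" if k: "k < 32 * p" and Pk: "P k" for k
  proof -
    define r where "r = radius m (m + 2 * k + 1)"
    have r1: "r = a k * exp l" using radius_add[of "m + 2 * k" 1] by (simp add: r_def a_def)
    have r2: "a (Suc k) = r * exp l" using radius_add[of "m + 2 * k + 1" 1] by (simp add: r_def a_def)
    have ak: "1 / 8 \<le> a k" using radius_mono[of m "m + 2 * k"] radius_mult[of 1] by (simp add: a_def)
    have el: "1 + l \<le> exp l" by (rule exp_ge_add_one_self)
    have "a k * (1 + l) \<le> r" unfolding r1 using el ak by (intro mult_left_mono) auto
    moreover have "1 / 8 * l \<le> a k * l" using ak l_bounds by (intro mult_right_mono) auto
    ultimately have d1: "a k + 2 * h \<le> r" by (simp add: h_def algebra_simps)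
    have "r * (1 + l) \<le> a (Suc k)" unfolding r2 using el ak d1 h by (intro mult_left_mono) auto
    moreover have "1 / 8 * l \<le> r * l" using ak d1 h l_bounds by (intro mult_right_mono) auto
    ultimately have d2: "r + 2 * h \<le> a (Suc k)" by (simp add: h_def algebra_simps)
    have lt1: "a (Suc k) < 1" using a_lt(1)[of "Suc k"] k by simp
    have r: "0 < r" "r < 1" using d1 d2 ak h lt1 by auto
    obtain z where z: "cmod z = r" "Re (f z) = max_re f r" using max_re_attained[OF f r] by metis
    have near: "a k < cmod w \<and> cmod w < a (Suc k)" if "w \<in> cball z h" for w
    proof -
      have "cmod (w - z) \<le> h" using that by (simp add: dist_norm norm_minus_commute)
      then have "cmod w \<le> r + h" "r - h \<le> cmod w"
        using norm_triangle_ineq[of z "w - z"] norm_triangle_ineq2[of z w] z by (auto simp: norm_minus_commute)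
      then show ?thesis using d1 d2 h by linarith
    qed
    have "Re (f z) * (pi / 16 * h\<^sup>2) \<le> max_re f (a (Suc k)) * measure lborel (Ek k)"
    proof (rule positive_part_mean_bound[OF f h])
      show "cball z h \<subseteq> ball 0 1" using near lt1 by force
      show "Re (f w) \<le> max_re f (a (Suc k))" if "w \<in> cball z h" for w
        using near[OF that] max_re_attained[OF f _ lt1] a_lt(2)[of "Suc k"] k by (metis Suc_leI less_imp_le)
      show "0 \<le> Re (f z)" using max_re_pos[OF f f0 r z0] z by simp
      have "Ek k = E \<inter> {z. a k < cmod z \<and> cmod z < a (Suc k)}" by (auto simp: Ek_def)
      moreover have "open {z. a k < cmod z \<and> cmod z < a (Suc k)}"
        by (intro open_Collect_conj open_Collect_less continuous_intros)
      ultimately show "Ek k \<in> sets borel" using E_open by auto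
      show "bounded (Ek k)" by (rule bounded_subset[OF E_bounded]) (auto simp: Ek_def)
      show "{w \<in> ball z h. 0 < Re (f w)} \<subseteq> Ek k"
      proof
        fix w assume w: "w \<in> {w \<in> ball z h. 0 < Re (f w)}"
        then have "w \<in> cball z h" by auto
        from near[OF this] w lt1 show "w \<in> Ek k" by (auto simp: Ek_def E_def)
      qed
    qed
    also have "\<dots> \<le> max_re f (a (Suc k)) * C"
      using re_pos[of "Suc k"] k Pk by (intro mult_left_mono) (auto simp: P_def)
    finally have "max_re f r * (pi / 16 * h\<^sup>2) \<le> (max_re f (a (Suc k)) * exp (- T)) * (pi / 16 * h\<^sup>2)"
      by (simp add: C_def z mult_ac)
    moreover have "pi / 16 * h\<^sup>2 > 0" using h by simp
    ultimately have "max_re f r \<le> max_re f (a (Suc k)) * exp (- T)" by (simp only: mult_le_cancel_right_pos)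
    moreover have "max_re f (a k) \<le> max_re f r"
      using d1 h r ak by (intro max_re_mono[OF f]) auto
    ultimately have "ln (max_re f (a k)) \<le> ln (max_re f (a (Suc k)) * exp (- T))"
      using re_pos[of k] k by (intro ln_mono) auto
    also have "\<dots> = V (Suc k) - T" using re_pos[of "Suc k"] k by (simp add: ln_mult V_def)
    finally show ?thesis by (simp add: V_def)
  qed
  show ?thesis
  proof (cases "16 * p \<le> card {k. k < 32 * p \<and> \<not> P k}")
    case True
    have "real (card {k. k < 32 * p \<and> \<not> P k}) * C \<le> measure lborel E"
    proof (rule disjoint_annuli_measure[OF E_open E_bounded, of _ "\<lambda>k. a (Suc k)" a])
      show "a (Suc i) \<le> a j" if "i < j" for i j using that by (intro a_mono) auto
      show "C \<le> measure lborel {z \<in> E. a k < cmod z \<and> cmod z < a (Suc k)}" if "k \<in> {k. k < 32 * p \<and> \<not> P k}" for k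
        using that by (simp add: P_def Ek_def)
    qed auto
    moreover have "real (16 * p) * C \<le> real (card {k. k < 32 * p \<and> \<not> P k}) * C"
      using True by (intro mult_right_mono) (auto simp: C_def simp del: of_nat_mult)
    moreover have "real (16 * p) * C = pi * exp (- T) * (ln 2)\<^sup>2 / (1024\<^sup>2 * real p)"
      using p by (simp add: C_def h_def l_def m_def field_simps power2_eq_square)
    ultimately show ?thesis by simp
  next
    case False
    then have card: "16 * p \<le> card {k. k < 32 * p \<and> P k}" using card_split[of "32 * p" P] by linarith
    have inc: "V 0 + T * real (card {k. k < 32 * p \<and> P k}) \<le> V (32 * p)"
      by (rule increment_count) (use V1 V2 in auto)
    show ?thesis
    proof (cases "T \<ge> 0")
      case True
      have "T * real (16 * p) \<le> T * real (card {k. k < 32 * p \<and> P k})"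
        using card True by (intro mult_left_mono) (auto simp del: of_nat_mult)
      then have V: "V 0 + 16 * real p * T \<le> V (32 * p)" using inc by (simp add: mult_ac)
      have a0: "a 0 = 1 / 8" using radius_mult[of 1] by (simp add: a_def)
      have r0: "radius m 0 = 1 / 16" by (simp add: radius_def)
      have "max_modulus f (1 / 16) \<le> 4 * max_re f (1 / 8)"
        using max_modulus_le_max_re[OF f f0 _ _ z0, of "1 / 8"] by simp
      then have "\<mu> 0 \<le> ln (4 * max_re f (a 0))"
        unfolding \<mu>_def r0 a0 using M_pos[of 0] m_bounds by (intro ln_mono) (auto simp: r0)
      also have "\<dots> = ln 4 + V 0" unfolding V_def using re_pos[of 0] by (subst ln_mult) auto
      finally have 0: "\<mu> 0 \<le> ln 4 + V 0" .
      have a32: "a (32 * p) = radius m (2 * m)" by (simp add: a_def m_def)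
      have "V (32 * p) \<le> \<mu> (2 * m)"
        unfolding V_def \<mu>_def a32[symmetric] using re_pos[of "32 * p"] a_lt[of "32 * p"]
        by (intro ln_mono max_re_le_max_modulus[OF f]) (auto intro: less_le_trans max_re_le_max_modulus[OF f])
      with V 0 show ?thesis by linarith
    next
      \<comment> \<open>For negative \<open>T\<close> the growth alternative is just monotonicity of
        the maximum modulus.\<close>
      case False
      have "\<mu> 0 \<le> \<mu> (2 * m)"
        unfolding \<mu>_def using M_pos[of 0] M_pos[of "2 * m"] m_bounds
        by (intro ln_mono max_modulus_mono[OF f] radius_mono radius_less_1 radius_pos) auto
      moreover have "16 * real p * T \<le> 0" using False by (simp add: mult_nonneg_nonpos)
      moreover have "ln (4::real) \<ge> 0" by simp
      ultimately show ?thesis by linarith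
    qed
  qed
qed

text \<open>As \<open>exp 1 \<le> 3\<close>, each tripling raises \<open>ln N\<close> by at least 1,
  and \<open>ln N\<close> runs from at least 0 to at most \<open>p\<close>. So at least
  \<open>p\<close> of the \<open>2 * p\<close> blocks do not triple, which is the doubling type
  hypothesis that the local estimate needs.\<close>

private lemma area_from_growth:
  fixes c D0 :: real
  assumes c: "c > 0" and D0: "D0 \<ge> 1"
    and loc: "local_area_constants 15 c D0"
    and N0: "N (2 * m) \<ge> D0" and N1: "N (3 * m) \<le> exp (real p)"
  shows "c * (ln 2)\<^sup>2 / (4 * 64\<^sup>2 * real p) \<le> measure lborel E"
proof -
  define s where "s k = 2 * m + 32 * k" for k
  define P where "P k \<longleftrightarrow> N (s (Suc k)) > 3 * N (s k)" for k
  have s: "s k \<le> 3 * m" if "k \<le> 2 * p" for k using that by (simp add: s_def m_def)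
  have Npos: "N j \<ge> D0" if "2 * m \<le> j" "j \<le> 3 * m" for j
    using N_mono[of "2 * m" j] that m_bounds N0 by linarith
  have Nsk: "N (s k) \<ge> D0" if "k \<le> 2 * p" for k
    using s[OF that] by (intro Npos) (auto simp: s_def)
  have "ln (N (s 0)) + 1 * real (card {k. k < 2 * p \<and> P k}) \<le> ln (N (s (2 * p)))"
  proof (rule increment_count[of "2 * p" "\<lambda>k. ln (N (s k))"])
    fix k assume k: "k < 2 * p"
    have pos: "N (s k) > 0" "N (s (Suc k)) > 0" using Nsk[of k] Nsk[of "Suc k"] k D0 by auto
    have "N (s k) \<le> N (s (Suc k))" using s[of "Suc k"] k m_bounds by (intro N_mono) (auto simp: s_def)
    then show "ln (N (s k)) \<le> ln (N (s (Suc k)))" using pos by simp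
    assume "P k"
    then have "ln (3 * N (s k)) \<le> ln (N (s (Suc k)))" using pos by (intro ln_mono) (auto simp: P_def)
    moreover have "ln (3 * N (s k)) = ln 3 + ln (N (s k))" using pos by (subst ln_mult) auto
    moreover have "1 \<le> ln (3::real)" using exp_le by (subst ln_ge_iff) auto
    ultimately show "ln (N (s k)) + 1 \<le> ln (N (s (Suc k)))" by linarith
  qed
  moreover have "0 \<le> ln (N (s 0))" using Nsk[of 0] D0 by simp
  moreover have "ln (N (s (2 * p))) \<le> real p"
  proof -
    have "s (2 * p) = 3 * m" by (simp add: s_def m_def)
    then have "ln (N (s (2 * p))) \<le> ln (exp (real p))"
      using N1 Nsk[of "2 * p"] D0 by (intro ln_mono) auto
    then show ?thesis by simp
  qed
  ultimately have "card {k. k < 2 * p \<and> P k} \<le> p" by linarith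
  then have good: "p \<le> card {k. k < 2 * p \<and> \<not> P k}" using card_split[of "2 * p" P] by linarith
  \<comment> \<open>This is \<open>c * (2 * l * (1/4))^2\<close> with
    \<open>l = ln 2 / (64 * p)\<close>; radii from index \<open>2 * m\<close> on are at least
    1/4.\<close>
  define B where "B = c * (ln 2)\<^sup>2 / (4 * 64\<^sup>2 * (real p)\<^sup>2)"
  have "real (card {k. k < 2 * p \<and> \<not> P k}) * B \<le> measure lborel E"
  proof (rule disjoint_annuli_measure[OF E_open E_bounded, of _ "\<lambda>k. radius m (s k + 24)" "\<lambda>k. radius m (s k)"])
    show "radius m (s i + 24) \<le> radius m (s j)" if "i < j" for i j using that by (intro radius_mono) (auto simp: s_def)
    fix k assume "k \<in> {k. k < 2 * p \<and> \<not> P k}"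
    then have k: "k < 2 * p" "N (s (Suc k)) \<le> 3 * N (s k)" by (auto simp: P_def)
    \<comment> \<open>Sixteen steps inward and eight outward match the annulus in
      \<open>local_area_constants\<close> and fit into the block of 32.\<close>
    define j where "j = s k + 16"
    have sk: "s (Suc k) = s k + 32" by (simp add: s_def)
    have jm: "j + 16 \<le> 3 * m" "2 * m < j - 1" using s[of "Suc k"] k sk by (auto simp: j_def s_def)
    have j1: "radius m j < 1" using jm m_bounds by (intro radius_less_1) auto
    obtain z where z: "cmod z = radius m j" "cmod (f z) = max_modulus f (radius m j)"
      using max_modulus_attained[OF f radius_pos j1] by metis
    define \<kappa> where "\<kappa> = max_modulus f (radius m (j - 1))"
    define D where "D = N (j - 1)"
    have \<kappa>: "\<kappa> > 0" unfolding \<kappa>_def using jm m_bounds by (intro M_pos) auto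
    have \<kappa>e: "\<kappa> = exp (\<mu> (j - 1))" using \<kappa> by (simp add: \<mu>_def \<kappa>_def)
    have Sj: "Suc (j - 1) = j" by (simp add: j_def)
    have rad: "radius m (j - 1) = radius m j * exp (- l)" "radius m (j + 4) = radius m j * exp (4 * l)"
      "radius m (j + 6) = radius m j * exp (6 * l)" "radius m (j + 8) = radius m j * exp (8 * l)"
      "radius m (s k) = radius m j * exp (- 16 * l)"
    proof -
      have "radius m j = radius m (j - 1) * exp l" using radius_add[of "j - 1" 1] Sj by simp
      then show "radius m (j - 1) = radius m j * exp (- l)" by (simp add: exp_minus)
      show "radius m (j + 4) = radius m j * exp (4 * l)" "radius m (j + 6) = radius m j * exp (6 * l)"
        "radius m (j + 8) = radius m j * exp (8 * l)"
        using radius_add[of j 4] radius_add[of j 6] radius_add[of j 8] by (simp_all add: mult.commute)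
      have "radius m j = radius m (s k) * exp (16 * l)"
        using radius_add[of "s k" 16] by (simp add: j_def mult.commute)
      then show "radius m (s k) = radius m j * exp (- 16 * l)" by (simp add: exp_minus)
    qed
    have "c * (2 * l * cmod z)\<^sup>2 \<le> measure lborel {w\<in>{w\<in>ball 0 1. Re (f w) > 0}.
        cmod z * exp (- 16 * l) < cmod w \<and> cmod w < cmod z * exp (8 * l)}"
    proof (rule loc[unfolded local_area_constants_def, rule_format, OF f, where \<kappa> = \<kappa> and D = D])
      show "0 < l" "l \<le> 1 / 32" using l_bounds by auto
      show "z \<noteq> 0" using z(1) radius_pos[of j] by auto
      show "cmod z * exp (6 * l) \<le> 1"
        unfolding z(1) rad(3)[symmetric] using jm m_bounds by (intro less_imp_le radius_less_1) auto
      show "\<kappa> > 0" by fact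
      show "D \<ge> D0" unfolding D_def using jm by (intro Npos) auto
      show "cmod (f w) \<le> \<kappa>" if "cmod w \<le> cmod z * exp (- l)" for w
        unfolding \<kappa>_def using that jm m_bounds unfolding z(1) rad(1)[symmetric]
        by (intro max_modulus_ge[OF f] radius_less_1) auto
      have "\<kappa> * exp D = exp (\<mu> j)" unfolding \<kappa>e D_def N_def Sj by (simp add: exp_add[symmetric])
      also have "\<dots> = cmod (f z)" using M_pos[of j] jm m_bounds by (simp add: \<mu>_def z)
      finally show "\<kappa> * exp D \<le> cmod (f z)" by simp
      show "cmod (f w) \<le> \<kappa> * exp (15 * D)" if "cmod w \<le> cmod z * exp (4 * l)" for w
      proof -
        have j14: "j - 1 \<le> j + 4" by linarith
        have "cmod (f w) \<le> max_modulus f (radius m (j + 4))"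
          using that jm m_bounds unfolding z(1) rad(2)[symmetric] by (intro max_modulus_ge[OF f] radius_less_1) auto
        also have "\<dots> = exp (\<mu> (j + 4))" using M_pos[of "j + 4"] jm m_bounds by (simp add: \<mu>_def)
        also have "\<mu> (j + 4) = \<mu> (j - 1) + (\<Sum>i=j - 1..<j + 4. N i)" using \<mu>_diff[OF j14] by simp
        \<comment> \<open>From \<open>j - 1\<close> to \<open>j + 4\<close> there are five
          increments, each at most three times the first one; this is the origin of the constant
          15.\<close>
        also have "(\<Sum>i=j - 1..<j + 4. N i) \<le> (\<Sum>i=j - 1..<j + 4. 3 * D)"
        proof (rule sum_mono)
          fix i assume i: "i \<in> {j - 1..<j + 4}"
          have "N i \<le> N (s (Suc k))" using i jm m_bounds by (intro N_mono) (auto simp: sk j_def)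
          also have "\<dots> \<le> 3 * N (s k)" by (rule k(2))
          also have "\<dots> \<le> 3 * D" unfolding D_def using jm m_bounds by (intro mult_left_mono N_mono) (auto simp: j_def)
          finally show "N i \<le> 3 * D" .
        qed
        also have "(\<Sum>i=j - 1..<j + 4. 3 * D) = 15 * D" using Sj by (simp add: j_def)
        finally show ?thesis unfolding \<kappa>e by (simp add: exp_add[symmetric])
      qed
    qed
    moreover have "B \<le> c * (2 * l * cmod z)\<^sup>2"
    proof -
      have "1 / 4 \<le> radius m j" using radius_mono[of "2 * m" j] radius_mult[of 2] jm by simp
      then have "2 * l * (1 / 4) \<le> 2 * l * cmod z" using l_bounds z by (intro mult_left_mono) auto
      then have "(2 * l * (1 / 4))\<^sup>2 \<le> (2 * l * cmod z)\<^sup>2" using l_bounds by (intro power_mono) auto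
      then have "c * (2 * l * (1 / 4))\<^sup>2 \<le> c * (2 * l * cmod z)\<^sup>2" using c by (intro mult_left_mono) auto
      moreover have "c * (2 * l * (1 / 4))\<^sup>2 = B"
        using p by (simp add: B_def l_def m_def field_simps power2_eq_square)
      ultimately show ?thesis by simp
    qed
    ultimately have *: "B \<le> measure lborel {w\<in>{w\<in>ball 0 1. Re (f w) > 0}.
        cmod z * exp (- 16 * l) < cmod w \<and> cmod w < cmod z * exp (8 * l)}" by linarith
    show "B \<le> measure lborel {w \<in> E. radius m (s k) < cmod w \<and> cmod w < radius m (s k + 24)}"
    proof -
      have e: "radius m (s k + 24) = radius m (j + 8)"
        by (rule arg_cong[where f = "radius m"]) (simp add: j_def)
      show ?thesis
        using *[unfolded z(1) rad(4)[symmetric] rad(5)[symmetric]] unfolding E_def e .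
    qed
  qed auto
  moreover have "real p * B \<le> real (card {k. k < 2 * p \<and> \<not> P k}) * B"
    using good c by (intro mult_right_mono) (auto simp: B_def)
  moreover have "real p * B = c * (ln 2)\<^sup>2 / (4 * 64\<^sup>2 * real p)"
    using p by (simp add: B_def power2_eq_square)
  ultimately show ?thesis by linarith
qed

text \<open>With \<open>T = 8 * (D0 + 1)\<close>, small area on the inner rings forces the sum of
  the first \<open>128 * p\<close> increments to be about \<open>128 * p * (D0 + 1)\<close>. By
  monotonicity the increment at \<open>2 * m\<close> is then at least \<open>D0\<close>, as
  \<open>ln 4\<close> is absorbed by the extra 1. The increment at \<open>3 * m\<close> is at most
  the total growth \<open>G\<close>.\<close>

lemma area_lower_bound:
  fixes c D0 G :: real
  assumes c: "c > 0" and D0: "D0 \<ge> 1"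
    and loc: "local_area_constants 15 c D0"
    and growth: "max_modulus f (3 / 4) \<le> exp G * max_modulus f (1 / 16)" "G \<le> exp (real p)"
  shows "min (pi * exp (- (8 * (D0 + 1))) * (ln 2)\<^sup>2 / 1024\<^sup>2) (c * (ln 2)\<^sup>2 / (4 * 64\<^sup>2)) / real p
    \<le> measure lborel {z\<in>ball 0 1. Re (f z) > 0}"
proof -
  define C1 where "C1 = pi * exp (- (8 * (D0 + 1))) * (ln 2)\<^sup>2 / 1024\<^sup>2"
  define C2 where "C2 = c * (ln 2)\<^sup>2 / (4 * 64\<^sup>2)"
  have "C1 / real p \<le> measure lborel E \<or> C2 / real p \<le> measure lborel E"
  proof (cases "C1 / real p \<le> measure lborel E")
    case False
    then have gr: "16 * real p * (8 * (D0 + 1)) - ln 4 \<le> \<mu> (2 * m) - \<mu> 0"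
      using area_or_growth[of "8 * (D0 + 1)"] by (simp add: C1_def)
    have "\<mu> (2 * m) - \<mu> 0 = (\<Sum>k=0..<2 * m. N k)" by (rule \<mu>_diff) simp
    also have "\<dots> \<le> (\<Sum>k=0..<2 * m. N (2 * m))" using m_bounds by (intro sum_mono N_mono) auto
    also have "\<dots> = 128 * real p * N (2 * m)" by (simp add: m_def)
    finally have "16 * real p * (8 * (D0 + 1)) - ln 4 \<le> 128 * real p * N (2 * m)" using gr by linarith
    moreover have "ln (4::real) \<le> 128 * real p"
    proof -
      have "ln (4::real) \<le> 4 - 1" by (rule ln_le_minus_one) simp
      then show ?thesis using p by simp
    qed
    ultimately have "128 * real p * D0 \<le> 128 * real p * N (2 * m)" by (simp add: algebra_simps)
    then have N0: "N (2 * m) \<ge> D0" using p by simp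
    \<comment> \<open>\<open>N (3 * m)\<close> reaches one step beyond radius 1/2; this keeps that
      step within 3/4, where the growth is known.\<close>
    have el: "exp l \<le> 3 / 2"
    proof -
      have "1 - l \<le> exp (- l)" using exp_ge_add_one_self[of "- l"] by simp
      then have "(1 - l) * exp l \<le> 1" by (simp add: exp_minus field_simps)
      moreover have "2 / 3 * exp l \<le> (1 - l) * exp l" using l_bounds by (intro mult_right_mono) auto
      ultimately show ?thesis by linarith
    qed
    have r34: "radius m (3 * m + 1) \<le> 3 / 4" using radius_add[of "3 * m" 1] radius_mult[of 3] el by simp
    have "\<mu> (3 * m + 1) \<le> ln (max_modulus f (3 / 4))"
      unfolding \<mu>_def using M_pos[of "3 * m + 1"] m_bounds r34
      by (intro ln_mono max_modulus_mono[OF f] radius_pos)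
        (auto intro: less_le_trans[OF _ max_modulus_mono[OF f radius_pos r34]])
    also have "\<dots> \<le> ln (exp G * max_modulus f (1 / 16))"
    proof (rule ln_mono)
      have "0 < max_modulus f (radius m (3 * m + 1))" using M_pos[of "3 * m + 1"] m_bounds by simp
      also have "\<dots> \<le> max_modulus f (3 / 4)" by (rule max_modulus_mono[OF f radius_pos r34]) simp
      finally show "0 < max_modulus f (3 / 4)" .
    qed (use growth in auto)
    also have "\<dots> = G + \<mu> 0"
    proof -
      have r0: "radius m 0 = 1 / 16" by (simp add: radius_def)
      have "max_modulus f (1 / 16) > 0" using M_pos[of 0] m_bounds unfolding r0 by simp
      then show ?thesis unfolding \<mu>_def r0 by (subst ln_mult) auto
    qed
    finally have "\<mu> (3 * m + 1) \<le> G + \<mu> 0" .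
    moreover have "\<mu> 0 \<le> \<mu> (3 * m)"
      unfolding \<mu>_def using M_pos[of 0] m_bounds
      by (intro ln_mono max_modulus_mono[OF f] radius_mono radius_less_1 radius_pos) auto
    ultimately have "N (3 * m) \<le> exp (real p)" using growth(2) by (simp add: N_def)
    from area_from_growth[OF c D0 loc N0 this] show ?thesis by (simp add: C2_def)
  qed simp
  moreover have "min C1 C2 / real p \<le> C1 / real p" "min C1 C2 / real p \<le> C2 / real p"
    by (auto intro!: divide_right_mono)
  ultimately show ?thesis unfolding C1_def C2_def E_def by linarith
qed

end

text \<open>The growth exponent is linear in \<open>d\<close>, so \<open>exp p\<close> exceeds it
  for a \<open>p\<close> of order \<open>ln d\<close>, and the bound \<open>C / p\<close> of
  \<open>area_lower_bound\<close> becomes a multiple of \<open>1 / ln d\<close>.\<close>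

lemma nadirashvili_class_area_lower_bound:
  obtains c where "c > 0" "\<And>d u. d \<ge> 2 \<Longrightarrow> u \<in> nadirashvili_class d \<Longrightarrow>
    c / ln (real d) \<le> measure lebesgue {z \<in> ball 0 1. u z > 0}"
proof -
  obtain c D0 where c: "c > 0" and D0: "D0 \<ge> 1" and loc: "local_area_constants 15 c D0"
    using local_area_constants_exist[of 15] zero_le_numeral by blast
  define C where "C = min (pi * exp (- (8 * (D0 + 1))) * (ln 2)\<^sup>2 / 1024\<^sup>2) (c * (ln 2)\<^sup>2 / (4 * 64\<^sup>2))"
  have C: "C > 0" using c by (simp add: C_def)
  show thesis
  proof (rule that[of "C / 7"])
    show "C / 7 > 0" using C by simp
    fix d :: nat and u assume d: "d \<ge> 2" and u: "u \<in> nadirashvili_class d"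
    have harm: "harmonic_on u (ball 0 1)" and cont: "continuous_on (cball 0 1) u" and nz: "\<exists>z\<in>ball 0 1. u z \<noteq> 0"
      and u0: "u 0 = 0" and sc: "sign_changes u \<le> enat d"
      using u by (auto simp: nadirashvili_class_def)
    obtain f where f: "f holomorphic_on ball 0 1" "f 0 = 0" and uf: "\<And>z. z \<in> ball 0 1 \<Longrightarrow> u z = Re (f z)"
      using harmonic_on_imp_Re_holomorphic[OF harm u0] by blast
    have ne: "\<exists>z\<in>ball 0 1. f z \<noteq> 0" using nz uf by force
    \<comment> \<open>For \<open>d \<ge> 2\<close> the growth exponent \<open>9 * d + 8\<close> is
      at most \<open>13 * d\<close>.\<close>
    define p where "p = nat \<lceil>ln (13 * real d)\<rceil>"
    have lnd: "ln (real d) \<ge> ln 2" using d by simp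
    have ln2: "ln (2::real) \<ge> 2 / 3" by (rule ln2_ge_two_thirds)
    have l13: "ln (13 * real d) = ln 13 + ln (real d)" using d by (subst ln_mult) auto
    have l13b: "ln (13::real) \<le> 4 * ln 2"
    proof -
      have "ln (13::real) \<le> ln (2 ^ 4)" by (intro ln_mono) auto
      then show ?thesis by (simp only: ln_realpow of_nat_numeral)
    qed
    have l13c: "ln (13::real) \<ge> 0" by simp
    have p1: "ln (13 * real d) \<le> real p" unfolding p_def by (rule real_nat_ceiling_ge)
    have pos: "ln (13 * real d) > 0" using l13 l13c lnd ln2 by linarith
    have "p \<noteq> 0" using p1 pos by (cases "p = 0") auto
    then have p: "p \<ge> 1" by simp
    \<comment> \<open>\<open>ln 13 \<le> 4 * ln 2\<close> and \<open>1 \<le> 3/2 * ln 2\<close>, so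
      that \<open>ln d\<close>, \<open>ln 13\<close> and the rounding add up to at most 6.5 times
      \<open>ln d\<close>.\<close>
    have p2: "real p \<le> 7 * ln (real d)"
    proof -
      have "real p \<le> ln (13 * real d) + 1" unfolding p_def using pos by linarith
      then show ?thesis using l13 l13b lnd ln2 by linarith
    qed
    have growth: "max_modulus f (3 / 4) \<le> exp (9 * real d + 8) * max_modulus f (1 / 16)"
    proof -
      obtain w where w: "cmod w = 3 / 4" "cmod (f w) = max_modulus f (3 / 4)"
        using max_modulus_attained[OF f(1), of "3 / 4"] by auto
      have B: "cmod (f w) \<le> max_modulus f (1 / 16)" if "w \<in> cball 0 (1 / 16)" for w
        using that by (intro max_modulus_ge[OF f(1)]) auto
      have M0: "0 \<le> max_modulus f (1 / 16)" by (rule max_modulus_nonneg[OF f(1)]) auto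
      have "cmod (f w) \<le> 8 ^ d * ((real d + 8) * 2 ^ d) * (max_modulus f (1 / 16) / (1 / 16) ^ d)"
        by (rule growth_of_sign_changes[OF f cont uf sc _ _ B]) (use w in auto)
      also have "\<dots> = ((8 * 2 * 16) ^ d * (real d + 8)) * max_modulus f (1 / 16)"
        unfolding power_mult_distrib by (simp add: power_one_over)
      also have "\<dots> \<le> exp (9 * real d + 8) * max_modulus f (1 / 16)"
      proof (rule mult_right_mono[OF _ M0])
        have "(8 * 2 * 16 :: real) \<le> exp 8"
        proof -
          have "(2::real) \<le> exp 1" using exp_ge_add_one_self[of 1] by simp
          then have "(2::real) ^ 8 \<le> exp 1 ^ 8" by (intro power_mono) auto
          then show ?thesis by (simp add: exp_of_nat_mult[symmetric])
        qed
        then have "(8 * 2 * 16 :: real) ^ d \<le> exp 8 ^ d" by (intro power_mono) auto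
        then have "(8 * 2 * 16 :: real) ^ d \<le> exp (8 * real d)" by (simp add: exp_of_nat_mult[symmetric] mult.commute)
        moreover have "real d + 8 \<le> exp (real d + 8)" using exp_ge_add_one_self[of "real d + 8"] by linarith
        ultimately have "(8 * 2 * 16) ^ d * (real d + 8) \<le> exp (8 * real d) * exp (real d + 8)"
          by (intro mult_mono) auto
        then show "(8 * 2 * 16) ^ d * (real d + 8) \<le> exp (9 * real d + 8)"
          by (simp add: exp_add[symmetric])
      qed
      finally show ?thesis using w by simp
    qed
    have G: "9 * real d + 8 \<le> exp (real p)"
    proof -
      have "9 * real d + 8 \<le> 13 * real d" using d by simp
      also have "\<dots> = exp (ln (13 * real d))" using d by simp
      also have "\<dots> \<le> exp (real p)" using p1 by simp
      finally show ?thesis .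
    qed
    have "C / real p \<le> measure lborel {z \<in> ball 0 1. Re (f z) > 0}"
      unfolding C_def
      by (rule area_lower_bound[OF f ne p c D0 loc growth G])
    moreover have "{z \<in> ball 0 1. Re (f z) > 0} = {z \<in> ball 0 1. u z > 0}" using uf by auto
    moreover have "open {z \<in> ball 0 1. Re (f z) > 0}"
      using continuous_open_preimage[OF continuous_on_Re[OF holomorphic_on_imp_continuous_on[OF f(1)]] open_ball, of "{0<..}"]
      by (simp add: vimage_def Int_def conj_commute)
    ultimately have "C / real p \<le> measure lebesgue {z \<in> ball 0 1. u z > 0}"
      by (simp add: measure_completion)
    moreover have "C / 7 / ln (real d) \<le> C / real p"
      using p2 p C by (simp add: divide_divide_eq_left divide_left_mono)
    ultimately show "C / 7 / ln (real d) \<le> measure lebesgue {z \<in> ball 0 1. u z > 0}" by linarith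
  qed
qed

section \<open>Functions with small positivity set\<close>

lemma zero_between_sign_change:
  fixes \<phi> :: "real \<Rightarrow> real"
  assumes c: "continuous_on UNIV \<phi>" and ab: "a < b" and s: "\<phi> a * \<phi> b < 0"
  shows "\<exists>t. a < t \<and> t < b \<and> \<phi> t = 0"
proof -
  have ne: "\<phi> a \<noteq> 0" "\<phi> b \<noteq> 0" using s by auto
  have "\<exists>t. a \<le> t \<and> t \<le> b \<and> \<phi> t = 0"
  proof (cases "\<phi> a < 0")
    case True
    then have "\<phi> b > 0" using s by (simp add: mult_less_0_iff)
    then show ?thesis using True ab by (intro IVT') (auto intro: continuous_on_subset[OF c])
  next
    case False
    then have "\<phi> a > 0" "\<phi> b < 0" using s ne by (auto simp: mult_less_0_iff)
    then show ?thesis using ab by (intro IVT2') (auto intro: continuous_on_subset[OF c])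
  qed
  then show ?thesis using ne by (metis less_eq_real_def)
qed

lemma cis_inj_period:
  assumes "cis s = cis t" "\<bar>s - t\<bar> < 2 * pi"
  shows "s = t"
proof -
  have "sin s = sin t \<and> cos s = cos t" using assms(1) by (simp add: complex_eq_iff)
  then obtain n :: int where n: "s = t + 2 * pi * n" unfolding sin_cos_eq_iff by auto
  then have "2 * pi * \<bar>real_of_int n\<bar> < 2 * pi * 1" using assms(2) by (simp add: abs_mult)
  then have "\<bar>real_of_int n\<bar> < 1" by (simp only: mult_less_cancel_left_pos[of "2 * pi"] pi_gt_zero mult_pos_pos zero_less_numeral)
  then have "n = 0" by linarith
  then show ?thesis using n by simp
qed

text \<open>On the circle \<open>2 * Re p\<close> is \<open>z ^ (- n)\<close> times a polynomial
  \<open>q\<close> of degree at most \<open>2 * n\<close>. Every sign change produces a zero of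
  \<open>q\<close> on the circle, and these zeros are distinct; \<open>ne\<close> excludes
  \<open>q = 0\<close>.\<close>

lemma sign_changes_Re_poly_le:
  fixes p :: "complex poly"
  assumes deg: "degree p \<le> n" and ne: "Re (poly p (cis \<alpha>)) \<noteq> 0"
  shows "sign_changes (\<lambda>z. Re (poly p z)) \<le> enat (2 * n)"
  unfolding sign_changes_def
proof (rule Sup_least, clarify)
  fix k and \<zeta> :: "nat \<Rightarrow> complex"
  assume cyc: "cyclically_ordered k \<zeta>" and alt: "\<forall>j<k. Re (poly p (\<zeta> j)) * Re (poly p (\<zeta> ((j + 1) mod k))) < 0"
  \<comment> \<open>The second summand is the reversed polynomial with conjugated coefficients; on
    the circle it equals \<open>z ^ n * cnj (p z)\<close>.\<close>
  define q where "q = monom 1 n * p + (\<Sum>i\<le>n. monom (cnj (coeff p i)) (n - i))"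
  have q_circle: "poly q (cis t) = cis t ^ n * of_real (2 * Re (poly p (cis t)))" for t
  proof -
    have "cis t ^ (n - i) = cis t ^ n * cnj (cis t ^ i)" if "i \<le> n" for i
      using that by (simp add: Complex.DeMoivre cis_cnj cis_mult of_nat_diff algebra_simps)
    then have "poly (\<Sum>i\<le>n. monom (cnj (coeff p i)) (n - i)) (cis t) = cis t ^ n * cnj (\<Sum>i\<le>n. coeff p i * cis t ^ i)"
      by (simp add: poly_sum poly_monom sum_distrib_left mult_ac)
    also have "(\<Sum>i\<le>n. coeff p i * cis t ^ i) = poly p (cis t)"
    proof -
      have "(\<Sum>i\<le>n. coeff p i * cis t ^ i) = (\<Sum>i\<le>degree p. coeff p i * cis t ^ i)"
        by (rule sum.mono_neutral_right) (use deg in \<open>auto simp: coeff_eq_0\<close>)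
      then show ?thesis by (simp add: poly_altdef)
    qed
    finally have "poly q (cis t) = cis t ^ n * (poly p (cis t) + cnj (poly p (cis t)))"
      by (simp add: q_def poly_monom algebra_simps)
    then show ?thesis by (simp only: complex_add_cnj)
  qed
  have "poly q (cis \<alpha>) \<noteq> 0" using ne unfolding q_circle by simp
  then have q0: "q \<noteq> 0" by auto
  have "degree (\<Sum>i\<le>n. monom (cnj (coeff p i)) (n - i)) \<le> n"
    by (intro degree_sum_le) (auto intro: order_trans[OF degree_monom_le])
  moreover have "degree (monom 1 n * p) \<le> n + n"
    by (rule order_trans[OF degree_mult_le]) (use deg in \<open>auto intro!: add_mono degree_monom_le\<close>)
  ultimately have degq: "degree q \<le> 2 * n" unfolding q_def by (intro degree_add_le) auto
  show "enat k \<le> enat (2 * n)"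
  proof (cases "k = 0")
    case False
    obtain \<theta> where \<theta>: "strict_mono_on {..<k} \<theta>" "\<And>i j. i < k \<Longrightarrow> j < k \<Longrightarrow> \<theta> j < \<theta> i + 2 * pi"
      "\<And>j. j < k \<Longrightarrow> \<zeta> j = cis (\<theta> j)" using cyc unfolding cyclically_ordered_def by auto
    define \<phi> where "\<phi> t = Re (poly p (cis t))" for t
    have \<phi>: "continuous_on UNIV \<phi>" unfolding \<phi>_def by (intro continuous_intros)
    \<comment> \<open>Appending \<open>\<theta> 0 + 2 * pi\<close> closes the cyclic list, so the
      last sign change, back to the first point, is treated like the others.\<close>
    define \<psi> where "\<psi> j = (if j < k then \<theta> j else \<theta> 0 + 2 * pi)" for j
    have \<psi>_lt: "\<psi> j < \<psi> (Suc j)" if "j < k" for j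
      using that \<theta>(2)[of 0 j] strict_mono_onD[OF \<theta>(1), of j "Suc j"] False by (auto simp: \<psi>_def)
    have per: "cis (\<theta> 0 + 2 * pi) = cis (\<theta> 0)" by (simp add: cis_mult[symmetric])
    have \<psi>_alt: "\<phi> (\<psi> j) * \<phi> (\<psi> (Suc j)) < 0" if "j < k" for j
    proof (cases "Suc j < k")
      case True
      then show ?thesis using alt[rule_format, OF that] that \<theta>(3)[of j] \<theta>(3)[of "Suc j"]
        by (auto simp: \<phi>_def \<psi>_def)
    next
      case False
      then have "Suc j = k" using that by simp
      then show ?thesis using alt[rule_format, OF that] that \<theta>(3)[of j] \<theta>(3)[of 0] \<open>k \<noteq> 0\<close> per
        by (auto simp: \<phi>_def \<psi>_def)
    qed
    have "\<forall>j. \<exists>t. j < k \<longrightarrow> \<psi> j < t \<and> t < \<psi> (Suc j) \<and> \<phi> t = 0"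
      using zero_between_sign_change[OF \<phi> \<psi>_lt \<psi>_alt] by blast
    then obtain t where t: "\<And>j. j < k \<Longrightarrow> \<psi> j < t j \<and> t j < \<psi> (Suc j) \<and> \<phi> (t j) = 0" by metis
    have \<psi>_mono: "\<psi> i \<le> \<psi> j" if "i \<le> j" "j \<le> k" for i j
      using that
    proof (induction j)
      case (Suc j)
      then show ?case using \<psi>_lt[of j] by (cases "i = Suc j") (auto intro: order_trans[OF _ less_imp_le])
    qed simp
    have t_lt: "t i < t j" if "i < j" "j < k" for i j
      using t[of i] t[of j] \<psi>_mono[of "Suc i" j] that by force
    have range: "\<theta> 0 \<le> t j \<and> t j < \<theta> 0 + 2 * pi" if "j < k" for j
      using t[OF that] \<psi>_mono[of 0 j] \<psi>_mono[of "Suc j" k] that False by (auto simp: \<psi>_def)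
    have "inj_on (\<lambda>j. cis (t j)) {..<k}"
    proof (rule inj_onI)
      fix i j assume ij: "i \<in> {..<k}" "j \<in> {..<k}" "cis (t i) = cis (t j)"
      then have "\<bar>t i - t j\<bar> < 2 * pi" using range[of i] range[of j] by auto
      then have "t i = t j" using ij cis_inj_period by blast
      then show "i = j" using t_lt[of i j] t_lt[of j i] ij by (cases i j rule: linorder_cases) auto
    qed
    then have "k = card ((\<lambda>j. cis (t j)) ` {..<k})" by (simp add: card_image)
    also have "\<dots> \<le> card {z. poly q z = 0}"
      using t q0 by (intro card_mono poly_roots_finite) (auto simp: q_circle \<phi>_def)
    also have "\<dots> \<le> degree q" by (rule card_poly_roots_bound[OF q0])
    also have "\<dots> \<le> 2 * n" by (rule degq)
    finally show ?thesis by simp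
  qed auto
qed

lemma harmonic_on_Re_holomorphic:
  assumes f: "f holomorphic_on S" and S: "open S"
  shows "harmonic_on (\<lambda>z. Re (f z)) S"
proof -
  have f': "deriv f holomorphic_on S" and f'': "deriv (deriv f) holomorphic_on S"
    using f S by (auto intro: holomorphic_deriv)
  have d: "(g has_derivative (\<lambda>h. deriv g z * h)) (at z)" if "g holomorphic_on S" "z \<in> S" for g z
    using holomorphic_derivI[OF that(1) S that(2)] by (simp add: has_field_derivative_def)
  have c: "continuous_on S (deriv (deriv f))" by (rule holomorphic_on_imp_continuous_on[OF f''])
  have "((\<lambda>z. Re (f z)) has_derivative (\<lambda>h. Re (deriv f z) * Re h + - Im (deriv f z) * Im h)) (at z)"
    "((\<lambda>z. Re (deriv f z)) has_derivative (\<lambda>h. Re (deriv (deriv f) z) * Re h + - Im (deriv (deriv f) z) * Im h)) (at z)"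
    "((\<lambda>z. - Im (deriv f z)) has_derivative (\<lambda>h. - Im (deriv (deriv f) z) * Re h + - Re (deriv (deriv f) z) * Im h)) (at z)"
    if "z \<in> S" for z
    using has_derivative_Re[OF d[OF f that]] has_derivative_Re[OF d[OF f' that]]
      has_derivative_minus[OF has_derivative_Im[OF d[OF f' that]]]
    by (simp_all add: algebra_simps)
  note d3 = this
  show ?thesis
    unfolding harmonic_on_def
  proof (intro conjI S)
    show "\<exists>p q pxx pxy qyx qyy.
        (\<forall>z\<in>S. ((\<lambda>z. Re (f z)) has_derivative (\<lambda>h. p z * Re h + q z * Im h)) (at z) \<and>
               (p has_derivative (\<lambda>h. pxx z * Re h + pxy z * Im h)) (at z) \<and>
               (q has_derivative (\<lambda>h. qyx z * Re h + qyy z * Im h)) (at z)) \<and>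
        continuous_on S pxx \<and> continuous_on S pxy \<and> continuous_on S qyx \<and> continuous_on S qyy \<and>
        (\<forall>z\<in>S. pxx z + qyy z = 0)"
      by (rule exI[of _ "\<lambda>z. Re (deriv f z)"], rule exI[of _ "\<lambda>z. - Im (deriv f z)"],
          rule exI[of _ "\<lambda>z. Re (deriv (deriv f) z)"], rule exI[of _ "\<lambda>z. - Im (deriv (deriv f) z)"],
          rule exI[of _ "\<lambda>z. - Im (deriv (deriv f) z)"], rule exI[of _ "\<lambda>z. - Re (deriv (deriv f) z)"])
        (intro conjI ballI continuous_intros c d3; simp)
  qed
qed

lemma Re_poly_in_nadirashvili_class:
  fixes p :: "complex poly"
  assumes "degree p \<le> n" "2 * n \<le> d" "poly p 0 = 0" "z \<in> ball 0 1" "Re (poly p z) \<noteq> 0" "Re (poly p (cis \<alpha>)) \<noteq> 0"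
  shows "(\<lambda>z. Re (poly p z)) \<in> nadirashvili_class d"
proof -
  have "sign_changes (\<lambda>z. Re (poly p z)) \<le> enat (2 * n)" by (rule sign_changes_Re_poly_le) fact+
  also have "\<dots> \<le> enat d" using assms by simp
  finally have sc: "sign_changes (\<lambda>z. Re (poly p z)) \<le> enat d" .
  have "(\<lambda>z. poly p z) holomorphic_on ball 0 1" by (intro holomorphic_intros)
  then have "harmonic_on (\<lambda>z. Re (poly p z)) (ball 0 1)" by (rule harmonic_on_Re_holomorphic) simp
  then show ?thesis
    using sc assms by (auto simp: nadirashvili_class_def intro!: continuous_intros)
qed

text \<open>The integral \<open>\<integral>\<^sub>0\<^sup>\<infinity> t powr (- t) * exp (w * t) dt\<close> after the substitution
  \<open>t = exp s\<close>, truncated. Turning the line of integration to \<open>Im s = pi / 2\<close> shows that it is bounded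
  for \<open>Im w \<ge> 3\<close>, whereas it grows doubly exponentially on the positive real axis.\<close>

definition strip_kernel :: "complex \<Rightarrow> complex \<Rightarrow> complex" where
  "strip_kernel w s = exp ((w - s) * exp s + s)"

text \<open>A primitive gives path independence, so the integral is the one over the line
  \<open>Im s = pi / 2\<close> plus two vertical edges, whence \<open>1 + 2 + 2\<close>. On the
  shifted line \<open>exp s\<close> turns into \<open>\<i> * exp s\<close> and the modulus becomes
  \<open>exp s * exp (- c * exp s)\<close> with \<open>c = Im w - pi / 2\<close>;
  \<open>Im w \<ge> 3\<close> ensures \<open>c \<ge> 1\<close>.\<close>

lemma strip_integral_bound_upper:
  assumes R: "R \<ge> 3" "cmod w + 3 \<le> R" and w: "Im w \<ge> 3"
  shows "cmod (integral {- R..R} (\<lambda>s. strip_kernel w (of_real s))) \<le> 5"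
proof -
  define f where "f = strip_kernel w"
  have fh: "f holomorphic_on UNIV" unfolding f_def strip_kernel_def[abs_def] by (intro holomorphic_intros)
  obtain g where g: "\<And>x. (g has_field_derivative f x) (at x)"
    using holomorphic_convex_primitive'[OF convex_UNIV open_UNIV fh] by auto
  define b where "b = \<i> * of_real (pi / 2)"
  have nf: "cmod (f s) = exp (Re ((w - s) * exp s) + Re s)" for s
    by (simp add: f_def strip_kernel_def norm_exp_eq_Re)
  have line: "((\<lambda>s. f (of_real s + c)) has_integral g (of_real R + c) - g (of_real (- R) + c)) {- R..R}" for c
  proof (rule fundamental_theorem_of_calculus)
    fix x :: real
    have "((\<lambda>x. of_real x + c) has_vector_derivative 1) (at x)"
      by (auto intro!: derivative_eq_intros)
    from field_vector_diff_chain_at[OF this g]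
    show "((\<lambda>s. g (of_real s + c)) has_vector_derivative f (of_real x + c)) (at x within {- R..R})"
      by (simp add: o_def has_vector_derivative_at_within)
  qed (use R in simp)
  have pi: "pi / 2 < 2" "0 < pi / 2" using pi_less_4 by auto
  have edge: "cmod (g (of_real a + b) - g (of_real a)) \<le> 2"
    if "\<And>\<tau>. 0 \<le> \<tau> \<Longrightarrow> \<tau> \<le> pi / 2 \<Longrightarrow> cmod (f (Complex a \<tau>)) \<le> 1" for a
  proof -
    have "cmod (g (of_real a + b) - g (of_real a)) \<le> 1 * cmod (of_real a + b - of_real a)"
    proof (rule field_differentiable_bound[of "closed_segment (of_real a) (of_real a + b)" g f])
      fix z assume "z \<in> closed_segment (of_real a) (of_real a + b)"
      then obtain u where u: "0 \<le> u" "u \<le> 1" "z = of_real a + of_real u * b"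
        unfolding closed_segment_def by (auto simp: scaleR_conv_of_real algebra_simps)
      then have "z = Complex a (u * (pi / 2))" by (simp add: complex_eq_iff b_def)
      moreover have "u * (pi / 2) \<le> 1 * (pi / 2)" using u pi by (intro mult_right_mono) auto
      ultimately show "cmod (f z) \<le> 1" using that[of "u * (pi / 2)"] u by simp
    qed (use g in \<open>auto intro: has_field_derivative_at_within\<close>)
    also have "\<dots> \<le> 2" using pi by (simp add: b_def norm_mult)
    finally show ?thesis .
  qed
  have expR: "exp R \<ge> 1 + R" by (rule exp_ge_add_one_self)
  \<comment> \<open>Near \<open>Im s = 0\<close> the decay comes from
    \<open>Re w - R \<le> -1\<close>, near \<open>Im s = pi / 2\<close> from
    \<open>Im w - \<tau> \<ge> 1\<close>; together they give at least
    \<open>sin \<tau> + cos \<tau> \<ge> 1\<close>.\<close>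
  have right: "cmod (g (of_real R + b) - g (of_real R)) \<le> 2"
  proof (rule edge)
    fix \<tau> :: real assume \<tau>: "0 \<le> \<tau>" "\<tau> \<le> pi / 2"
    have sc: "0 \<le> sin \<tau>" "0 \<le> cos \<tau>" using \<tau> by (auto intro!: sin_ge_zero cos_ge_zero)
    have "1 \<le> (sin \<tau> + cos \<tau>)\<^sup>2" using sc sin_cos_squared_add[of \<tau>] by (simp add: power2_sum)
    then have "1\<^sup>2 \<le> (sin \<tau> + cos \<tau>)\<^sup>2" by simp
    then have sc1: "1 \<le> sin \<tau> + cos \<tau>" using sc by (intro power2_le_imp_le[of 1]) auto
    have "Re w \<le> R - 3" using R abs_Re_le_cmod[of w] by linarith
    then have x: "(Re w - R) * cos \<tau> \<le> (-1) * cos \<tau>" using sc by (intro mult_right_mono) auto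
    have y: "1 * sin \<tau> \<le> (Im w - \<tau>) * sin \<tau>" using sc w \<tau> pi by (intro mult_right_mono) auto
    have "Re ((w - Complex R \<tau>) * exp (Complex R \<tau>)) = exp R * ((Re w - R) * cos \<tau> - (Im w - \<tau>) * sin \<tau>)"
      by (simp add: Re_exp Im_exp algebra_simps)
    also have "\<dots> \<le> exp R * (-1)" using x y sc1 by (intro mult_left_mono) auto
    finally have "Re ((w - Complex R \<tau>) * exp (Complex R \<tau>)) + Re (Complex R \<tau>) \<le> 0"
      using expR by (simp only: complex.sel)
    then show "cmod (f (Complex R \<tau>)) \<le> 1" unfolding nf by simp
  qed
  \<comment> \<open>Here \<open>exp s\<close> has modulus \<open>exp (- R)\<close> and makes the
    product with \<open>w - s\<close> at most 2; the factor \<open>exp s\<close> in the kernel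
    compensates this as \<open>R \<ge> 3\<close>.\<close>
  have left: "cmod (g (of_real (- R) + b) - g (of_real (- R))) \<le> 2"
  proof (rule edge)
    fix \<tau> :: real assume \<tau>: "0 \<le> \<tau>" "\<tau> \<le> pi / 2"
    have "cmod (w - Complex (- R) \<tau>) \<le> cmod w + (R + 2)"
    proof -
      have "cmod (Complex (- R) \<tau>) \<le> \<bar>- R\<bar> + \<bar>\<tau>\<bar>" using cmod_le[of "Complex (- R) \<tau>"] by simp
      then show ?thesis using norm_triangle_ineq4[of w "Complex (- R) \<tau>"] \<tau> pi R by linarith
    qed
    also have "\<dots> \<le> 2 * exp R" using R expR by linarith
    finally have "cmod (w - Complex (- R) \<tau>) * exp (- R) \<le> 2 * exp R * exp (- R)" by (intro mult_right_mono) auto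
    moreover have "2 * exp R * exp (- R) = 2" by (simp add: exp_minus)
    moreover have "cmod ((w - Complex (- R) \<tau>) * exp (Complex (- R) \<tau>)) = cmod (w - Complex (- R) \<tau>) * exp (- R)"
      by (simp add: norm_mult norm_exp_eq_Re)
    ultimately have "cmod ((w - Complex (- R) \<tau>) * exp (Complex (- R) \<tau>)) \<le> 2"
      by (simp only:)
    then have "Re ((w - Complex (- R) \<tau>) * exp (Complex (- R) \<tau>)) \<le> 2"
      using complex_Re_le_cmod order_trans by blast
    then show "cmod (f (Complex (- R) \<tau>)) \<le> 1" unfolding nf using R by simp
  qed
  define c where "c = Im w - pi / 2"
  have c: "c \<ge> 1" using w pi by (simp add: c_def)
  have top: "cmod (g (of_real R + b) - g (of_real (- R) + b)) \<le> 1"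
  proof -
    have "((\<lambda>s. exp s * exp (- c * exp s)) has_integral (- exp (- c * exp R) / c) - (- exp (- c * exp (- R)) / c)) {- R..R}"
      using R c by (intro fundamental_theorem_of_calculus)
        (auto simp: has_real_derivative_iff_has_vector_derivative[symmetric] intro!: derivative_eq_intros)
    then have I: "(\<lambda>s. exp s * exp (- c * exp s)) integrable_on {- R..R}"
      "integral {- R..R} (\<lambda>s. exp s * exp (- c * exp s)) = (exp (- c * exp (- R)) - exp (- c * exp R)) / c"
      by (auto simp: integral_unique has_integral_integrable diff_divide_distrib)
    have "cmod (integral {- R..R} (\<lambda>s. f (of_real s + b))) \<le> integral {- R..R} (\<lambda>s. exp s * exp (- c * exp s))"
    proof (rule integral_norm_bound_integral[OF has_integral_integrable[OF line] I(1)])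
      fix s :: real
      have eb: "exp (complex_of_real s + b) = \<i> * of_real (exp s)"
        by (simp add: exp_add b_def cis_conv_exp[symmetric] complex_eq_iff Re_exp Im_exp)
      have re: "Re ((w - (of_real s + b)) * exp (of_real s + b)) = - c * exp s"
        unfolding eb by (simp add: b_def c_def algebra_simps)
      have "cmod (f (of_real s + b)) = exp (- c * exp s + Re (of_real s + b))" unfolding nf re ..
      also have "\<dots> = exp s * exp (- c * exp s)" by (simp add: b_def exp_add[symmetric])
      finally show "cmod (f (of_real s + b)) \<le> exp s * exp (- c * exp s)" by simp
    qed
    also have "\<dots> \<le> 1"
    proof -
      have "exp (- c * exp (- R)) \<le> 1" using c by simp
      moreover have "exp (- c * exp R) \<ge> 0" by simp
      ultimately have "exp (- c * exp (- R)) - exp (- c * exp R) \<le> c" using c by linarith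
      then show ?thesis unfolding I(2) using c by (simp add: divide_le_eq)
    qed
    finally show ?thesis using line[of b] by (simp add: integral_unique)
  qed
  have "integral {- R..R} (\<lambda>s. f (of_real s)) = (g (of_real R + b) - g (of_real (- R) + b))
      - (g (of_real R + b) - g (of_real R)) + (g (of_real (- R) + b) - g (of_real (- R)))"
    using line[of 0] by (simp add: integral_unique)
  also have "cmod \<dots> \<le> 1 + 2 + 2"
    by (intro norm_triangle_le add_mono norm_triangle_le_diff top right left)
  finally show ?thesis by (simp add: f_def)
qed

lemma strip_integral_bound:
  assumes R: "R \<ge> 3" "cmod w + 3 \<le> R" and w: "\<bar>Im w\<bar> \<ge> 3"
  shows "cmod (integral {- R..R} (\<lambda>s. strip_kernel w (of_real s))) \<le> 5"
proof (cases "Im w \<ge> 3")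
  case True
  then show ?thesis using strip_integral_bound_upper R by blast
next
  case False
  then have "cmod (integral {- R..R} (\<lambda>s. strip_kernel (cnj w) (of_real s))) \<le> 5"
    using w R by (intro strip_integral_bound_upper) auto
  moreover have "strip_kernel (cnj w) (of_real s) = cnj (strip_kernel w (of_real s))" for s
    by (simp add: strip_kernel_def exp_cnj)
  moreover have "integral {- R..R} (\<lambda>s. cnj (strip_kernel w (of_real s))) = cnj (integral {- R..R} (\<lambda>s. strip_kernel w (of_real s)))"
    by (simp add: integral_cnj)
  ultimately show ?thesis by simp
qed

text \<open>One term of the exponential series at \<open>exp 1 * x\<close> is at most its sum, and
  \<open>exp 1 \<le> 3\<close>; dividing by \<open>exp n\<close> brings in the decay.\<close>

lemma power_over_fact_le:
  assumes "x \<ge> 0"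
  shows "x ^ n / fact n \<le> exp (3 * x - real n)"
proof -
  have "(exp 1 * x) ^ n / fact n \<le> exp (exp 1 * x)"
  proof -
    define y where "y = exp 1 * x"
    have "(\<Sum>k\<in>{n}. y ^ k /\<^sub>R fact k) \<le> (\<Sum>k. y ^ k /\<^sub>R fact k)"
      using assms by (intro sum_le_suminf[OF summable_exp_generic]) (auto simp: y_def)
    then show ?thesis unfolding y_def[symmetric] by (simp add: exp_def divide_inverse mult.commute)
  qed
  also have "\<dots> \<le> exp (3 * x)" using exp_le assms by (simp add: mult_right_mono)
  finally have "exp (- real n) * ((exp 1 * x) ^ n / fact n) \<le> exp (- real n) * exp (3 * x)"
    by (intro mult_left_mono) auto
  moreover have "exp (- real n) * ((exp 1 * x) ^ n / fact n) = x ^ n / fact n"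
    by (simp add: power_mult_distrib exp_minus exp_of_nat_mult[symmetric])
  moreover have "exp (- real n) * exp (3 * x) = exp (3 * x - real n)" by (simp add: exp_add[symmetric])
  ultimately show ?thesis by simp
qed

text \<open>The polynomial is the truncated Taylor series of the strip integral about 4, without its
  constant term. Off the strip the integral is at most 5 in modulus and truncation adds at most 1,
  whereas the removed value at the centre is at least 8; hence the real part is negative
  there.\<close>

lemma strip_polynomial:
  assumes R: "R \<ge> 13" and n: "real n \<ge> 8 * exp (2 * R)"
  obtains p :: "complex poly" where "degree p \<le> n" "poly p 0 = 0"
    "\<And>z. cmod z \<le> 1 \<Longrightarrow> (R - 7) * \<bar>Im z\<bar> \<ge> 3 \<Longrightarrow> Re (poly p z) < 0"
proof -
  \<comment> \<open>\<open>7 = 4 + 3\<close>: the centre 4 and the margin 3 in the hypothesis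
    \<open>cmod w + 3 \<le> R\<close> of the strip bound.\<close>
  define D where "D = R - 7"
  have D: "D > 0" using R by (simp add: D_def)
  define g where "g s = exp ((4 - s) * exp s + s)" for s :: real
  have gc: "continuous_on A g" for A unfolding g_def[abs_def] by (intro continuous_intros)
  define c where "c k = integral {- R..R} (\<lambda>s. exp s ^ k * g s)" for k
  define F where "F \<zeta> = integral {- R..R} (\<lambda>s. strip_kernel (4 + \<zeta>) (of_real s))" for \<zeta>
  define T where "T \<zeta> s = (\<Sum>k\<le>n. (\<zeta> * of_real (exp s)) ^ k / fact k) * complex_of_real (g s)" for \<zeta> and s :: real
  have kernel: "strip_kernel (4 + \<zeta>) (of_real s) = exp (\<zeta> * of_real (exp s)) * of_real (g s)" for \<zeta> s
  proof -
    have "strip_kernel (4 + \<zeta>) (of_real s) = exp (\<zeta> * of_real (exp s) + of_real ((4 - s) * exp s + s))"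
      by (simp add: strip_kernel_def exp_of_real algebra_simps)
    also have "\<dots> = exp (\<zeta> * of_real (exp s)) * of_real (g s)" unfolding exp_add g_def exp_of_real ..
    finally show ?thesis .
  qed
  define Y where "Y = exp R"
  have Y: "Y \<ge> 1 + R" unfolding Y_def by (rule exp_ge_add_one_self)
  have Y2: "Y\<^sup>2 = exp (2 * R)" by (simp add: Y_def exp_double)
  have YY: "4 + R \<le> Y"
  proof -
    have "(1 + R / 2)\<^sup>2 \<le> (exp (R / 2))\<^sup>2" using R exp_ge_add_one_self[of "R / 2"] by (intro power_mono) auto
    moreover have "(exp (R / 2))\<^sup>2 = Y" by (simp add: Y_def exp_double[symmetric])
    moreover have "(1 + R / 2)\<^sup>2 = 1 + R + R * R / 4" by (simp add: power2_eq_square field_simps)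
    moreover have "R * R \<ge> 13 * R" using R by (intro mult_right_mono) auto
    ultimately show ?thesis using R by linarith
  qed
  have YleY2: "Y \<le> Y\<^sup>2" using Y R self_le_power[of Y 2] by simp
  have err: "cmod (F \<zeta> - integral {- R..R} (T \<zeta>)) \<le> 1" if \<zeta>: "cmod \<zeta> \<le> D" for \<zeta>
  proof -
    have iF: "(\<lambda>s. strip_kernel (4 + \<zeta>) (of_real s)) integrable_on {- R..R}"
      unfolding strip_kernel_def by (intro integrable_continuous_real continuous_intros)
    have iT: "T \<zeta> integrable_on {- R..R}"
      unfolding T_def[abs_def] by (intro integrable_continuous_real continuous_intros gc) auto
    define X where "X = D * Y"
    have X: "0 \<le> X" "X \<le> Y\<^sup>2"
    proof -
      show "0 \<le> X" using D Y R by (simp add: X_def)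
      have "D * Y \<le> Y * Y" using Y R by (intro mult_right_mono) (auto simp: D_def)
      then show "X \<le> Y\<^sup>2" by (simp add: X_def power2_eq_square)
    qed
    \<comment> \<open>Exponents in units of \<open>Y^2\<close>: 4 from the Taylor remainder, 1 for
      the factor \<open>Y^2\<close> and 2 for \<open>g\<close> are collected in \<open>M\<close>;
      the length \<open>2 * R\<close> of the interval adds 1. The total 8 is the constant in the
      hypothesis on \<open>n\<close>.\<close>
    define M where "M = exp (4 * Y\<^sup>2 - real n) * exp (3 * Y\<^sup>2)"
    have "cmod (integral {- R..R} (\<lambda>s. strip_kernel (4 + \<zeta>) (of_real s) - T \<zeta> s)) \<le> integral {- R..R} (\<lambda>s. M)"
    proof (rule integral_norm_bound_integral)
      show "(\<lambda>s. strip_kernel (4 + \<zeta>) (of_real s) - T \<zeta> s) integrable_on {- R..R}"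
        by (intro integrable_diff iF iT)
      show "(\<lambda>s. M) integrable_on {- R..R}" by (intro integrable_continuous_real continuous_intros)
      fix s assume s: "s \<in> {- R..R}"
      define z where "z = \<zeta> * of_real (exp s)"
      have es: "exp s \<le> Y" using s by (simp add: Y_def)
      have z: "cmod z \<le> X"
        unfolding z_def X_def norm_mult using \<zeta> es D by (intro mult_mono) auto
      have "cmod (exp z - (\<Sum>k\<le>n. z ^ k / fact k)) \<le> exp (cmod z) * cmod z ^ Suc n / fact n"
        by (rule Taylor_exp_field)
      also have "\<dots> \<le> exp X * X ^ Suc n / fact n"
        using z X by (intro divide_right_mono mult_mono power_mono) auto
      also have "\<dots> = exp X * X * (X ^ n / fact n)" by simp
      also have "\<dots> \<le> exp X * X * exp (3 * X - real n)"
        using X by (intro mult_left_mono power_over_fact_le) auto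
      also have "\<dots> \<le> exp (Y\<^sup>2) * Y\<^sup>2 * exp (3 * Y\<^sup>2 - real n)"
        using X by (intro mult_mono) auto
      also have "\<dots> = Y\<^sup>2 * exp (4 * Y\<^sup>2 - real n)" by (simp add: exp_add[symmetric])
      finally have 1: "cmod (exp z - (\<Sum>k\<le>n. z ^ k / fact k)) \<le> Y\<^sup>2 * exp (4 * Y\<^sup>2 - real n)" .
      have "(4 - s) * exp s \<le> (4 + R) * Y" using s es R by (intro mult_mono) auto
      also have "\<dots> \<le> Y * Y" using YY Y R by (intro mult_right_mono) auto
      finally have "(4 - s) * exp s \<le> Y\<^sup>2" by (simp add: power2_eq_square)
      moreover have "s \<le> Y\<^sup>2" using s Y YleY2 by auto
      ultimately have "(4 - s) * exp s + s \<le> Y\<^sup>2 + Y\<^sup>2" by linarith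
      then have 2: "g s \<le> exp (2 * Y\<^sup>2)" by (simp add: g_def)
      have "cmod (strip_kernel (4 + \<zeta>) (of_real s) - T \<zeta> s) = cmod (exp z - (\<Sum>k\<le>n. z ^ k / fact k)) * g s"
      proof -
        have "strip_kernel (4 + \<zeta>) (of_real s) - T \<zeta> s = (exp z - (\<Sum>k\<le>n. z ^ k / fact k)) * of_real (g s)"
          by (simp add: kernel T_def z_def left_diff_distrib)
        then show ?thesis by (simp add: norm_mult g_def)
      qed
      also have "\<dots> \<le> (Y\<^sup>2 * exp (4 * Y\<^sup>2 - real n)) * exp (2 * Y\<^sup>2)"
        using 1 2 by (intro mult_mono) (auto simp: g_def)
      also have "\<dots> \<le> (exp (Y\<^sup>2) * exp (4 * Y\<^sup>2 - real n)) * exp (2 * Y\<^sup>2)"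
      proof -
        have "Y\<^sup>2 \<le> exp (Y\<^sup>2)" using exp_ge_add_one_self[of "Y\<^sup>2"] by linarith
        then show ?thesis by (intro mult_right_mono) auto
      qed
      also have "\<dots> = M" by (simp add: M_def exp_add[symmetric])
      finally show "cmod (strip_kernel (4 + \<zeta>) (of_real s) - T \<zeta> s) \<le> M" .
    qed
    also have "\<dots> = 2 * R * M" using R by simp
    also have "\<dots> \<le> exp (Y\<^sup>2) * M"
    proof (rule mult_right_mono)
      have "2 * R \<le> Y * Y" using Y R by (intro mult_mono) auto
      then have "2 * R \<le> Y\<^sup>2" by (simp add: power2_eq_square)
      then show "2 * R \<le> exp (Y\<^sup>2)" using exp_ge_add_one_self[of "Y\<^sup>2"] by linarith
    qed (simp add: M_def)
    also have "\<dots> = exp (8 * Y\<^sup>2 - real n)" by (simp add: M_def exp_add[symmetric])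
    also have "\<dots> \<le> 1" using n by (simp add: Y2)
    finally show ?thesis using Henstock_Kurzweil_Integration.integral_diff[OF iF iT] by (simp add: F_def)
  qed
  have T_poly: "integral {- R..R} (T \<zeta>) = (\<Sum>k\<le>n. of_real (c k / fact k) * \<zeta> ^ k)" for \<zeta>
  proof -
    have "T \<zeta> s = (\<Sum>k\<le>n. \<zeta> ^ k / fact k * of_real (exp s ^ k * g s))" for s
      by (simp add: T_def sum_distrib_right power_mult_distrib mult.assoc)
    then have "T \<zeta> = (\<lambda>s. \<Sum>k\<le>n. \<zeta> ^ k / fact k * of_real (exp s ^ k * g s))" by (rule ext)
    then have "integral {- R..R} (T \<zeta>) = integral {- R..R} (\<lambda>s. \<Sum>k\<le>n. \<zeta> ^ k / fact k * of_real (exp s ^ k * g s))"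
      by (simp only:)
    also have "\<dots> = (\<Sum>k\<le>n. integral {- R..R} (\<lambda>s. \<zeta> ^ k / fact k * complex_of_real (exp s ^ k * g s)))"
      by (intro integral_sum integrable_continuous_real continuous_intros gc) auto
    also have "\<dots> = (\<Sum>k\<le>n. of_real (c k / fact k) * \<zeta> ^ k)"
    proof (rule sum.cong)
      fix k
      have "(\<lambda>s. exp s ^ k * g s) integrable_on {- R..R}"
        by (intro integrable_continuous_real continuous_intros gc)
      then have "integral {- R..R} (\<lambda>s. complex_of_real (exp s ^ k * g s)) = of_real (c k)"
        using integral_linear[OF _ bounded_linear_of_real[where 'a=complex], of "\<lambda>s. exp s ^ k * g s" "{- R..R}"]
        by (simp add: o_def c_def)
      then show "integral {- R..R} (\<lambda>s. \<zeta> ^ k / fact k * complex_of_real (exp s ^ k * g s)) = of_real (c k / fact k) * \<zeta> ^ k"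
        by simp
    qed simp
    finally show ?thesis .
  qed
  \<comment> \<open>Already the interval \<open>{0..1}\<close> suffices, where the exponent of
    \<open>g\<close> is at least 3 because of the centre 4.\<close>
  have c0: "8 \<le> c 0"
  proof -
    have "(8::real) \<le> exp 3" using exp_lower_Taylor_quadratic[of "3::real"] by simp
    also have "exp 3 = integral {0..1} (\<lambda>s::real. exp (3::real))" by simp
    also have "\<dots> \<le> integral {0..1} g"
    proof (rule integral_le)
      show "g integrable_on {0..1}" by (intro integrable_continuous_real gc)
      fix s :: real assume s: "s \<in> {0..1}"
      have "3 * 1 \<le> (4 - s) * exp s" using s by (intro mult_mono) auto
      then show "exp 3 \<le> g s" using s by (simp add: g_def)
    qed auto
    also have "\<dots> \<le> integral {- R..R} g"
      using R by (intro integral_subset_le integrable_continuous_real gc) (auto simp: g_def)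
    finally show ?thesis by (simp add: c_def)
  qed
  define p where "p = (\<Sum>k\<in>{1..n}. monom (complex_of_real (c k / fact k * D ^ k)) k)"
  have poly_p: "poly p z = integral {- R..R} (T (of_real D * z)) - of_real (c 0)" for z
  proof -
    have "{..n} = insert 0 {1..n}" by auto
    then show ?thesis
      unfolding T_poly p_def by (simp add: poly_sum poly_monom power_mult_distrib mult_ac)
  qed
  show thesis
  proof (rule that[of p])
    show "degree p \<le> n" unfolding p_def by (intro degree_sum_le) (auto intro: order_trans[OF degree_monom_le])
    show "poly p 0 = 0" unfolding p_def by (simp add: poly_sum poly_monom)
    fix z :: complex assume z: "cmod z \<le> 1" "(R - 7) * \<bar>Im z\<bar> \<ge> 3"
    define \<zeta> where "\<zeta> = of_real D * z"
    have \<zeta>: "cmod \<zeta> \<le> D" using z D mult_left_mono[of "cmod z" 1 D] by (simp add: \<zeta>_def norm_mult)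
    have "cmod (F \<zeta>) \<le> 5"
      unfolding F_def
    proof (rule strip_integral_bound)
      show "cmod (4 + \<zeta>) + 3 \<le> R" using norm_triangle_ineq[of 4 \<zeta>] \<zeta> by (simp add: D_def)
      show "3 \<le> \<bar>Im (4 + \<zeta>)\<bar>" using z D by (simp add: \<zeta>_def D_def abs_mult)
    qed (use R in simp)
    then have "cmod (integral {- R..R} (T \<zeta>)) \<le> 6"
      using err[OF \<zeta>] norm_triangle_ineq2[of "integral {- R..R} (T \<zeta>)" "F \<zeta>"] by (simp add: norm_minus_commute)
    then have "Re (integral {- R..R} (T \<zeta>)) \<le> 6" using complex_Re_le_cmod order_trans by blast
    then show "Re (poly p z) < 0" using c0 unfolding poly_p \<zeta>_def[symmetric] by simp
  qed
qed

section \<open>The upper bound for the constant\<close>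

lemma nadirashvili_constant_le:
  assumes "u \<in> nadirashvili_class d"
  shows "nadirashvili_constant d \<le> measure lebesgue {z \<in> ball 0 1. u z > 0}"
  unfolding nadirashvili_constant_def
  by (rule cINF_lower[OF _ assms]) (auto intro!: bdd_belowI[of _ 0])

lemma measure_lebesgue_subset_cbox:
  assumes u: "u \<in> nadirashvili_class d" and b: "b \<ge> 0" and sub: "{z \<in> ball 0 1. u z > 0} \<subseteq> {z. \<bar>Im z\<bar> \<le> b}"
  shows "measure lebesgue {z \<in> ball 0 1. u z > 0} \<le> 4 * b"
proof -
  have "continuous_on (ball 0 1) u"
    using u continuous_on_subset[of "cball 0 1" u "ball 0 1"] by (auto simp: nadirashvili_class_def)
  then have o: "open {z \<in> ball 0 1. u z > 0}"
    using continuous_open_preimage[OF _ open_ball, of 0 1 u "{0<..}"] by (simp add: vimage_def Int_def conj_commute)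
  have "{z \<in> ball 0 1. u z > 0} \<subseteq> cbox (Complex (-1) (- b)) (Complex 1 b)"
  proof
    fix z assume z: "z \<in> {z \<in> ball 0 1. u z > 0}"
    then have "\<bar>Im z\<bar> \<le> b" "\<bar>Re z\<bar> \<le> 1" using sub abs_Re_le_cmod[of z] by auto
    then show "z \<in> cbox (Complex (-1) (- b)) (Complex 1 b)" by (auto simp: in_cbox_complex_iff)
  qed
  then have "measure lebesgue {z \<in> ball 0 1. u z > 0} \<le> measure lebesgue (cbox (Complex (-1) (- b)) (Complex 1 b))"
    using o by (intro measure_mono_fmeasurable) auto
  also have "\<dots> = measure lborel (cbox (Complex (-1) (- b)) (Complex 1 b))"
    by (simp add: measure_completion)
  also have "\<dots> = 4 * b"
    using b by (subst content_cbox) (auto simp: Basis_complex_def)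
  finally show ?thesis .
qed

lemma nadirashvili_class_has_Re:
  assumes "d \<ge> 2"
  shows "Re \<in> nadirashvili_class d"
  using Re_poly_in_nadirashvili_class[of "[:0, 1:]" 1 d "1 / 2" 0] assms by (simp add: eta_contract_eq)

text \<open>The threshold 30 is where \<open>R \<ge> 13\<close> becomes available, using
  \<open>ln 40 \<le> 4\<close>. Below it the area bound 4 suffices since
  \<open>120 = 4 * 30\<close>; above it the strip has area at most \<open>12 / (R - 7)\<close>, and
  \<open>ln d \<le> 10 * (R - 7)\<close>.\<close>

lemma nadirashvili_constant_upper_bound:
  assumes d: "d \<ge> 2"
  shows "nadirashvili_constant d \<le> 120 / ln (real d)"
proof -
  have lnd: "ln (real d) > 0" using d by simp
  have ln40: "ln (40::real) \<le> 4"
  proof -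
    have "(1 + 1/4 + (1/4)\<^sup>2/2) \<le> exp (1/4::real)" by (rule exp_lower_Taylor_quadratic) simp
    then have "(41/32 :: real) ^ 16 \<le> exp (1/4) ^ 16" by (intro power_mono) (auto simp: power2_eq_square)
    also have "exp (1/4::real) ^ 16 = exp 4" by (simp add: exp_of_nat_mult[symmetric])
    finally have "(40::real) \<le> exp 4" by (rule order_trans[rotated]) (simp add: power_divide)
    then have "ln 40 \<le> ln (exp (4::real))" by (intro ln_mono) auto
    then show ?thesis by simp
  qed
  show ?thesis
  proof (cases "ln (real d) \<le> 30")
    case True
    have "nadirashvili_constant d \<le> measure lebesgue {z \<in> ball 0 1. Re z > 0}"
      by (rule nadirashvili_constant_le[OF nadirashvili_class_has_Re[OF d]])
    also have "\<dots> \<le> 4 * 1"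
      by (rule measure_lebesgue_subset_cbox[OF nadirashvili_class_has_Re[OF d]])
        (auto intro: order_trans[OF abs_Im_le_cmod])
    also have "\<dots> \<le> 120 / ln (real d)" using True lnd by (simp add: field_simps)
    finally show ?thesis .
  next
    case False
    \<comment> \<open>This makes \<open>8 * exp (2 * R)\<close> equal to \<open>d / 5\<close>, which
      leaves room for rounding in \<open>d div 2\<close>.\<close>
    define R where "R = (ln (real d) - ln 40) / 2"
    have R: "R \<ge> 13" using False ln40 by (simp add: R_def)
    have "2 * R = ln (real d) - ln 40" unfolding R_def by simp
    then have eR: "exp (2 * R) = real d / 40" using d by (simp add: exp_diff)
    have n: "8 * exp (2 * R) \<le> real (d div 2)"
    proof -
      have "real d \<le> 2 * real (d div 2) + 1" by linarith
      moreover have "2 \<le> real d" using d by simp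
      ultimately show ?thesis unfolding eR by linarith
    qed
    obtain p :: "complex poly" where p: "degree p \<le> d div 2" "poly p 0 = 0"
      "\<And>z. cmod z \<le> 1 \<Longrightarrow> (R - 7) * \<bar>Im z\<bar> \<ge> 3 \<Longrightarrow> Re (poly p z) < 0"
      using strip_polynomial[OF R n] by blast
    define u where "u z = Re (poly p z)" for z
    \<comment> \<open>Both points lie off the strip, as \<open>(R - 7) / 2 \<ge> 3\<close>; they
      witness that \<open>u\<close> is not zero in the disc or on the circle.\<close>
    have 1: "Re (poly p (\<i> / 2)) < 0" "Re (poly p (cis (pi / 2))) < 0" using R by (intro p(3); simp)+
    have u: "u \<in> nadirashvili_class d"
      unfolding u_def using p 1
      by (intro Re_poly_in_nadirashvili_class[where n = "d div 2" and z = "\<i> / 2" and \<alpha> = "pi / 2"]) auto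
    have "nadirashvili_constant d \<le> measure lebesgue {z \<in> ball 0 1. u z > 0}"
      by (rule nadirashvili_constant_le[OF u])
    also have "\<dots> \<le> 4 * (3 / (R - 7))"
    proof (rule measure_lebesgue_subset_cbox[OF u])
      show "{z \<in> ball 0 1. u z > 0} \<subseteq> {z. \<bar>Im z\<bar> \<le> 3 / (R - 7)}"
      proof clarsimp
        fix z assume z: "cmod z < 1" "u z > 0"
        then have "\<not> (R - 7) * \<bar>Im z\<bar> \<ge> 3" using p(3)[of z] by (auto simp: u_def)
        then show "\<bar>Im z\<bar> \<le> 3 / (R - 7)" using R by (simp add: field_simps)
      qed
    qed (use R in simp)
    also have "\<dots> \<le> 120 / ln (real d)"
    proof -
      have "ln (real d) \<le> 10 * (R - 7)"
      proof -
        have "a \<le> 10 * ((a - b) / 2 - 7)" if "a > 30" "b \<le> 4" for a b :: real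
          using that by (simp add: field_simps)
        then show ?thesis using False ln40 unfolding R_def by simp
      qed
      then show ?thesis using R lnd by (simp add: field_simps)
    qed
    finally show ?thesis .
  qed
qed

section \<open>The Nadirashvili constant\<close>

theorem theorem1p8:
  shows "\<exists>C::real. C > 0 \<and>
    (\<forall>d::nat. d \<ge> 2 \<longrightarrow>
       inverse C / ln (real d) \<le> nadirashvili_constant d \<and>
       nadirashvili_constant d \<le> C / ln (real d))"
proof -
  obtain c where c: "c > 0" and lower: "\<And>d u. d \<ge> 2 \<Longrightarrow> u \<in> nadirashvili_class d \<Longrightarrow>
      c / ln (real d) \<le> measure lebesgue {z \<in> ball 0 1. u z > 0}"
    using nadirashvili_class_area_lower_bound by blast
  define C where "C = max 120 (inverse c)"
  have C: "C > 0" "inverse C \<le> c"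
  proof -
    show "C > 0" by (simp add: C_def)
    have "inverse c \<le> C" by (simp add: C_def)
    then have "inverse C \<le> inverse (inverse c)" using c by (intro le_imp_inverse_le) auto
    then show "inverse C \<le> c" by simp
  qed
  have "inverse C / ln (real d) \<le> nadirashvili_constant d \<and> nadirashvili_constant d \<le> C / ln (real d)"
    if d: "d \<ge> 2" for d :: nat
  proof
    have lnd: "ln (real d) > 0" using d by simp
    have "inverse C / ln (real d) \<le> c / ln (real d)" using C lnd by (intro divide_right_mono) auto
    also have "\<dots> \<le> nadirashvili_constant d"
      unfolding nadirashvili_constant_def
      using nadirashvili_class_has_Re[OF d] lower[OF d] by (intro cINF_greatest) auto
    finally show "inverse C / ln (real d) \<le> nadirashvili_constant d" .
    have "nadirashvili_constant d \<le> 120 / ln (real d)" by (rule nadirashvili_constant_upper_bound[OF d])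
    also have "\<dots> \<le> C / ln (real d)" using lnd by (intro divide_right_mono) (auto simp: C_def)
    finally show "nadirashvili_constant d \<le> C / ln (real d)" .
  qed
  then show ?thesis using C(1) by blast
qed

end
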